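(* Let $X$ be a connected topological space which is locally path-connected and semi-locally simply-connected, and let $x\in X$ be a base point. The fibre functor $\mathrm{Fib}_x$ induces an equivalence of categories between the category $\mathbf{Cov}(X)$ of covers of $X$ and the category of sets equipped with a left $\pi_1(X,x)$-action. Under this equivalence connected covers correspond to $\pi_1(X,x)$-sets with transitive action, and Galois covers correspond to coset spaces of normal subgroups.
   Context: A cover of $X$ is a continuous map $p:Y\to X$ such that every $x\in X$ has a neighbourhood $U$ with $p^{-1}(U)=\bigsqcup_{y\in p^{-1}(x)}V_y$, each $V_y$ open (with $y\in V_y$) and mapped homeomorphically onto $U$; morphisms of covers are continuous maps over $X$. $\mathrm{Fib}_x$ sends a cover $p:Y\to X$ to the fibre $p^{-1}(x)$ with the monodromy action $[\gamma]\cdot y=\widetilde{\gamma}_y(1)$, where $\widetilde{\gamma}_y$ is the unique lift of the loop $\gamma$ to $Y$ starting at $y$; the product $[\delta][\gamma]$ in $\pi_1(X,x)$ is taken to be "first $\gamma$, then $\delta$", so that this is a left action. $\operatorname{Aut}(Y|X)$ is the group of homeomorphisms of $Y$ over $X$; a cover is Galois if $Y$ is connected and the induced map $Y/\operatorname{Aut}(Y|X)\to X$ is a homeomorphism. *)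

theory Defs
  imports "HOL-Analysis.Analysis" "HOL-Algebra.Group_Action" "HOL-Algebra.Left_Coset"
begin

section \<open>Categories, functors, equivalences\<close>

text \<open>Hom-sets of different pairs of objects are not required to be disjoint; composition therefore
  takes the three objects as arguments: \<open>cmp C a b c g f\<close> is the composite of \<open>f : a \<rightarrow> b\<close> and
  \<open>g : b \<rightarrow> c\<close>. Nothing is said about the values of \<open>hm\<close>, \<open>idt\<close> and \<open>cmp\<close> outside \<open>ob C\<close>.\<close>

record ('o, 'm) cat =
  ob :: "'o set"
  hm :: "'o \<Rightarrow> 'o \<Rightarrow> 'm set"
  idt :: "'o \<Rightarrow> 'm"
  cmp :: "'o \<Rightarrow> 'o \<Rightarrow> 'o \<Rightarrow> 'm \<Rightarrow> 'm \<Rightarrow> 'm"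

definition is_category :: "('o, 'm) cat \<Rightarrow> bool" where
  "is_category C \<longleftrightarrow>
     (\<forall>a\<in>ob C. idt C a \<in> hm C a a) \<and>
     (\<forall>a\<in>ob C. \<forall>b\<in>ob C. \<forall>c\<in>ob C. \<forall>f\<in>hm C a b. \<forall>g\<in>hm C b c. cmp C a b c g f \<in> hm C a c) \<and>
     (\<forall>a\<in>ob C. \<forall>b\<in>ob C. \<forall>f\<in>hm C a b.
        cmp C a b b (idt C b) f = f \<and> cmp C a a b f (idt C a) = f) \<and>
     (\<forall>a\<in>ob C. \<forall>b\<in>ob C. \<forall>c\<in>ob C. \<forall>d\<in>ob C. \<forall>f\<in>hm C a b. \<forall>g\<in>hm C b c. \<forall>h\<in>hm C c d.
        cmp C a c d h (cmp C a b c g f) = cmp C a b d (cmp C b c d h g) f)"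

definition iso_arrow :: "('o, 'm) cat \<Rightarrow> 'o \<Rightarrow> 'o \<Rightarrow> 'm \<Rightarrow> bool" where
  "iso_arrow C a b f \<longleftrightarrow> f \<in> hm C a b \<and>
     (\<exists>g\<in>hm C b a. cmp C a b a g f = idt C a \<and> cmp C b a b f g = idt C b)"

record ('o, 'm, 'o2, 'm2) cat_functor =
  fob :: "'o \<Rightarrow> 'o2"
  far :: "'o \<Rightarrow> 'o \<Rightarrow> 'm \<Rightarrow> 'm2"

definition is_functor ::
  "('o, 'm) cat \<Rightarrow> ('o2, 'm2) cat \<Rightarrow> ('o, 'm, 'o2, 'm2) cat_functor \<Rightarrow> bool" where
  "is_functor C D F \<longleftrightarrow> is_category C \<and> is_category D \<and>
     (\<forall>a\<in>ob C. fob F a \<in> ob D) \<and>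
     (\<forall>a\<in>ob C. \<forall>b\<in>ob C. \<forall>f\<in>hm C a b. far F a b f \<in> hm D (fob F a) (fob F b)) \<and>
     (\<forall>a\<in>ob C. far F a a (idt C a) = idt D (fob F a)) \<and>
     (\<forall>a\<in>ob C. \<forall>b\<in>ob C. \<forall>c\<in>ob C. \<forall>f\<in>hm C a b. \<forall>g\<in>hm C b c.
        far F a c (cmp C a b c g f)
          = cmp D (fob F a) (fob F b) (fob F c) (far F b c g) (far F a b f))"

definition id_functor :: "('o, 'm, 'o, 'm) cat_functor" where
  "id_functor = \<lparr>fob = (\<lambda>a. a), far = (\<lambda>a b f. f)\<rparr>"

definition comp_functor ::
  "('o2, 'm2, 'o3, 'm3) cat_functor \<Rightarrow> ('o, 'm, 'o2, 'm2) cat_functor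
     \<Rightarrow> ('o, 'm, 'o3, 'm3) cat_functor" where
  "comp_functor G F =
     \<lparr>fob = (\<lambda>a. fob G (fob F a)), far = (\<lambda>a b f. far G (fob F a) (fob F b) (far F a b f))\<rparr>"

definition naturally_isomorphic ::
  "('o, 'm) cat \<Rightarrow> ('o2, 'm2) cat \<Rightarrow> ('o, 'm, 'o2, 'm2) cat_functor
     \<Rightarrow> ('o, 'm, 'o2, 'm2) cat_functor \<Rightarrow> bool" where
  "naturally_isomorphic C D F G \<longleftrightarrow>
     (\<exists>\<eta>. (\<forall>a\<in>ob C. iso_arrow D (fob F a) (fob G a) (\<eta> a)) \<and>
          (\<forall>a\<in>ob C. \<forall>b\<in>ob C. \<forall>f\<in>hm C a b.
             cmp D (fob F a) (fob F b) (fob G b) (\<eta> b) (far F a b f)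
               = cmp D (fob F a) (fob G a) (fob G b) (far G a b f) (\<eta> a)))"

definition equivalence_of_categories ::
  "('o, 'm) cat \<Rightarrow> ('o2, 'm2) cat \<Rightarrow> ('o, 'm, 'o2, 'm2) cat_functor \<Rightarrow> bool" where
  "equivalence_of_categories C D F \<longleftrightarrow> is_functor C D F \<and>
     (\<exists>G. is_functor D C G \<and>
          naturally_isomorphic C C (comp_functor G F) id_functor \<and>
          naturally_isomorphic D D (comp_functor F G) id_functor)"


section \<open>The fundamental group\<close>

definition loopin :: "'a topology \<Rightarrow> 'a \<Rightarrow> (real \<Rightarrow> 'a) \<Rightarrow> bool" where
  "loopin X x \<gamma> \<longleftrightarrow> pathin X \<gamma> \<and> \<gamma> 0 = x \<and> \<gamma> 1 = x"

definition loop_homotopic :: "'a topology \<Rightarrow> 'a \<Rightarrow> (real \<Rightarrow> 'a) \<Rightarrow> (real \<Rightarrow> 'a) \<Rightarrow> bool" where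
  "loop_homotopic X x = homotopic_with (\<lambda>g. g 0 = x \<and> g 1 = x) (top_of_set {0..1}) X"

definition loop_class :: "'a topology \<Rightarrow> 'a \<Rightarrow> (real \<Rightarrow> 'a) \<Rightarrow> (real \<Rightarrow> 'a) set" where
  "loop_class X x \<gamma> = {\<delta>. loop_homotopic X x \<gamma> \<delta>}"

text \<open>The same formula as \<^const>\<open>joinpaths\<close>, which is restricted to the type class
  \<^class>\<open>topological_space\<close>: first \<open>\<gamma>\<close>, then \<open>\<delta>\<close>.\<close>

definition path_concat :: "(real \<Rightarrow> 'a) \<Rightarrow> (real \<Rightarrow> 'a) \<Rightarrow> real \<Rightarrow> 'a" where
  "path_concat \<gamma> \<delta> = (\<lambda>t. if t \<le> 1/2 then \<gamma> (2 * t) else \<delta> (2 * t - 1))"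

text \<open>The product \<open>[\<delta>][\<gamma>]\<close> is the class of ``first \<open>\<gamma>\<close>, then \<open>\<delta>\<close>''. For two classes the union
  below is a union of equal sets.\<close>

definition pi1 :: "'a topology \<Rightarrow> 'a \<Rightarrow> (real \<Rightarrow> 'a) set monoid" where
  "pi1 X x =
     \<lparr>carrier = loop_class X x ` {\<gamma>. loopin X x \<gamma>},
      mult = (\<lambda>D C. \<Union>\<delta>\<in>D. \<Union>\<gamma>\<in>C. loop_class X x (path_concat \<gamma> \<delta>)),
      one = loop_class X x (\<lambda>t. x)\<rparr>"

definition semilocally_simply_connected_space :: "'a topology \<Rightarrow> bool" where
  "semilocally_simply_connected_space X \<longleftrightarrow>
     (\<forall>x\<in>topspace X. \<exists>U. openin X U \<and> x \<in> U \<and>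
        (\<forall>\<gamma>. loopin (subtopology X U) x \<gamma> \<longrightarrow> loop_homotopic X x \<gamma> (\<lambda>t. x)))"


section \<open>Covers\<close>

abbreviation fibre :: "'b topology \<Rightarrow> ('b \<Rightarrow> 'a) \<Rightarrow> 'a \<Rightarrow> 'b set" where
  "fibre Y p x \<equiv> {y \<in> topspace Y. p y = x}"

text \<open>Unlike in \<^const>\<open>covering_space\<close>, fibres may be empty, and the total space is an abstract
  topology.\<close>

definition cover :: "'a topology \<Rightarrow> 'b topology \<Rightarrow> ('b \<Rightarrow> 'a) \<Rightarrow> bool" where
  "cover X Y p \<longleftrightarrow> continuous_map Y X p \<and>
     (\<forall>x\<in>topspace X. \<exists>U V. openin X U \<and> x \<in> U \<and>
        {y \<in> topspace Y. p y \<in> U} = (\<Union>y\<in>fibre Y p x. V y) \<and>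
        disjoint_family_on V (fibre Y p x) \<and>
        (\<forall>y\<in>fibre Y p x. openin Y (V y) \<and> y \<in> V y \<and>
           homeomorphic_map (subtopology Y (V y)) (subtopology X U) p))"

text \<open>The category of covers whose total space has its points in the type \<open>'u\<close>. Maps are
  extensional, so that equality of HOL functions is equality of maps.\<close>

definition Cov ::
  "'a topology \<Rightarrow> ('u topology \<times> ('u \<Rightarrow> 'a), 'u \<Rightarrow> 'u) cat" where
  "Cov X =
     \<lparr>ob = {(Y, p). cover X Y p \<and> p \<in> extensional (topspace Y)},
      hm = (\<lambda>(Y, p) (Z, q). {f \<in> extensional (topspace Y).
              continuous_map Y Z f \<and> (\<forall>y\<in>topspace Y. q (f y) = p y)}),
      idt = (\<lambda>(Y, p). \<lambda>y\<in>topspace Y. y),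
      cmp = (\<lambda>(Y, p) _ _ g f. compose (topspace Y) g f)\<rparr>"

definition connected_cover :: "'a topology \<Rightarrow> 'b topology \<Rightarrow> ('b \<Rightarrow> 'a) \<Rightarrow> bool" where
  "connected_cover X Y p \<longleftrightarrow> cover X Y p \<and> connected_space Y \<and> topspace Y \<noteq> {}"

definition Deck :: "'b topology \<Rightarrow> ('b \<Rightarrow> 'a) \<Rightarrow> ('b \<Rightarrow> 'b) monoid" where
  "Deck Y p = (BijGroup (topspace Y))
     \<lparr>carrier := {f \<in> extensional (topspace Y).
        homeomorphic_map Y Y f \<and> (\<forall>y\<in>topspace Y. p (f y) = p y)}\<rparr>"

definition quotient_topology :: "'b topology \<Rightarrow> ('b \<Rightarrow> 'c) \<Rightarrow> 'c topology" where
  "quotient_topology Y q =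
     topology (\<lambda>U. U \<subseteq> q ` topspace Y \<and> openin Y {y \<in> topspace Y. q y \<in> U})"

lemma openin_quotient_topology:
  "openin (quotient_topology Y q) U \<longleftrightarrow>
     U \<subseteq> q ` topspace Y \<and> openin Y {y \<in> topspace Y. q y \<in> U}"
proof -
  have "istopology (\<lambda>U. U \<subseteq> q ` topspace Y \<and> openin Y {y \<in> topspace Y. q y \<in> U})"
    unfolding istopology_def
  proof (intro conjI allI impI)
    fix S T
    assume "S \<subseteq> q ` topspace Y \<and> openin Y {y \<in> topspace Y. q y \<in> S}"
      and "T \<subseteq> q ` topspace Y \<and> openin Y {y \<in> topspace Y. q y \<in> T}"
    moreover have "{y \<in> topspace Y. q y \<in> S \<inter> T}
        = {y \<in> topspace Y. q y \<in> S} \<inter> {y \<in> topspace Y. q y \<in> T}" by blast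
    ultimately show "S \<inter> T \<subseteq> q ` topspace Y" "openin Y {y \<in> topspace Y. q y \<in> S \<inter> T}"
      by auto
  next
    fix K
    assume K: "\<forall>S\<in>K. S \<subseteq> q ` topspace Y \<and> openin Y {y \<in> topspace Y. q y \<in> S}"
    have "{y \<in> topspace Y. q y \<in> \<Union>K} = (\<Union>S\<in>K. {y \<in> topspace Y. q y \<in> S})" by blast
    with K show "\<Union>K \<subseteq> q ` topspace Y" "openin Y {y \<in> topspace Y. q y \<in> \<Union>K}" by auto
  qed
  then show ?thesis
    by (simp add: quotient_topology_def topology_inverse')
qed

lemma quotient_map_quotient_topology: "quotient_map Y (quotient_topology Y q) q"
proof -
  have "{y \<in> topspace Y. q y \<in> q ` topspace Y} = topspace Y" by blast
  then have "openin (quotient_topology Y q) (q ` topspace Y)"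
    by (simp add: openin_quotient_topology)
  then have "topspace (quotient_topology Y q) = q ` topspace Y"
    by (metis openin_quotient_topology openin_subset openin_topspace subset_antisym)
  then show ?thesis
    by (simp add: quotient_map_def openin_quotient_topology)
qed

definition deck_quotient :: "'b topology \<Rightarrow> ('b \<Rightarrow> 'a) \<Rightarrow> 'b set topology" where
  "deck_quotient Y p = quotient_topology Y (orbit (Deck Y p) (\<lambda>f. f))"

text \<open>The induced map sends an orbit to the common value of \<open>p\<close> on it.\<close>

definition galois_cover :: "'a topology \<Rightarrow> 'b topology \<Rightarrow> ('b \<Rightarrow> 'a) \<Rightarrow> bool" where
  "galois_cover X Y p \<longleftrightarrow> connected_cover X Y p \<and>
     homeomorphic_map (deck_quotient Y p) X (\<lambda>B. the_elem (p ` B))"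


section \<open>Sets with a left group action\<close>

definition equivariant ::
  "('g, 'z) monoid_scheme \<Rightarrow> 'e set \<times> ('g \<Rightarrow> 'e \<Rightarrow> 'e) \<Rightarrow> 'f set \<times> ('g \<Rightarrow> 'f \<Rightarrow> 'f)
     \<Rightarrow> ('e \<Rightarrow> 'f) set" where
  "equivariant G = (\<lambda>(E, \<phi>) (F, \<psi>).
     {f \<in> E \<rightarrow>\<^sub>E F. \<forall>g\<in>carrier G. \<forall>e\<in>E. f (\<phi> g e) = \<psi> g (f e)})"

definition GSet ::
  "('g, 'z) monoid_scheme \<Rightarrow> ('u set \<times> ('g \<Rightarrow> 'u \<Rightarrow> 'u), 'u \<Rightarrow> 'u) cat" where
  "GSet G =
     \<lparr>ob = {(E, \<phi>). group_action G E \<phi> \<and> \<phi> \<in> extensional (carrier G)},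
      hm = equivariant G,
      idt = (\<lambda>(E, \<phi>). \<lambda>e\<in>E. e),
      cmp = (\<lambda>(E, \<phi>) _ _ g f. compose E g f)\<rparr>"

definition gset_isomorphic ::
  "('g, 'z) monoid_scheme \<Rightarrow> 'e set \<times> ('g \<Rightarrow> 'e \<Rightarrow> 'e) \<Rightarrow> 'f set \<times> ('g \<Rightarrow> 'f \<Rightarrow> 'f) \<Rightarrow> bool" where
  "gset_isomorphic G A B \<longleftrightarrow> (\<exists>f\<in>equivariant G A B. bij_betw f (fst A) (fst B))"

text \<open>Neither the empty space nor the empty set with action counts as connected, respectively
  transitive; \<^const>\<open>transitive_action\<close> alone would admit the empty set.\<close>

definition transitive_gset ::
  "('g, 'z) monoid_scheme \<Rightarrow> 'e set \<times> ('g \<Rightarrow> 'e \<Rightarrow> 'e) \<Rightarrow> bool" where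
  "transitive_gset G = (\<lambda>(E, \<phi>). transitive_action G E \<phi> \<and> E \<noteq> {})"

definition coset_gset ::
  "('g, 'z) monoid_scheme \<Rightarrow> 'g set \<Rightarrow> 'g set set \<times> ('g \<Rightarrow> 'g set \<Rightarrow> 'g set)" where
  "coset_gset G N =
     (lcosets\<^bsub>G\<^esub> N, \<lambda>g\<in>carrier G. \<lambda>C\<in>lcosets\<^bsub>G\<^esub> N. g <#\<^bsub>G\<^esub> C)"


section \<open>The fibre functor\<close>

definition path_lift :: "'b topology \<Rightarrow> ('b \<Rightarrow> 'a) \<Rightarrow> (real \<Rightarrow> 'a) \<Rightarrow> 'b \<Rightarrow> real \<Rightarrow> 'b" where
  "path_lift Y p \<gamma> y = (THE \<beta>. \<beta> \<in> extensional {0..1} \<and> pathin Y \<beta> \<and> \<beta> 0 = y \<and>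
     (\<forall>t\<in>{0..1}. p (\<beta> t) = \<gamma> t))"

text \<open>\<^const>\<open>the_elem\<close> picks the endpoint common to the lifts of all loops in a homotopy class.\<close>

definition monodromy ::
  "'a topology \<Rightarrow> 'a \<Rightarrow> 'b topology \<Rightarrow> ('b \<Rightarrow> 'a) \<Rightarrow> (real \<Rightarrow> 'a) set \<Rightarrow> 'b \<Rightarrow> 'b" where
  "monodromy X x Y p =
     (\<lambda>c\<in>carrier (pi1 X x). \<lambda>y\<in>fibre Y p x. the_elem ((\<lambda>\<gamma>. path_lift Y p \<gamma> y 1) ` c))"

definition Fib ::
  "'a topology \<Rightarrow> 'a \<Rightarrow>
    ('u topology \<times> ('u \<Rightarrow> 'a), 'u \<Rightarrow> 'u, 'u set \<times> ((real \<Rightarrow> 'a) set \<Rightarrow> 'u \<Rightarrow> 'u), 'u \<Rightarrow> 'u) cat_functor"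
  where
  "Fib X x =
     \<lparr>fob = (\<lambda>(Y, p). (fibre Y p x, monodromy X x Y p)),
      far = (\<lambda>(Y, p) _ f. restrict f (fibre Y p x))\<rparr>"

end

(* A cover is determined by transport along paths. A morphism of covers commutes with transport, so it is
   determined by its effect on one fibre, and an equivariant map of fibres extends along chosen paths from x,
   independently of the choice. Conversely a set E with an action yields the cover X x E whose topology declares a
   set open if it is stable under transport along all short paths; local simple connectedness makes it evenly
   covered. Both the connected and the Galois condition then become statements about the fibre: Galois means that
   deck transformations, i.e. equivariant bijections of the fibre, act transitively, i.e. that all stabilizers agree.

   For the last claim a coset space has to fit into the universe 'u: a loop is, up to homotopy, a finite chain of
   steps inside good neighbourhoods, so the fundamental group is no larger than the set of finite lists of pairs of
   points. *)

theory Submission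
  imports Defs
begin

section \<open>Homotopy of paths\<close>

text \<open>The textbook route forms the universal cover from homotopy classes of paths and divides
  its product with E by the group. Choosing one path \<open>g b\<close> from x to each point b
  replaces both quotients: it identifies every fibre with E as a set, in general discontinuously,
  and the topology of \<open>total_space\<close> makes up for this by letting a path from b to c act
  through the loop that leaves along \<open>g b\<close> and returns along \<open>g c\<close>. The
  points remain pairs, so the total space is no larger than the product of X and E. This matters
  because all covers have their points in one fixed type \<open>'u\<close>; as \<open>'u\<close> is
  infinite, it has room for the products and finite lists that occur.

  Transport is set up for paths with arbitrary ends, not only for loops. Continuity of a map between
  covers is a local question over points other than x, and there transport along a path inside a
  small open set is given by a section (\<open>transport_section\<close>). The group sees only the
  fibre over x.\<close>

definition path_between :: "'a topology \<Rightarrow> 'a \<Rightarrow> 'a \<Rightarrow> (real \<Rightarrow> 'a) \<Rightarrow> bool" where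
  "path_between X a b \<gamma> \<longleftrightarrow> pathin X \<gamma> \<and> \<gamma> 0 = a \<and> \<gamma> 1 = b"

definition path_homotopic :: "'a topology \<Rightarrow> 'a \<Rightarrow> 'a \<Rightarrow> (real \<Rightarrow> 'a) \<Rightarrow> (real \<Rightarrow> 'a) \<Rightarrow> bool" where
  "path_homotopic X a b = homotopic_with (\<lambda>g. g 0 = a \<and> g 1 = b) (top_of_set {0..1}) X"

definition path_reverse :: "(real \<Rightarrow> 'a) \<Rightarrow> real \<Rightarrow> 'a" where
  "path_reverse \<gamma> = (\<lambda>t. \<gamma> (1 - t))"

definition path_segment :: "(real \<Rightarrow> 'a) \<Rightarrow> real \<Rightarrow> real \<Rightarrow> real \<Rightarrow> 'a" where
  "path_segment \<gamma> u v = (\<lambda>t. \<gamma> (u + t * (v - u)))"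

lemma loopin_iff_path_between: "loopin X x = path_between X x x"
  by (auto simp: loopin_def path_between_def)

lemma loop_homotopic_eq: "loop_homotopic X x = path_homotopic X x x"
  by (auto simp: loop_homotopic_def path_homotopic_def)

text \<open>Homotopies become maps on a subspace of the plane instead of on a product topology, so
  that they can be lifted, pasted and precomposed with real functions.\<close>

lemma path_homotopic_iff:
  "path_homotopic X a b \<gamma> \<delta> \<longleftrightarrow>
     (\<exists>h. continuous_map (top_of_set ({0..1} \<times> {0..1})) X h \<and>
       (\<forall>t\<in>{0..1}. h (0::real, t) = \<gamma> t) \<and> (\<forall>t\<in>{0..1}. h (1, t) = \<delta> t) \<and>
       (\<forall>s\<in>{0..1}. h (s, 0) = a \<and> h (s, 1) = b))"
proof -
  have "prod_topology (top_of_set {0..1::real}) (top_of_set {0..1::real}) = top_of_set ({0..1} \<times> {0..1})"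
    by simp
  moreover have "path_homotopic X a b \<gamma> \<delta> \<longleftrightarrow>
    (\<exists>h. continuous_map (prod_topology (top_of_set {0..1}) (top_of_set {0..1})) X h \<and>
       (\<forall>t\<in>topspace (top_of_set {0..1}). h (0::real, t) = \<gamma> t) \<and>
       (\<forall>t\<in>topspace (top_of_set {0..1}). h (1, t) = \<delta> t) \<and>
       (\<forall>s\<in>{0..1}. h (s, 0) = a \<and> h (s, 1) = b))"
    unfolding path_homotopic_def by (rule homotopic_with) simp
  ultimately show ?thesis by (simp only: topspace_euclidean_subtopology)
qed

lemma path_homotopic_imp_path_between:
  assumes "path_homotopic X a b \<gamma> \<delta>"
  shows "path_between X a b \<gamma>" "path_between X a b \<delta>"
  using homotopic_with_imp_continuous_maps[OF assms[unfolded path_homotopic_def]]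
    homotopic_with_imp_property[OF assms[unfolded path_homotopic_def]]
  by (auto simp: path_between_def pathin_def)

lemma path_homotopic_refl: "path_between X a b \<gamma> \<Longrightarrow> path_homotopic X a b \<gamma> \<gamma>"
  by (simp add: path_homotopic_def path_between_def pathin_def)

lemma path_homotopic_sym: "path_homotopic X a b \<gamma> \<delta> \<Longrightarrow> path_homotopic X a b \<delta> \<gamma>"
  unfolding path_homotopic_def by (rule homotopic_with_symD)

lemma path_homotopic_trans [trans]:
  "\<lbrakk>path_homotopic X a b \<gamma> \<delta>; path_homotopic X a b \<delta> \<epsilon>\<rbrakk> \<Longrightarrow> path_homotopic X a b \<gamma> \<epsilon>"
  unfolding path_homotopic_def by (rule homotopic_with_trans)

lemma path_between_imp_topspace:
  assumes "path_between X a b \<gamma>"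
  shows "a \<in> topspace X" "b \<in> topspace X"
  using assms path_start_in_topspace path_finish_in_topspace by (fastforce simp: path_between_def)+

lemma path_between_in_topspace: "\<lbrakk>path_between X a b \<gamma>; t \<in> {0..1}\<rbrakk> \<Longrightarrow> \<gamma> t \<in> topspace X"
  using path_image_subset_topspace by (fastforce simp: path_between_def)

section \<open>Reparametrization and the groupoid laws up to homotopy\<close>

lemma pathin_reparametrize:
  assumes "pathin X \<gamma>" "continuous_on {0..1} f" "f ` {0..1} \<subseteq> {0..1}"
  shows "pathin X (\<gamma> \<circ> f)"
proof -
  have "continuous_map (top_of_set {0..1}) (top_of_set {0..1}) f"
    using assms by (auto simp: image_subset_iff_funcset)
  then show ?thesis using assms(1) unfolding pathin_def by (metis continuous_map_compose)
qed

text \<open>Two parameters with the same ends are joined by the straight line \<open>k\<close>,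
  which convexity keeps inside the interval, and \<gamma> carries it to a homotopy. The laws for
  segments, associativity, constant and reversed paths below all write both sides as one path after
  two parameters.\<close>

lemma path_homotopic_reparametrize:
  assumes "pathin X \<gamma>" and f: "continuous_on {0..1} f" "f ` {0..1} \<subseteq> {0..1}"
    and g: "continuous_on {0..1} g" "g ` {0..1} \<subseteq> {0..1}"
    and "f 0 = g 0" "f 1 = g 1" "\<gamma> (f 0) = a" "\<gamma> (f 1) = b"
  shows "path_homotopic X a b (\<gamma> \<circ> f) (\<gamma> \<circ> g)"
proof -
  define k where "k = (\<lambda>z::real \<times> real. (1 - fst z) * f (snd z) + fst z * g (snd z))"
  have cf: "continuous_on ({0..1} \<times> {0..1}) (\<lambda>z::real \<times> real. f (snd z))"
    "continuous_on ({0..1} \<times> {0..1}) (\<lambda>z::real \<times> real. g (snd z))"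
    by (rule continuous_on_compose2[OF f(1)] continuous_on_compose2[OF g(1)]; auto intro: continuous_intros)+
  have "k z \<in> {0..1}" if "z \<in> {0..1} \<times> {0..1}" for z
  proof -
    have "f (snd z) \<in> {0..1}" "g (snd z) \<in> {0..1}" "0 \<le> fst z" "fst z \<le> 1" using that f g by auto
    then have "k z \<in> closed_segment (f (snd z)) (g (snd z))"
      unfolding k_def in_segment by auto
    with \<open>f (snd z) \<in> {0..1}\<close> \<open>g (snd z) \<in> {0..1}\<close> show ?thesis
      using closed_segment_subset[of "f (snd z)" "{0..1}" "g (snd z)"] by auto
  qed
  then have k: "continuous_map (top_of_set ({0..1} \<times> {0..1})) (top_of_set {0..1}) k"
    unfolding continuous_map_subtopology_eu k_def by (auto intro!: continuous_intros cf)
  have "continuous_map (top_of_set ({0..1} \<times> {0..1})) X (\<gamma> \<circ> k)"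
    using continuous_map_compose[OF k] assms(1) by (simp add: pathin_def)
  moreover have "k (0, t) = f t" "k (1, t) = g t" "k (s, 0) = f 0" "k (s, 1) = f 1" for s t
    using assms by (simp_all add: k_def algebra_simps)
  ultimately show ?thesis
    unfolding path_homotopic_iff using assms(8,9) by (metis comp_apply)
qed

lemma path_homotopic_cong:
  assumes "path_between X a b \<gamma>" "\<And>t. t \<in> {0..1} \<Longrightarrow> \<gamma> t = \<delta> t"
  shows "path_homotopic X a b \<gamma> \<delta>"
proof -
  have "\<delta> 0 = a" "\<delta> 1 = b"
    using assms(1) assms(2)[of 0] assms(2)[of 1] by (auto simp: path_between_def)
  then show ?thesis
    using assms(1) unfolding path_homotopic_def path_between_def pathin_def
    by (intro homotopic_with_equal) (simp_all add: assms(2))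
qed

text \<open>The squares are pasted along the edge \<open>snd z = 1/2\<close>; applied to two
  homotopies, this concatenates them at every stage \<open>fst z\<close>.\<close>

lemma continuous_map_square_join:
  assumes h: "continuous_map (top_of_set ({0..1} \<times> {0..1})) X h"
    and k: "continuous_map (top_of_set ({0..1} \<times> {0..1})) X k"
    and hk: "\<And>s. s \<in> {0..1} \<Longrightarrow> h (s, 1) = k (s, 0)"
  shows "continuous_map (top_of_set ({0..1} \<times> {0..1})) X
    (\<lambda>z::real \<times> real. if snd z \<le> 1/2 then h (fst z, 2 * snd z) else k (fst z, 2 * snd z - 1))"
proof (rule continuous_map_cases_le)
  show "continuous_map (top_of_set ({0..1} \<times> {0..1})) euclideanreal snd"
    "continuous_map (top_of_set ({0..1} \<times> {0..1})) euclideanreal (\<lambda>x. 1/2)"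
    by (auto intro: continuous_intros)
  have 1: "continuous_map (top_of_set {z \<in> {0..1} \<times> {0..1}. snd z \<le> (1/2::real)})
      (top_of_set ({0..1} \<times> {0..1})) (\<lambda>z::real \<times> real. (fst z, 2 * snd z))"
    by (auto simp: continuous_map_subtopology_eu intro!: continuous_intros)
  have 2: "continuous_map (top_of_set {z \<in> {0..1} \<times> {0..1}. 1/2 \<le> snd z})
      (top_of_set ({0..1} \<times> {0..1})) (\<lambda>z::real \<times> real. (fst z, 2 * snd z - 1))"
    by (auto simp: continuous_map_subtopology_eu intro!: continuous_intros)
  have eq: "subtopology (top_of_set ({0..1} \<times> {0..1})) {z \<in> topspace (top_of_set ({0..1} \<times> {0..1})). P z}
      = top_of_set {z \<in> {0..1} \<times> {0..1}. P z}" for P :: "real \<times> real \<Rightarrow> bool"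
  proof -
    have "({0..1} \<times> {0..1}) \<inter> {z \<in> {0..1} \<times> {0..1}. P z} = {z \<in> {0..1} \<times> {0..1}. P z}" by blast
    then show ?thesis by (simp only: subtopology_subtopology topspace_euclidean_subtopology)
  qed
  show "continuous_map (subtopology (top_of_set ({0..1} \<times> {0..1}))
      {z \<in> topspace (top_of_set ({0..1} \<times> {0..1})). snd z \<le> 1/2}) X (\<lambda>z. h (fst z, 2 * snd z))"
    unfolding eq using continuous_map_compose[OF 1 h] by (simp add: o_def)
  show "continuous_map (subtopology (top_of_set ({0..1} \<times> {0..1}))
      {z \<in> topspace (top_of_set ({0..1} \<times> {0..1})). 1/2 \<le> snd z}) X (\<lambda>z. k (fst z, 2 * snd z - 1))"
    unfolding eq using continuous_map_compose[OF 2 k] by (simp add: o_def)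
next
  fix z :: "real \<times> real"
  assume "z \<in> topspace (top_of_set ({0..1} \<times> {0..1}))" "snd z = 1/2"
  moreover from this have "2 * snd z = 1" by simp
  ultimately show "h (fst z, 2 * snd z) = k (fst z, 2 * snd z - 1)"
    using hk[of "fst z"] by (auto simp only: mem_Times_iff topspace_euclidean_subtopology diff_self)
qed

lemma path_homotopic_concat:
  assumes "path_homotopic X a b \<gamma> \<gamma>'" "path_homotopic X b c \<delta> \<delta>'"
  shows "path_homotopic X a c (path_concat \<gamma> \<delta>) (path_concat \<gamma>' \<delta>')"
proof -
  obtain h where h: "continuous_map (top_of_set ({0..1} \<times> {0..1})) X h"
       "\<forall>t\<in>{0..1}. h (0::real, t) = \<gamma> t" "\<forall>t\<in>{0..1}. h (1, t) = \<gamma>' t"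
       "\<forall>s\<in>{0..1}. h (s, 0) = a \<and> h (s, 1) = b"
    using assms(1) unfolding path_homotopic_iff by blast
  obtain k where k: "continuous_map (top_of_set ({0..1} \<times> {0..1})) X k"
       "\<forall>t\<in>{0..1}. k (0::real, t) = \<delta> t" "\<forall>t\<in>{0..1}. k (1, t) = \<delta>' t"
       "\<forall>s\<in>{0..1}. k (s, 0) = b \<and> k (s, 1) = c"
    using assms(2) unfolding path_homotopic_iff by blast
  show ?thesis
    unfolding path_homotopic_iff
    by (intro exI conjI, rule continuous_map_square_join[OF h(1) k(1)])
      (use h k in \<open>auto simp: path_concat_def\<close>)
qed

lemma path_between_concat:
  "\<lbrakk>path_between X a b \<gamma>; path_between X b c \<delta>\<rbrakk> \<Longrightarrow> path_between X a c (path_concat \<gamma> \<delta>)"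
  using path_homotopic_concat path_homotopic_refl path_homotopic_imp_path_between by metis

lemma path_between_const: "a \<in> topspace X \<Longrightarrow> path_between X a a (\<lambda>t. a)"
  by (simp add: path_between_def)

lemma path_between_reverse: "path_between X a b \<gamma> \<Longrightarrow> path_between X b a (path_reverse \<gamma>)"
  using pathin_reparametrize[of X \<gamma> "\<lambda>t. 1 - t"] continuous_on_op_minus[of "{0..1}" "1::real"]
  by (auto simp: path_between_def path_reverse_def o_def)

lemma path_reverse_reverse [simp]: "path_reverse (path_reverse \<gamma>) = \<gamma>"
  by (simp add: path_reverse_def)

lemma segment_parameter_in_unit_interval:
  assumes "u \<in> {0..1}" "v \<in> {0..1}" "t \<in> {0..1::real}"
  shows "u + t * (v - u) \<in> {0..1}"
proof -
  have "u + t * (v - u) = (1 - t) * u + t * v" by (simp add: algebra_simps)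
  then have "u + t * (v - u) \<in> closed_segment u v" using assms(3) unfolding in_segment by auto
  then show ?thesis using closed_segment_subset[of u "{0..1}" v] assms by auto
qed

lemma path_between_segment:
  assumes "pathin X \<gamma>" "u \<in> {0..1}" "v \<in> {0..1}"
  shows "path_between X (\<gamma> u) (\<gamma> v) (path_segment \<gamma> u v)"
proof -
  have "pathin X (\<gamma> \<circ> (\<lambda>t. u + t * (v - u)))"
  proof (rule pathin_reparametrize[OF assms(1)])
    show "continuous_on {0..1} (\<lambda>t. u + t * (v - u))" by (intro continuous_intros)
    show "(\<lambda>t. u + t * (v - u)) ` {0..1} \<subseteq> {0..1}"
      using segment_parameter_in_unit_interval[OF assms(2,3)] by blast
  qed
  then show ?thesis by (simp add: path_between_def path_segment_def o_def)
qed

lemma path_segment_full [simp]: "path_segment \<gamma> 0 1 = \<gamma>"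
  by (simp add: path_segment_def)

text \<open>Both sides are \<gamma> after a parameter running from u to w. The three points may come
  in any order; a segment with v below u runs backwards.\<close>

lemma path_homotopic_concat_segments:
  assumes "pathin X \<gamma>" "u \<in> {0..1}" "v \<in> {0..1}" "w \<in> {0..1}"
  shows "path_homotopic X (\<gamma> u) (\<gamma> w) (path_concat (path_segment \<gamma> u v) (path_segment \<gamma> v w))
    (path_segment \<gamma> u w)"
proof -
  \<comment> \<open>\<open>min\<close> and \<open>max\<close> write the piecewise affine parameter
    as a single formula whose continuity is immediate; the fact \<open>f\<close> recovers its two
    branches.\<close>
  let ?f = "\<lambda>t. u + min (2 * t) 1 * (v - u) + max 0 (2 * t - 1) * (w - v)"
  have f: "?f t = (if t \<le> 1/2 then u + (2 * t) * (v - u) else v + (2 * t - 1) * (w - v))" for t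
    by (auto simp: min_def max_def)
  have "path_homotopic X (\<gamma> u) (\<gamma> w) (\<gamma> \<circ> ?f) (\<gamma> \<circ> (\<lambda>t. u + t * (w - u)))"
  proof (rule path_homotopic_reparametrize[OF assms(1)])
    show "continuous_on {0..1} ?f" "continuous_on {0..1} (\<lambda>t. u + t * (w - u))"
      by (intro continuous_intros)+
    show "?f ` {0..1} \<subseteq> {0..1}"
    proof (rule image_subsetI)
      fix t :: real assume "t \<in> {0..1}"
      then have "t \<le> 1/2 \<Longrightarrow> 2 * t \<in> {0..1}" "\<not> t \<le> 1/2 \<Longrightarrow> 2 * t - 1 \<in> {0..1}" by auto
      then show "?f t \<in> {0..1}"
        unfolding f using segment_parameter_in_unit_interval[OF assms(2,3)]
          segment_parameter_in_unit_interval[OF assms(3,4)] by presburger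
    qed
    show "(\<lambda>t. u + t * (w - u)) ` {0..1} \<subseteq> {0..1}"
      using segment_parameter_in_unit_interval[OF assms(2,4)] by blast
  qed simp_all
  moreover have "path_concat (path_segment \<gamma> u v) (path_segment \<gamma> v w) = \<gamma> \<circ> ?f"
    unfolding o_def f by (simp add: path_concat_def path_segment_def fun_eq_iff)
  ultimately show ?thesis by (simp add: path_segment_def o_def)
qed

lemma path_homotopic_assoc:
  assumes "path_between X a b \<gamma>" "path_between X b c \<delta>" "path_between X c d \<epsilon>"
  shows "path_homotopic X a d (path_concat (path_concat \<gamma> \<delta>) \<epsilon>) (path_concat \<gamma> (path_concat \<delta> \<epsilon>))"
proof -
  let ?\<sigma> = "path_concat (path_concat \<gamma> \<delta>) \<epsilon>"
  \<comment> \<open>The bracketing on the left spends a quarter, a quarter and a half of the time on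
    the three paths, the one on the right a half, a quarter and a quarter. This parameter converts
    the second timetable into the first; its slopes are 1/2, 1 and 2.\<close>
  let ?g = "\<lambda>t::real. if t \<le> 1/2 then t / 2 else if t \<le> 3/4 then t - 1/4 else 2 * t - 1"
  have \<sigma>: "path_between X a d ?\<sigma>" using assms path_between_concat by metis
  have c: "continuous_on {0..1} ?g"
  proof -
    have eq: "?g = (\<lambda>t. t / 2 + max 0 (t / 2 - 1/4) + max 0 (t - 3/4))" by (auto simp: max_def field_simps)
    show ?thesis unfolding eq by (intro continuous_intros) auto
  qed
  have "path_homotopic X a d (?\<sigma> \<circ> id) (?\<sigma> \<circ> ?g)"
    by (rule path_homotopic_reparametrize) (use \<sigma> c in \<open>auto simp: path_between_def\<close>)
  moreover have "path_concat \<gamma> (path_concat \<delta> \<epsilon>) = ?\<sigma> \<circ> ?g"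
    by (rule ext) (auto simp: path_concat_def right_diff_distrib)
  ultimately show ?thesis by simp
qed

lemma path_homotopic_const_left:
  assumes "path_between X a b \<gamma>"
  shows "path_homotopic X a b (path_concat (\<lambda>t. a) \<gamma>) \<gamma>"
proof -
  let ?g = "\<lambda>t::real. max 0 (2 * t - 1)"
  have "path_homotopic X a b (\<gamma> \<circ> ?g) (\<gamma> \<circ> id)"
    by (rule path_homotopic_reparametrize) (use assms in \<open>auto simp: path_between_def intro!: continuous_intros\<close>)
  moreover have "path_concat (\<lambda>t. a) \<gamma> = \<gamma> \<circ> ?g"
  proof
    fix t :: real
    have "max 0 (2 * t - 1) = (if t \<le> 1/2 then 0 else 2 * t - 1)" by simp
    then show "path_concat (\<lambda>t. a) \<gamma> t = (\<gamma> \<circ> ?g) t"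
      using assms by (simp add: path_concat_def path_between_def)
  qed
  ultimately show ?thesis by simp
qed

lemma path_homotopic_const_right:
  assumes "path_between X a b \<gamma>"
  shows "path_homotopic X a b (path_concat \<gamma> (\<lambda>t. b)) \<gamma>"
proof -
  let ?g = "\<lambda>t::real. min 1 (2 * t)"
  have "path_homotopic X a b (\<gamma> \<circ> ?g) (\<gamma> \<circ> id)"
    by (rule path_homotopic_reparametrize) (use assms in \<open>auto simp: path_between_def intro!: continuous_intros\<close>)
  moreover have "path_concat \<gamma> (\<lambda>t. b) = \<gamma> \<circ> ?g"
  proof
    fix t :: real
    have "min 1 (2 * t) = (if t \<le> 1/2 then 2 * t else 1)" by simp
    then show "path_concat \<gamma> (\<lambda>t. b) t = (\<gamma> \<circ> ?g) t"
      using assms by (simp add: path_concat_def path_between_def)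
  qed
  ultimately show ?thesis by simp
qed

text \<open>Going out and back is \<gamma> after the tent map
  \<open>min (2 * t) (2 - 2 * t)\<close>, which vanishes at both ends and therefore contracts to the
  parameter 0.\<close>

lemma path_homotopic_reverse_right:
  assumes "path_between X a b \<gamma>"
  shows "path_homotopic X a a (path_concat \<gamma> (path_reverse \<gamma>)) (\<lambda>t. a)"
proof -
  let ?g = "\<lambda>t::real. min (2 * t) (2 - 2 * t)"
  have hom: "path_homotopic X a a (\<gamma> \<circ> ?g) (\<gamma> \<circ> (\<lambda>t. 0))"
  proof (rule path_homotopic_reparametrize)
    show "continuous_on {0..1} ?g" by (intro continuous_intros)
    show "?g ` {0..1} \<subseteq> {0..1}" by (auto simp: min_def)
  qed (use assms in \<open>auto simp: path_between_def\<close>)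
  have concat: "path_concat \<gamma> (path_reverse \<gamma>) = \<gamma> \<circ> ?g"
    by (auto simp: path_concat_def path_reverse_def min_def fun_eq_iff)
  have const: "\<gamma> \<circ> (\<lambda>t. 0) = (\<lambda>t. a)" using assms by (auto simp: path_between_def)
  show ?thesis using hom unfolding concat const .
qed

lemma path_homotopic_reverse_left:
  assumes "path_between X a b \<gamma>"
  shows "path_homotopic X b b (path_concat (path_reverse \<gamma>) \<gamma>) (\<lambda>t. b)"
  using path_homotopic_reverse_right[OF path_between_reverse[OF assms]] by simp

lemma path_between_map:
  "\<lbrakk>path_between X a b \<gamma>; continuous_map X Y f\<rbrakk> \<Longrightarrow> path_between Y (f a) (f b) (f \<circ> \<gamma>)"
  by (auto simp: path_between_def intro: pathin_compose)

lemma path_between_mono: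
  "path_between (subtopology X U) a b \<gamma> \<Longrightarrow> path_between X a b \<gamma>"
  by (auto simp: path_between_def pathin_subtopology)

lemma path_between_subtopology:
  "path_between (subtopology X U) a b \<gamma> \<longleftrightarrow> path_between X a b \<gamma> \<and> (\<forall>t\<in>{0..1}. \<gamma> t \<in> U)"
  by (auto simp: path_between_def pathin_subtopology)

section \<open>Lifting along covers\<close>

lemma cover_evenly_covered:
  assumes "cover X Y p" "b \<in> topspace X"
  obtains U V where "openin X U" "b \<in> U" "{y \<in> topspace Y. p y \<in> U} = (\<Union>y\<in>fibre Y p b. V y)"
    "disjoint_family_on V (fibre Y p b)"
    "\<forall>y\<in>fibre Y p b. openin Y (V y) \<and> y \<in> V y \<and>
       homeomorphic_map (subtopology Y (V y)) (subtopology X U) p"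
proof -
  have "\<exists>U V. openin X U \<and> b \<in> U \<and>
        {y \<in> topspace Y. p y \<in> U} = (\<Union>y\<in>fibre Y p b. V y) \<and>
        disjoint_family_on V (fibre Y p b) \<and>
        (\<forall>y\<in>fibre Y p b. openin Y (V y) \<and> y \<in> V y \<and>
           homeomorphic_map (subtopology Y (V y)) (subtopology X U) p)"
    using assms unfolding cover_def by fast
  then show ?thesis by (elim exE conjE) (rule that)
qed

lemma cover_continuous_map: "cover X Y p \<Longrightarrow> continuous_map Y X p"
  by (simp add: cover_def)

lemma cover_in_topspace: "\<lbrakk>cover X Y p; y \<in> topspace Y\<rbrakk> \<Longrightarrow> p y \<in> topspace X"
  using cover_continuous_map continuous_map_image_subset_topspace by fastforce

section \<open>Uniqueness of lifts\<close>

text \<open>Connectedness in the form of an induction principle. Agreement of lifts, being joined by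
  a path in X and being reached by transport in a connected cover are all shown by it.\<close>

lemma connected_space_locally_constant:
  assumes K: "connected_space K" and j: "j \<in> topspace K" and k: "k \<in> topspace K" and P: "P j"
    and loc: "\<And>k. k \<in> topspace K \<Longrightarrow> \<exists>W. openin K W \<and> k \<in> W \<and> (\<forall>i\<in>W. P i = P k)"
  shows "P k"
proof -
  have "openin K {i \<in> topspace K. P i = b}" for b
  proof (subst openin_subopen, intro ballI)
    fix i assume i: "i \<in> {i \<in> topspace K. P i = b}"
    then obtain W where W: "openin K W" "i \<in> W" "\<forall>i'\<in>W. P i' = P i" using loc[of i] by blast
    have "W \<subseteq> {i \<in> topspace K. P i = b}" using W(3) i openin_subset[OF W(1)] by blast
    then show "\<exists>T. openin K T \<and> i \<in> T \<and> T \<subseteq> {i \<in> topspace K. P i = b}" using W by blast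
  qed
  from this[of True] this[of False]
  have "openin K {i \<in> topspace K. P i}" "openin K {i \<in> topspace K. \<not> P i}" by simp_all
  moreover have "{i \<in> topspace K. \<not> P i} = topspace K - {i \<in> topspace K. P i}" by blast
  ultimately have "closedin K {i \<in> topspace K. P i}" by (simp add: closedin_def)
  then have "{i \<in> topspace K. P i} = {} \<or> {i \<in> topspace K. P i} = topspace K"
    using K \<open>openin K {i \<in> topspace K. P i}\<close> unfolding connected_space_clopen_in by blast
  then show ?thesis using j k P by blast
qed

text \<open>Agreement of two lifts is locally constant: if they agree at a point, they stay on one
  sheet, where \<open>p\<close> is injective; if they differ, they stay on disjoint sheets. The
  domain is any connected space because the lemma serves for intervals, for overlaps of rectangles
  and for the covers themselves.\<close>

lemma cover_lift_unique:
  assumes p: "cover X Y p" and K: "connected_space K"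
    and g: "continuous_map K Y g" and h: "continuous_map K Y h"
    and gh: "\<And>k. k \<in> topspace K \<Longrightarrow> p (g k) = p (h k)"
    and k0: "k\<^sub>0 \<in> topspace K" "g k\<^sub>0 = h k\<^sub>0" and k: "k \<in> topspace K"
  shows "g k = h k"
proof (rule connected_space_locally_constant[OF K k0(1) k, where P = "\<lambda>k. g k = h k"])
  have gY: "g k \<in> topspace Y" and hY: "h k \<in> topspace Y" if "k \<in> topspace K" for k
    using that g h continuous_map_image_subset_topspace by fastforce+
  fix k assume k: "k \<in> topspace K"
  show "\<exists>W. openin K W \<and> k \<in> W \<and> (\<forall>i\<in>W. (g i = h i) = (g k = h k))"
  proof -
    have bX: "p (g k) \<in> topspace X" using p gY k cover_in_topspace by metis
    obtain U V where U: "openin X U" "p (g k) \<in> U"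
      and cov: "{y \<in> topspace Y. p y \<in> U} = (\<Union>y\<in>fibre Y p (p (g k)). V y)"
      and disj: "disjoint_family_on V (fibre Y p (p (g k)))"
      and V: "\<forall>y\<in>fibre Y p (p (g k)). openin Y (V y) \<and> y \<in> V y \<and>
         homeomorphic_map (subtopology Y (V y)) (subtopology X U) p"
      by (rule cover_evenly_covered[OF p bX])
    have fib: "g k \<in> fibre Y p (p (g k))" "h k \<in> fibre Y p (p (g k))" using gY hY gh k by auto
    \<comment> \<open>On this neighbourhood of \<open>k\<close> each of the two lifts stays on a
      single sheet.\<close>
    let ?W = "{j \<in> topspace K. g j \<in> V (g k)} \<inter> {j \<in> topspace K. h j \<in> V (h k)}"
    have "openin K ?W" using V fib g h by (blast intro: openin_continuous_map_preimage)
    moreover have "k \<in> ?W" using V fib k by blast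
    moreover have "(g i = h i) = (g k = h k)" if i: "i \<in> ?W" for i
    proof (cases "g k = h k")
      case True
      have "inj_on p (topspace (subtopology Y (V (g k))))"
        using V fib homeomorphic_imp_injective_map by blast
      then have "inj_on p (V (g k))"
        using V fib by (metis openin_subset topspace_subtopology_subset)
      moreover have "g i \<in> V (g k)" "h i \<in> V (g k)" "p (g i) = p (h i)" using i gh True by auto
      ultimately show ?thesis using True by (auto dest: inj_onD)
    next
      case False
      then have "V (g k) \<inter> V (h k) = {}" using disj fib by (simp add: disjoint_family_on_def)
      then show ?thesis using i False by auto
    qed
    ultimately show ?thesis by (intro exI[of _ ?W] conjI ballI)
  qed
qed (rule k0(2))

section \<open>Local sections of a cover\<close>

text \<open>The inverse of \<open>p\<close> on the sheet through \<open>y\<close>, with the sheet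
  cut down to \<open>T\<close> and the base set to the image of what remains. The open images of
  such sections serve as small neighbourhoods of \<open>y\<close> in the later local
  arguments.\<close>

lemma cover_local_section:
  assumes p: "cover X Y p" and T: "openin Y T" "y \<in> T"
  obtains N s where "openin X N" "p y \<in> N" "continuous_map (subtopology X N) Y s"
    "\<forall>b\<in>N. s b \<in> T \<and> p (s b) = b" "s (p y) = y" "openin Y (s ` N)"
proof -
  have y: "y \<in> topspace Y" using T openin_subset by blast
  then have bX: "p y \<in> topspace X" by (rule cover_in_topspace[OF p])
  obtain U V where U: "openin X U" "p y \<in> U"
    and cov: "{y \<in> topspace Y. p y \<in> U} = (\<Union>y\<in>fibre Y p (p y). V y)"
    and disj: "disjoint_family_on V (fibre Y p (p y))"
    and V': "\<forall>y\<in>fibre Y p (p y). openin Y (V y) \<and> y \<in> V y \<and>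
       homeomorphic_map (subtopology Y (V y)) (subtopology X U) p"
    by (rule cover_evenly_covered[OF p bX])
  have V: "openin Y (V y)" "y \<in> V y" "homeomorphic_map (subtopology Y (V y)) (subtopology X U) p"
    using V' y by blast+
  obtain s where s: "homeomorphic_maps (subtopology Y (V y)) (subtopology X U) p s"
    using V(3) homeomorphic_map_maps by blast
  have tops: "topspace (subtopology Y (V y)) = V y" "topspace (subtopology X U) = U"
    by (simp_all only: openin_subset[OF V(1)] openin_subset[OF U(1)] topspace_subtopology_subset)
  have sp: "\<And>z. z \<in> V y \<Longrightarrow> s (p z) = z \<and> p z \<in> U" and ps: "\<And>b. b \<in> U \<Longrightarrow> p (s b) = b"
    using s tops unfolding homeomorphic_maps_def by (auto simp: continuous_map_def)
  let ?W = "V y \<inter> T"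
  have "openin (subtopology Y (V y)) ?W"
    using V(1) T(1) by (metis Int_commute openin_subtopology_Int)
  then have "openin (subtopology X U) (p ` ?W)"
    using homeomorphic_map_openness[OF V(3)] tops by blast
  then have "openin X (p ` ?W)" using U(1) openin_trans_full by blast
  moreover have "s ` p ` ?W = ?W" using sp by (force simp: image_iff)
  moreover have "continuous_map (subtopology X (p ` ?W)) Y s"
  proof -
    have "continuous_map (subtopology X U) Y s"
      using s continuous_map_into_fulltopology unfolding homeomorphic_maps_def by blast
    moreover have "p ` ?W \<subseteq> U" using sp by auto
    ultimately show ?thesis by (metis continuous_map_from_subtopology_mono)
  qed
  moreover have "openin Y ?W" using V(1) T(1) by blast
  moreover have "p y \<in> p ` ?W" "s (p y) = y" using sp V(2) T(2) by auto
  moreover have "\<forall>b\<in>p ` ?W. s b \<in> T \<and> p (s b) = b" using sp by auto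
  ultimately show ?thesis using that[of "p ` ?W" s] by presburger
qed

text \<open>With a path-connected base set, every point of the image of \<open>s\<close> is obtained
  from \<open>y\<close> by transport along a path inside \<open>N\<close>.\<close>

lemma cover_local_section_path_connected:
  assumes p: "cover X Y p" and X: "locally_path_connected_space X" and T: "openin Y T" "y \<in> T"
    and M: "openin X M" "p y \<in> M"
  obtains N s where "openin X N" "p y \<in> N" "N \<subseteq> M" "path_connectedin X N"
    "continuous_map (subtopology X N) Y s"
    "\<forall>b\<in>N. s b \<in> T \<and> p (s b) = b" "s (p y) = y" "openin Y (s ` N)"
proof -
  obtain N s where N: "openin X N" "p y \<in> N" and s: "continuous_map (subtopology X N) Y s"
    "\<forall>b\<in>N. s b \<in> T \<and> p (s b) = b" "s (p y) = y" "openin Y (s ` N)"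
    using cover_local_section[OF p T] by metis
  obtain N' where N': "openin X N'" "path_connectedin X N'" "p y \<in> N'" "N' \<subseteq> N \<inter> M"
    using X N M unfolding locally_path_connected_space by (metis IntI openin_Int)
  have "s ` N' = s ` N \<inter> {z \<in> topspace Y. p z \<in> N'}"
    using N' s openin_subset[OF s(4)] by (force simp: image_iff)
  moreover have "openin Y {z \<in> topspace Y. p z \<in> N'}"
    using cover_continuous_map[OF p] N'(1) by (rule openin_continuous_map_preimage)
  ultimately have "openin Y (s ` N')" using s(4) by auto
  moreover have "continuous_map (subtopology X N') Y s"
    using s(1) N'(4) continuous_map_from_subtopology_mono by (metis le_inf_iff)
  ultimately show ?thesis using that[of N' s] N' s by blast
qed

section \<open>Existence of lifts over the unit square\<close>

text \<open>The lift may be prescribed at any point of \<open>A\<close>, not just at a fixed corner.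
  This makes the property symmetric, so that pieces can be glued without regard to which of them
  contains the starting point.\<close>

definition lifts_on :: "'b topology \<Rightarrow> ('b \<Rightarrow> 'a) \<Rightarrow> ('k::topological_space \<Rightarrow> 'a) \<Rightarrow> 'k set \<Rightarrow> bool" where
  "lifts_on Y p f A \<longleftrightarrow> (\<forall>a\<in>A. \<forall>y\<in>fibre Y p (f a).
     \<exists>g. continuous_map (top_of_set A) Y g \<and> g a = y \<and> (\<forall>k\<in>A. p (g k) = f k))"

lemma lifts_on_subset:
  assumes "lifts_on Y p f A" "B \<subseteq> A"
  shows "lifts_on Y p f B"
proof -
  show ?thesis
    unfolding lifts_on_def
  proof (intro ballI)
    fix a y assume "a \<in> B" "y \<in> fibre Y p (f a)"
    then obtain g where "continuous_map (top_of_set A) Y g" "g a = y" "\<forall>k\<in>A. p (g k) = f k"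
      using assms unfolding lifts_on_def by (meson subsetD)
    moreover from this have "continuous_map (top_of_set B) Y g"
      using assms(2) continuous_map_from_subtopology_mono by blast
    ultimately show "\<exists>g. continuous_map (top_of_set B) Y g \<and> g a = y \<and> (\<forall>k\<in>B. p (g k) = f k)"
      using assms(2) by blast
  qed
qed

text \<open>A lift on the first piece is continued by the lift on the second that has the same value
  at \<open>c\<close>. Uniqueness over the connected overlap makes the two agree there, and closed
  pieces can be pasted.\<close>

lemma lifts_on_Un:
  assumes p: "cover X Y p" and lA: "lifts_on Y p f A" and lB: "lifts_on Y p f B"
    and cl: "closed A" "closed B" and conn: "connected (A \<inter> B)" and c: "c \<in> A \<inter> B"
  shows "lifts_on Y p f (A \<union> B)"
proof -
  \<comment> \<open>Stated for arbitrary \<open>A\<close> and \<open>B\<close>, so that a starting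
    point in the second set is handled by exchanging the two.\<close>
  have *: "\<exists>g. continuous_map (top_of_set (A \<union> B)) Y g \<and> g a = y \<and> (\<forall>k\<in>A \<union> B. p (g k) = f k)"
    if AB: "lifts_on Y p f A" "lifts_on Y p f B" "closed A" "closed B" "connected (A \<inter> B)" "c \<in> A \<inter> B"
      and a: "a \<in> A" and y: "y \<in> fibre Y p (f a)" for A B a y
  proof -
    obtain g where g: "continuous_map (top_of_set A) Y g" "g a = y" "\<forall>k\<in>A. p (g k) = f k"
      using AB(1) a y unfolding lifts_on_def by meson
    have "g c \<in> fibre Y p (f c)"
      using g AB(6) continuous_map_image_subset_topspace[OF g(1)] by auto
    then obtain h where h: "continuous_map (top_of_set B) Y h" "h c = g c" "\<forall>k\<in>B. p (h k) = f k"
      using AB(2,6) unfolding lifts_on_def by (meson IntD2)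
    have gh: "g k = h k" if "k \<in> A \<inter> B" for k
    proof (rule cover_lift_unique[OF p, where K = "top_of_set (A \<inter> B)" and k\<^sub>0 = c])
      show "connected_space (top_of_set (A \<inter> B))" using AB(5) by (metis connectedin_def connectedin_iff_connected)
      show "continuous_map (top_of_set (A \<inter> B)) Y g" "continuous_map (top_of_set (A \<inter> B)) Y h"
        using g(1) h(1) continuous_map_from_subtopology_mono by blast+
    qed (use g h AB(6) that in auto)
    let ?G = "\<lambda>k. if k \<in> A then g k else h k"
    have "continuous_map (top_of_set (A \<union> B)) Y ?G"
    proof (rule pasting_lemma_closed[where I = "{True, False}" and T = "\<lambda>b. if b then A else B"
          and f = "\<lambda>b. if b then g else h"])
      fix i
      show "closedin (top_of_set (A \<union> B)) (if i then A else B)"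
        using AB(3,4) by (auto intro: closed_subset)
      have "subtopology (top_of_set (A \<union> B)) A = top_of_set A" "subtopology (top_of_set (A \<union> B)) B = top_of_set B"
        by (simp_all add: subtopology_subtopology Int_absorb1)
      then show "continuous_map (subtopology (top_of_set (A \<union> B)) (if i then A else B)) Y (if i then g else h)"
        using g(1) h(1) by simp
    qed (use gh in auto)
    moreover have "?G a = y" "\<forall>k\<in>A \<union> B. p (?G k) = f k" using a g h by auto
    ultimately show ?thesis by blast
  qed
  show ?thesis
    unfolding lifts_on_def
  proof (intro ballI)
    fix a y assume a: "a \<in> A \<union> B" and y: "y \<in> fibre Y p (f a)"
    show "\<exists>g. continuous_map (top_of_set (A \<union> B)) Y g \<and> g a = y \<and> (\<forall>k\<in>A \<union> B. p (g k) = f k)"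
    proof (cases "a \<in> A")
      case True
      then show ?thesis using *[OF lA lB cl conn c _ y] by blast
    next
      case False
      then have "a \<in> B" using a by blast
      then show ?thesis using *[OF lB lA cl(2,1) _ _ _ y] conn c by (simp add: Int_commute Un_commute)
    qed
  qed
qed

text \<open>The prescribed value picks out a sheet, and the lift is \<open>f\<close> followed by the
  inverse of \<open>p\<close> on that sheet.\<close>

lemma lifts_on_evenly_covered:
  assumes p: "cover X Y p" and f: "continuous_map (top_of_set A) X f" and "f ` A \<subseteq> U"
    and cov: "{y \<in> topspace Y. p y \<in> U} = (\<Union>y\<in>fibre Y p b. V y)"
    and V: "\<forall>y\<in>fibre Y p b. openin Y (V y) \<and> homeomorphic_map (subtopology Y (V y)) (subtopology X U) p"
  shows "lifts_on Y p f A"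
  unfolding lifts_on_def
proof (intro ballI)
  fix a y assume a: "a \<in> A" and y: "y \<in> fibre Y p (f a)"
  then have "y \<in> {y \<in> topspace Y. p y \<in> U}" using assms(3) by auto
  then obtain z where z: "z \<in> fibre Y p b" "y \<in> V z" unfolding cov by blast
  obtain s where s: "homeomorphic_maps (subtopology Y (V z)) (subtopology X U) p s"
    using V z(1) homeomorphic_map_maps by blast
  have fU: "continuous_map (top_of_set A) (subtopology X U) f"
    using f assms(3) by (simp add: continuous_map_in_subtopology image_subset_iff_funcset)
  have "continuous_map (top_of_set A) (subtopology Y (V z)) (s \<circ> f)"
    using s continuous_map_compose[OF fU] unfolding homeomorphic_maps_def by blast
  then have "continuous_map (top_of_set A) Y (s \<circ> f)" by (rule continuous_map_into_fulltopology)
  moreover have "(s \<circ> f) a = y"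
    using s y z V unfolding homeomorphic_maps_def
    by (metis (mono_tags, lifting) comp_apply mem_Collect_eq openin_subset topspace_subtopology_subset)
  moreover have "p ((s \<circ> f) k) = f k" if "k \<in> A" for k
  proof -
    have "f k \<in> topspace (subtopology X U)"
      using fU that continuous_map_image_subset_topspace by fastforce
    then show ?thesis using s unfolding homeomorphic_maps_def by simp
  qed
  ultimately show "\<exists>g. continuous_map (top_of_set A) Y g \<and> g a = y \<and> (\<forall>k\<in>A. p (g k) = f k)" by blast
qed

text \<open>A Lebesgue number argument carried out by bisection. \<open>Bolzano\<close> first glues
  the small rectangles over one value s to a strip of positive width, then the strips to the whole
  square.\<close>

lemma lifts_on_unit_square:
  fixes f :: "real \<times> real \<Rightarrow> 'a"
  assumes p: "cover X Y p" and f: "continuous_map (top_of_set ({0..1} \<times> {0..1})) X f"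
  shows "lifts_on Y p f ({0..1} \<times> {0..1})"
proof -
  let ?I = "{0..1::real}"
  have local: "\<exists>e>0. lifts_on Y p f (({s-e..s+e} \<inter> ?I) \<times> ({t-e..t+e} \<inter> ?I))"
    if st: "s \<in> ?I" "t \<in> ?I" for s t
  proof -
    have bX: "f (s, t) \<in> topspace X" using st continuous_map_image_subset_topspace[OF f] by auto
    obtain U V where U: "openin X U" "f (s, t) \<in> U"
      and cov: "{y \<in> topspace Y. p y \<in> U} = (\<Union>y\<in>fibre Y p (f (s, t)). V y)"
      and disj: "disjoint_family_on V (fibre Y p (f (s, t)))"
      and V: "\<forall>y\<in>fibre Y p (f (s, t)). openin Y (V y) \<and> y \<in> V y \<and>
         homeomorphic_map (subtopology Y (V y)) (subtopology X U) p"
      by (rule cover_evenly_covered[OF p bX])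
    have "openin (top_of_set (?I \<times> ?I)) {z \<in> topspace (top_of_set (?I \<times> ?I)). f z \<in> U}"
      using openin_continuous_map_preimage[OF f U(1)] .
    then obtain W where W: "open W" "{z \<in> ?I \<times> ?I. f z \<in> U} = ?I \<times> ?I \<inter> W"
      unfolding openin_open by auto
    have "(s, t) \<in> W" using W(2) U(2) st by blast
    then obtain A B where AB: "open A" "open B" "(s, t) \<in> A \<times> B" "A \<times> B \<subseteq> W"
      using open_prod_elim[OF W(1)] by metis
    obtain d where d: "d > 0" "cball s d \<subseteq> A" using AB open_contains_cball by blast
    obtain d' where d': "d' > 0" "cball t d' \<subseteq> B" using AB open_contains_cball by blast
    define e where "e = min d d'"
    let ?R = "({s-e..s+e} \<inter> ?I) \<times> ({t-e..t+e} \<inter> ?I)"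
    have "{s-e..s+e} \<subseteq> A" "{t-e..t+e} \<subseteq> B"
      using d d' by (force simp: e_def cball_eq_atLeastAtMost)+
    then have "?R \<subseteq> ?I \<times> ?I \<inter> W" using AB(4) by blast
    then have R: "?R \<subseteq> ?I \<times> ?I" "f ` ?R \<subseteq> U" using W(2) by blast+
    have "continuous_map (top_of_set ?R) X f" using f R(1) by (rule continuous_map_from_subtopology_mono)
    then have "lifts_on Y p f ?R" using lifts_on_evenly_covered[OF p _ R(2) cov] V by blast
    then show ?thesis using d d' by (intro exI[of _ e]) (auto simp: e_def)
  qed
  have strip: "\<exists>e>0. lifts_on Y p f (({s-e..s+e} \<inter> ?I) \<times> ?I)" if s: "s \<in> ?I" for s
  proof -
    \<comment> \<open>The premises confine the interval to [0,1]: the local hypothesis of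
      \<open>Bolzano\<close> also ranges over intervals that stick out of it.\<close>
    define P where "P = (\<lambda>a b. 0 \<le> a \<longrightarrow> b \<le> 1 \<longrightarrow>
      (\<exists>e>0. lifts_on Y p f (({s-e..s+e} \<inter> ?I) \<times> {a..b})))"
    have "P 0 1"
    proof (rule Bolzano[of "0::real" 1 P])
      fix a b c assume trans: "P a b" "P b c" "a \<le> b" "b \<le> c"
      show "P a c" unfolding P_def
      proof (intro impI)
        assume "0 \<le> a" "c \<le> 1"
        then obtain e e' where e: "e > 0" "lifts_on Y p f (({s-e..s+e} \<inter> ?I) \<times> {a..b})"
          and e': "e' > 0" "lifts_on Y p f (({s-e'..s+e'} \<inter> ?I) \<times> {b..c})"
          using trans unfolding P_def by (meson order_trans)
        \<comment> \<open>Two adjoining strips are trimmed to the smaller of their widths before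
          they are glued.\<close>
        let ?J = "{s - min e e'..s + min e e'} \<inter> ?I"
        have "lifts_on Y p f (?J \<times> {a..b} \<union> ?J \<times> {b..c})"
        proof (rule lifts_on_Un[OF p])
          show "lifts_on Y p f (?J \<times> {a..b})" by (rule lifts_on_subset[OF e(2)]) auto
          show "lifts_on Y p f (?J \<times> {b..c})" by (rule lifts_on_subset[OF e'(2)]) auto
          have "?J \<times> {a..b} \<inter> ?J \<times> {b..c} = ?J \<times> {b}" using trans by auto
          moreover have "connected ?J" by (auto intro!: convex_connected convex_Int)
          ultimately show "connected (?J \<times> {a..b} \<inter> ?J \<times> {b..c})" by (simp add: connected_Times)
          show "(s, b) \<in> ?J \<times> {a..b} \<inter> ?J \<times> {b..c}" using trans e e' s by auto
        qed (auto intro!: closed_Times)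
        moreover have "?J \<times> {a..b} \<union> ?J \<times> {b..c} = ?J \<times> {a..c}" using trans by auto
        ultimately show "\<exists>e>0. lifts_on Y p f (({s-e..s+e} \<inter> ?I) \<times> {a..c})"
          using e e' by (intro exI[of _ "min e e'"]) auto
      qed
    next
      fix t :: real assume t: "0 \<le> t" "t \<le> 1"
      then obtain e where e: "e > 0" "lifts_on Y p f (({s-e..s+e} \<inter> ?I) \<times> ({t-e..t+e} \<inter> ?I))"
        using local[of s t] s t by auto
      show "\<exists>d>0. \<forall>a b. a \<le> t \<and> t \<le> b \<and> b - a < d \<longrightarrow> P a b"
      proof (intro exI[of _ e] conjI allI impI e(1))
        fix a b assume ab: "a \<le> t \<and> t \<le> b \<and> b - a < e"
        show "P a b" unfolding P_def
        proof (intro impI exI[of _ e] conjI e(1))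
          assume "0 \<le> a" "b \<le> 1"
          then have "{a..b} \<subseteq> {t-e..t+e} \<inter> ?I" using ab by auto
          then show "lifts_on Y p f (({s-e..s+e} \<inter> ?I) \<times> {a..b})"
            by (intro lifts_on_subset[OF e(2)]) auto
        qed
      qed
    qed simp
    then show ?thesis by (simp add: P_def)
  qed
  define Q where "Q = (\<lambda>a b. 0 \<le> a \<longrightarrow> b \<le> 1 \<longrightarrow> lifts_on Y p f ({a..b} \<times> ?I))"
  have "Q 0 1"
  proof (rule Bolzano[of "0::real" 1 Q])
    fix a b c assume trans: "Q a b" "Q b c" "a \<le> b" "b \<le> c"
    show "Q a c" unfolding Q_def
    proof (intro impI)
      assume ac: "0 \<le> a" "c \<le> 1"
      have "lifts_on Y p f ({a..b} \<times> ?I \<union> {b..c} \<times> ?I)"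
      proof (rule lifts_on_Un[OF p])
        show "lifts_on Y p f ({a..b} \<times> ?I)" "lifts_on Y p f ({b..c} \<times> ?I)"
          using trans ac unfolding Q_def by auto
        have "{a..b} \<times> ?I \<inter> {b..c} \<times> ?I = {b} \<times> ?I" using trans by auto
        then show "connected ({a..b} \<times> ?I \<inter> {b..c} \<times> ?I)" by (simp add: connected_Times)
        show "(b, 0) \<in> {a..b} \<times> ?I \<inter> {b..c} \<times> ?I" using trans by auto
      qed (auto intro!: closed_Times)
      moreover have "{a..b} \<times> ?I \<union> {b..c} \<times> ?I = {a..c} \<times> ?I" using trans by auto
      ultimately show "lifts_on Y p f ({a..c} \<times> ?I)" by simp
    qed
  next
    fix s :: real assume "0 \<le> s" "s \<le> 1"
    then obtain e where e: "e > 0" "lifts_on Y p f (({s-e..s+e} \<inter> ?I) \<times> ?I)"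
      using strip[of s] by auto
    show "\<exists>d>0. \<forall>a b. a \<le> s \<and> s \<le> b \<and> b - a < d \<longrightarrow> Q a b"
    proof (intro exI[of _ e] conjI allI impI e(1))
      fix a b assume ab: "a \<le> s \<and> s \<le> b \<and> b - a < e"
      show "Q a b" unfolding Q_def
      proof (intro impI)
        assume "0 \<le> a" "b \<le> 1"
        then have "{a..b} \<subseteq> {s-e..s+e} \<inter> ?I" using ab by auto
        then show "lifts_on Y p f ({a..b} \<times> ?I)"
          by (intro lifts_on_subset[OF e(2)]) auto
      qed
    qed
  qed simp
  then show ?thesis by (simp add: Q_def)
qed

section \<open>Transport along paths\<close>

definition transport :: "'b topology \<Rightarrow> ('b \<Rightarrow> 'a) \<Rightarrow> (real \<Rightarrow> 'a) \<Rightarrow> 'b \<Rightarrow> 'b" where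
  "transport Y p \<gamma> y = path_lift Y p \<gamma> y 1"

text \<open>A path is viewed as a map on the square that does not depend on the first coordinate, so
  lifting over the square covers paths as well as homotopies; the lift is then restricted to one
  edge.\<close>

lemma path_lift_exists:
  assumes p: "cover X Y p" and \<gamma>: "pathin X \<gamma>" and y: "y \<in> fibre Y p (\<gamma> 0)"
  shows "\<exists>\<beta>. pathin Y \<beta> \<and> \<beta> 0 = y \<and> (\<forall>t\<in>{0..1}. p (\<beta> t) = \<gamma> t)"
proof -
  let ?Q = "{0..1} \<times> {0..1} :: (real \<times> real) set"
  have "continuous_map (top_of_set ?Q) (top_of_set {0..1}) snd"
    by (auto simp: continuous_map_subtopology_eu intro!: continuous_intros)
  then have "continuous_map (top_of_set ?Q) X (\<gamma> \<circ> snd)"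
    using \<gamma> unfolding pathin_def by (rule continuous_map_compose)
  then have "lifts_on Y p (\<gamma> \<circ> snd) ?Q" using p lifts_on_unit_square by blast
  moreover have "(0, 0) \<in> ?Q" "y \<in> fibre Y p ((\<gamma> \<circ> snd) (0, 0))" using y by auto
  ultimately obtain g where g: "continuous_map (top_of_set ?Q) Y g" "g (0, 0) = y"
    "\<forall>k\<in>?Q. p (g k) = (\<gamma> \<circ> snd) k"
    unfolding lifts_on_def by blast
  have "continuous_map (top_of_set {0..1}) (top_of_set ?Q) (\<lambda>t. (0, t))"
    by (auto simp: continuous_map_subtopology_eu intro!: continuous_intros)
  then have "pathin Y (g \<circ> (\<lambda>t. (0, t)))"
    using g(1) unfolding pathin_def by (rule continuous_map_compose)
  then show ?thesis using g(2,3) by (intro exI[of _ "g \<circ> (\<lambda>t. (0, t))"]) auto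
qed

lemma path_lift_eq:
  assumes p: "cover X Y p" and \<beta>: "pathin Y \<beta>" "\<And>t. t \<in> {0..1} \<Longrightarrow> p (\<beta> t) = \<gamma> t" and t: "t \<in> {0..1}"
  shows "path_lift Y p \<gamma> (\<beta> 0) t = \<beta> t"
proof -
  have "path_lift Y p \<gamma> (\<beta> 0) = restrict \<beta> {0..1}"
    unfolding path_lift_def
  proof (rule the_equality)
    show "restrict \<beta> {0..1} \<in> extensional {0..1} \<and> pathin Y (restrict \<beta> {0..1}) \<and>
      restrict \<beta> {0..1} 0 = \<beta> 0 \<and> (\<forall>t\<in>{0..1}. p (restrict \<beta> {0..1} t) = \<gamma> t)"
      using \<beta> by (auto simp: pathin_def elim!: continuous_map_eq)
  next
    fix \<alpha>
    assume \<alpha>: "\<alpha> \<in> extensional {0..1} \<and> pathin Y \<alpha> \<and> \<alpha> 0 = \<beta> 0 \<and> (\<forall>t\<in>{0..1}. p (\<alpha> t) = \<gamma> t)"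
    have conn: "connected_space (top_of_set {0..1::real})"
      by (metis connectedin_def connectedin_iff_connected connected_Icc)
    have "\<alpha> s = \<beta> s" if "s \<in> {0..1}" for s
      by (rule cover_lift_unique[OF p conn, where k\<^sub>0 = 0]) (use \<alpha> \<beta> that in \<open>auto simp: pathin_def\<close>)
    then show "\<alpha> = restrict \<beta> {0..1}" using \<alpha> by (auto intro: extensionalityI)
  qed
  then show ?thesis using t by simp
qed

text \<open>Any lift computes the transport, by uniqueness. The rules below are obtained by
  exhibiting a lift or by combining such rules.\<close>

lemma transport_eqI:
  assumes "cover X Y p" "path_between Y y z \<beta>" "\<And>t. t \<in> {0..1} \<Longrightarrow> p (\<beta> t) = \<gamma> t"
  shows "transport Y p \<gamma> y = z"
  using path_lift_eq[OF assms(1) _ assms(3), where t = 1] assms(2) by (auto simp: transport_def path_between_def)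

lemma transport_lift:
  assumes p: "cover X Y p" and \<gamma>: "path_between X a b \<gamma>" and y: "y \<in> fibre Y p a"
  obtains \<beta> where "path_between Y y (transport Y p \<gamma> y) \<beta>" "\<And>t. t \<in> {0..1} \<Longrightarrow> p (\<beta> t) = \<gamma> t"
proof -
  obtain \<beta> where \<beta>: "pathin Y \<beta>" "\<beta> 0 = y" "\<forall>t\<in>{0..1}. p (\<beta> t) = \<gamma> t"
    using path_lift_exists[OF p] \<gamma> y unfolding path_between_def by blast
  then have "path_between Y y (\<beta> 1) \<beta>" by (simp add: path_between_def)
  moreover from this have "transport Y p \<gamma> y = \<beta> 1"
    using \<beta>(3) by (intro transport_eqI[OF p]) auto
  ultimately show ?thesis using that \<beta>(3) by simp
qed

lemma transport_in_fibre:
  assumes "cover X Y p" "path_between X a b \<gamma>" "y \<in> fibre Y p a"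
  shows "transport Y p \<gamma> y \<in> fibre Y p b"
proof -
  obtain \<beta> where \<beta>: "path_between Y y (transport Y p \<gamma> y) \<beta>" "\<And>t. t \<in> {0..1} \<Longrightarrow> p (\<beta> t) = \<gamma> t"
    using transport_lift[OF assms] by blast
  from \<beta>(2)[of 1] have "p (transport Y p \<gamma> y) = b"
    using \<beta>(1) assms(2) by (simp add: path_between_def)
  then show ?thesis using path_between_imp_topspace(2)[OF \<beta>(1)] by simp
qed

text \<open>The homotopy is lifted with value \<open>y\<close> at one corner. Its sides
  \<open>t = 0\<close> and \<open>t = 1\<close> lie over single points, so their lifts are constant;
  hence both edges lift \<gamma> and \<delta> from \<open>y\<close> and end at the same
  point.\<close>

lemma transport_homotopic:
  assumes p: "cover X Y p" and hom: "path_homotopic X a b \<gamma> \<delta>" and y: "y \<in> fibre Y p a"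
  shows "transport Y p \<gamma> y = transport Y p \<delta> y"
proof -
  let ?Q = "{0..1} \<times> {0..1} :: (real \<times> real) set"
  obtain h where h: "continuous_map (top_of_set ?Q) X h"
    "\<forall>t\<in>{0..1}. h (0, t) = \<gamma> t" "\<forall>t\<in>{0..1}. h (1, t) = \<delta> t"
    "\<forall>s\<in>{0..1}. h (s, 0) = a \<and> h (s, 1) = b"
    using hom unfolding path_homotopic_iff by blast
  have "lifts_on Y p h ?Q" using lifts_on_unit_square[OF p h(1)] .
  moreover have "(0, 0) \<in> ?Q" "y \<in> fibre Y p (h (0, 0))" using y h(4) by auto
  ultimately obtain g where g: "continuous_map (top_of_set ?Q) Y g" "g (0, 0) = y" "\<forall>k\<in>?Q. p (g k) = h k"
    unfolding lifts_on_def by blast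
  have side: "pathin Y (g \<circ> k)" if "continuous_on {0..1} k" "k ` {0..1} \<subseteq> ?Q" for k
  proof -
    have "continuous_map (top_of_set {0..1}) (top_of_set ?Q) k"
      using that by (auto simp: continuous_map_subtopology_eu)
    then show ?thesis using g(1) unfolding pathin_def by (rule continuous_map_compose)
  qed
  \<comment> \<open>The side and the constant path at its first point both lift the same constant
    path, so both compute its transport.\<close>
  have const: "g (1, t) = g (0, t)" if t: "t = 0 \<or> t = 1" for t
  proof -
    have path: "pathin Y (g \<circ> (\<lambda>s. (s, t)))" by (rule side) (use t in \<open>auto intro!: continuous_intros\<close>)
    then have "path_between Y (g (0, t)) (g (1, t)) (g \<circ> (\<lambda>s. (s, t)))" by (simp add: path_between_def)
    moreover have "p ((g \<circ> (\<lambda>s. (s, t))) s) = h (0, t)" if "s \<in> {0..1}" for s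
      using that t g(3) h(4) by auto
    ultimately have "transport Y p (\<lambda>s. h (0, t)) (g (0, t)) = g (1, t)" by (intro transport_eqI[OF p])
    moreover have "g (0, t) \<in> topspace Y" "p (g (0, t)) = h (0, t)"
      using path_start_in_topspace[OF path] g(3) t by auto
    then have "transport Y p (\<lambda>s. h (0, t)) (g (0, t)) = g (0, t)"
      by (intro transport_eqI[OF p]) (auto intro: path_between_const)
    ultimately show ?thesis by simp
  qed
  have "transport Y p \<gamma> y = g (0, 1)"
  proof (rule transport_eqI[OF p])
    have "pathin Y (g \<circ> (\<lambda>t. (0, t)))" by (rule side) (auto intro!: continuous_intros)
    then show "path_between Y y (g (0, 1)) (g \<circ> (\<lambda>t. (0, t)))" using g(2) by (simp add: path_between_def)
  qed (use g(3) h(2) in auto)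
  moreover have "transport Y p \<delta> y = g (1, 1)"
  proof (rule transport_eqI[OF p])
    have "pathin Y (g \<circ> (\<lambda>t. (1, t)))" by (rule side) (auto intro!: continuous_intros)
    then show "path_between Y y (g (1, 1)) (g \<circ> (\<lambda>t. (1, t)))"
      using g(2) const[of 0] by (simp add: path_between_def)
  qed (use g(3) h(3) in auto)
  ultimately show ?thesis using const[of 1] by simp
qed

lemma transport_const:
  assumes "cover X Y p" "y \<in> fibre Y p a"
  shows "transport Y p (\<lambda>t. a) y = y"
  using assms by (intro transport_eqI[OF assms(1)]) (auto intro: path_between_const)

lemma transport_concat:
  assumes p: "cover X Y p" and \<gamma>: "path_between X a b \<gamma>" and \<delta>: "path_between X b c \<delta>"
    and y: "y \<in> fibre Y p a"
  shows "transport Y p (path_concat \<gamma> \<delta>) y = transport Y p \<delta> (transport Y p \<gamma> y)"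
proof -
  obtain \<beta> where \<beta>: "path_between Y y (transport Y p \<gamma> y) \<beta>" "\<And>t. t \<in> {0..1} \<Longrightarrow> p (\<beta> t) = \<gamma> t"
    using transport_lift[OF p \<gamma> y] by blast
  obtain \<beta>' where \<beta>': "path_between Y (transport Y p \<gamma> y) (transport Y p \<delta> (transport Y p \<gamma> y)) \<beta>'"
    "\<And>t. t \<in> {0..1} \<Longrightarrow> p (\<beta>' t) = \<delta> t"
    using transport_lift[OF p \<delta> transport_in_fibre[OF p \<gamma> y]] by blast
  show ?thesis
    by (rule transport_eqI[OF p path_between_concat[OF \<beta>(1) \<beta>'(1)]])
      (auto simp: path_concat_def \<beta>(2) \<beta>'(2))
qed

lemma transport_reverse:
  assumes p: "cover X Y p" and \<gamma>: "path_between X a b \<gamma>" and y: "y \<in> fibre Y p a"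
  shows "transport Y p (path_reverse \<gamma>) (transport Y p \<gamma> y) = y"
  using transport_concat[OF p \<gamma> path_between_reverse[OF \<gamma>] y]
    transport_homotopic[OF p path_homotopic_reverse_right[OF \<gamma>] y] transport_const[OF p y] by simp

lemma transport_reverse':
  assumes p: "cover X Y p" and \<gamma>: "path_between X a b \<gamma>" and y: "y \<in> fibre Y p b"
  shows "transport Y p \<gamma> (transport Y p (path_reverse \<gamma>) y) = y"
  using transport_reverse[OF p path_between_reverse[OF \<gamma>] y] by simp

text \<open>A morphism sends lifts to lifts.\<close>

lemma transport_morphism:
  assumes p: "cover X Y p" and q: "cover X Z q" and f: "continuous_map Y Z f" "\<And>y. y \<in> topspace Y \<Longrightarrow> q (f y) = p y"
    and \<gamma>: "path_between X a b \<gamma>" and y: "y \<in> fibre Y p a"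
  shows "f (transport Y p \<gamma> y) = transport Z q \<gamma> (f y)"
proof -
  obtain \<beta> where \<beta>: "path_between Y y (transport Y p \<gamma> y) \<beta>" "\<And>t. t \<in> {0..1} \<Longrightarrow> p (\<beta> t) = \<gamma> t"
    using transport_lift[OF p \<gamma> y] by blast
  have "transport Z q \<gamma> (f y) = f (transport Y p \<gamma> y)"
    by (rule transport_eqI[OF q path_between_map[OF \<beta>(1) f(1)]])
      (simp add: \<beta>(2) f(2) path_between_in_topspace[OF \<beta>(1)])
  then show ?thesis by simp
qed

text \<open>Over \<open>N\<close> the path \<open>s\<close> after \<gamma> is a lift. This ties
  transport to the topology of the cover.\<close>

lemma transport_section:
  assumes p: "cover X Y p" and s: "continuous_map (subtopology X N) Y s" "\<And>b. b \<in> N \<Longrightarrow> p (s b) = b"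
    and \<gamma>: "path_between (subtopology X N) a b \<gamma>"
  shows "transport Y p \<gamma> (s a) = s b"
  by (rule transport_eqI[OF p path_between_map[OF \<gamma> s(1)]])
    (use s(2) \<gamma> in \<open>auto simp: path_between_subtopology\<close>)

section \<open>The fundamental group and the monodromy action\<close>

lemma loop_class_eq:
  assumes "path_homotopic X x x \<gamma> \<delta>"
  shows "loop_class X x \<gamma> = loop_class X x \<delta>"
  unfolding loop_class_def loop_homotopic_eq
  using path_homotopic_trans[OF assms] path_homotopic_trans[OF path_homotopic_sym[OF assms]]
  by (intro Collect_cong) blast

lemma carrier_pi1: "carrier (pi1 X x) = loop_class X x ` {\<gamma>. path_between X x x \<gamma>}"
  by (simp add: pi1_def loopin_iff_path_between)

lemma one_pi1: "\<one>\<^bsub>pi1 X x\<^esub> = loop_class X x (\<lambda>t. x)"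
  by (simp add: pi1_def)

lemma loop_class_in_carrier: "path_between X x x \<gamma> \<Longrightarrow> loop_class X x \<gamma> \<in> carrier (pi1 X x)"
  by (simp add: carrier_pi1)

lemma mult_pi1:
  assumes "path_between X x x \<gamma>" "path_between X x x \<delta>"
  shows "loop_class X x \<delta> \<otimes>\<^bsub>pi1 X x\<^esub> loop_class X x \<gamma> = loop_class X x (path_concat \<gamma> \<delta>)"
proof -
  have eq: "loop_class X x (path_concat \<gamma>' \<delta>') = loop_class X x (path_concat \<gamma> \<delta>)"
    if "\<delta>' \<in> loop_class X x \<delta>" "\<gamma>' \<in> loop_class X x \<gamma>" for \<gamma>' \<delta>'
  proof -
    have "path_homotopic X x x \<gamma> \<gamma>'" "path_homotopic X x x \<delta> \<delta>'"
      using that by (simp_all add: loop_class_def loop_homotopic_eq)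
    from loop_class_eq[OF path_homotopic_concat[OF this]] show ?thesis by simp
  qed
  have "\<delta> \<in> loop_class X x \<delta>" "\<gamma> \<in> loop_class X x \<gamma>"
    using assms by (simp_all add: loop_class_def loop_homotopic_eq path_homotopic_refl)
  then have "(\<Union>\<delta>'\<in>loop_class X x \<delta>. \<Union>\<gamma>'\<in>loop_class X x \<gamma>. loop_class X x (path_concat \<gamma>' \<delta>'))
    = loop_class X x (path_concat \<gamma> \<delta>)"
    using eq by blast
  then show ?thesis by (simp add: pi1_def)
qed

lemma inverse_pi1:
  assumes "path_between X x x \<gamma>"
  shows "loop_class X x (path_reverse \<gamma>) \<otimes>\<^bsub>pi1 X x\<^esub> loop_class X x \<gamma> = \<one>\<^bsub>pi1 X x\<^esub>"
  using mult_pi1[OF assms path_between_reverse[OF assms]] loop_class_eq[OF path_homotopic_reverse_right[OF assms]]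
  by (simp add: one_pi1)

lemma group_pi1:
  assumes "x \<in> topspace X"
  shows "group (pi1 X x)"
proof (rule groupI)
  show "\<one>\<^bsub>pi1 X x\<^esub> \<in> carrier (pi1 X x)"
    using assms by (simp add: one_pi1 loop_class_in_carrier path_between_const)
next
  fix c d assume "c \<in> carrier (pi1 X x)" "d \<in> carrier (pi1 X x)"
  then show "c \<otimes>\<^bsub>pi1 X x\<^esub> d \<in> carrier (pi1 X x)"
    by (auto simp: carrier_pi1 mult_pi1 path_between_concat)
next
  fix c d e assume "c \<in> carrier (pi1 X x)" "d \<in> carrier (pi1 X x)" "e \<in> carrier (pi1 X x)"
  then obtain \<gamma> \<delta> \<epsilon> where paths: "path_between X x x \<gamma>" "path_between X x x \<delta>" "path_between X x x \<epsilon>"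
    and eqs: "c = loop_class X x \<gamma>" "d = loop_class X x \<delta>" "e = loop_class X x \<epsilon>"
    by (auto simp: carrier_pi1)
  \<comment> \<open>The product reads from right to left, so associativity of paths is needed for
    \<epsilon>, \<delta>, \<gamma> in this order.\<close>
  then show "c \<otimes>\<^bsub>pi1 X x\<^esub> d \<otimes>\<^bsub>pi1 X x\<^esub> e = c \<otimes>\<^bsub>pi1 X x\<^esub> (d \<otimes>\<^bsub>pi1 X x\<^esub> e)"
    using loop_class_eq[OF path_homotopic_assoc[OF paths(3,2,1)]] by (simp add: mult_pi1 path_between_concat)
next
  fix c assume "c \<in> carrier (pi1 X x)"
  then obtain \<gamma> where \<gamma>: "path_between X x x \<gamma>" "c = loop_class X x \<gamma>" by (auto simp: carrier_pi1)
  \<comment> \<open>A unit on the left of the product is a constant loop that runs last.\<close>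
  then show "\<one>\<^bsub>pi1 X x\<^esub> \<otimes>\<^bsub>pi1 X x\<^esub> c = c"
    using loop_class_eq[OF path_homotopic_const_right[OF \<gamma>(1)]] path_between_const[OF assms]
    by (simp add: mult_pi1 one_pi1)
  show "\<exists>d\<in>carrier (pi1 X x). d \<otimes>\<^bsub>pi1 X x\<^esub> c = \<one>\<^bsub>pi1 X x\<^esub>"
    using inverse_pi1[OF \<gamma>(1)] path_between_reverse[OF \<gamma>(1)] \<gamma>(2) loop_class_in_carrier by metis
qed

section \<open>The monodromy action\<close>

text \<open>Homotopy invariance makes the set of endpoints a singleton, so \<open>the_elem\<close>
  returns the transport along any one representative. Facts about monodromy are reduced to transport
  by it.\<close>

lemma monodromy_loop_class:
  assumes p: "cover X Y p" and \<gamma>: "path_between X x x \<gamma>" and y: "y \<in> fibre Y p x"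
  shows "monodromy X x Y p (loop_class X x \<gamma>) y = transport Y p \<gamma> y"
proof -
  have "\<gamma> \<in> loop_class X x \<gamma>"
    using \<gamma> by (simp add: loop_class_def loop_homotopic_eq path_homotopic_refl)
  moreover have "path_lift Y p \<delta> y 1 = transport Y p \<gamma> y" if "\<delta> \<in> loop_class X x \<gamma>" for \<delta>
  proof -
    have "path_homotopic X x x \<gamma> \<delta>" using that by (simp add: loop_class_def loop_homotopic_eq)
    then show ?thesis using transport_homotopic[OF p _ y] by (simp add: transport_def)
  qed
  ultimately have "(\<lambda>\<delta>. path_lift Y p \<delta> y 1) ` loop_class X x \<gamma> = {transport Y p \<gamma> y}" by auto
  then show ?thesis using \<gamma> y by (simp add: monodromy_def loop_class_in_carrier)
qed

text \<open>Pointwise laws suffice: the action of the inverse element supplies bijectivity.\<close>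

lemma group_actionI:
  assumes "group G"
    and cl: "\<And>g e. \<lbrakk>g \<in> carrier G; e \<in> E\<rbrakk> \<Longrightarrow> \<phi> g e \<in> E"
    and ext: "\<And>g. g \<in> carrier G \<Longrightarrow> \<phi> g \<in> extensional E"
    and one: "\<And>e. e \<in> E \<Longrightarrow> \<phi> \<one>\<^bsub>G\<^esub> e = e"
    and mult: "\<And>g h e. \<lbrakk>g \<in> carrier G; h \<in> carrier G; e \<in> E\<rbrakk> \<Longrightarrow> \<phi> (g \<otimes>\<^bsub>G\<^esub> h) e = \<phi> g (\<phi> h e)"
  shows "group_action G E \<phi>"
proof -
  interpret group G by fact
  have bij: "\<phi> g \<in> Bij E" if g: "g \<in> carrier G" for g
  proof -
    have "bij_betw (\<phi> g) E E"
    proof (rule bij_betw_byWitness[where f' = "\<phi> (inv\<^bsub>G\<^esub> g)"])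
      show "\<forall>e\<in>E. \<phi> (inv\<^bsub>G\<^esub> g) (\<phi> g e) = e" "\<forall>e\<in>E. \<phi> g (\<phi> (inv\<^bsub>G\<^esub> g) e) = e"
        using g one mult[symmetric] by simp_all
    qed (use g cl in auto)
    then show ?thesis using ext[OF g] by (simp add: Bij_def)
  qed
  have "\<phi> \<in> hom G (BijGroup E)"
  proof (rule homI)
    fix g h assume gh: "g \<in> carrier G" "h \<in> carrier G"
    then show "\<phi> (g \<otimes>\<^bsub>G\<^esub> h) = \<phi> g \<otimes>\<^bsub>BijGroup E\<^esub> \<phi> h"
      using ext mult bij by (auto simp: BijGroup_def compose_def intro: extensionalityI[of _ E])
  qed (use bij in \<open>simp add: BijGroup_def\<close>)
  then show ?thesis
    by (simp add: group_action_def group_hom_def group_hom_axioms_def group_BijGroup assms(1))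
qed

lemma group_action_monodromy:
  assumes x: "x \<in> topspace X" and p: "cover X Y p"
  shows "group_action (pi1 X x) (fibre Y p x) (monodromy X x Y p)"
proof (rule group_actionI[OF group_pi1[OF x]])
  fix c y assume "c \<in> carrier (pi1 X x)" "y \<in> fibre Y p x"
  then show "monodromy X x Y p c y \<in> fibre Y p x"
    using transport_in_fibre[OF p] by (auto simp: carrier_pi1 monodromy_loop_class[OF p])
next
  fix c assume "c \<in> carrier (pi1 X x)"
  then show "monodromy X x Y p c \<in> extensional (fibre Y p x)" by (simp add: monodromy_def)
next
  fix y assume "y \<in> fibre Y p x"
  then show "monodromy X x Y p \<one>\<^bsub>pi1 X x\<^esub> y = y"
    using monodromy_loop_class[OF p path_between_const[OF x]] transport_const[OF p] by (simp add: one_pi1)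
next
  fix c d y assume "c \<in> carrier (pi1 X x)" "d \<in> carrier (pi1 X x)" and y: "y \<in> fibre Y p x"
  then obtain \<gamma> \<delta> where paths: "path_between X x x \<gamma>" "path_between X x x \<delta>"
    and eqs: "c = loop_class X x \<gamma>" "d = loop_class X x \<delta>"
    by (auto simp: carrier_pi1)
  show "monodromy X x Y p (c \<otimes>\<^bsub>pi1 X x\<^esub> d) y = monodromy X x Y p c (monodromy X x Y p d y)"
    using paths y transport_in_fibre[OF p paths(2) y] transport_concat[OF p paths(2,1) y]
    by (simp add: eqs mult_pi1 monodromy_loop_class[OF p] path_between_concat)
qed

section \<open>Fully faithful essentially surjective functors\<close>

lemma category_id: "\<lbrakk>is_category C; a \<in> ob C\<rbrakk> \<Longrightarrow> idt C a \<in> hm C a a"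
  by (simp add: is_category_def)

lemma category_comp:
  "\<lbrakk>is_category C; a \<in> ob C; b \<in> ob C; c \<in> ob C; f \<in> hm C a b; g \<in> hm C b c\<rbrakk>
    \<Longrightarrow> cmp C a b c g f \<in> hm C a c"
  unfolding is_category_def by blast

lemma category_id_left:
  "\<lbrakk>is_category C; a \<in> ob C; b \<in> ob C; f \<in> hm C a b\<rbrakk> \<Longrightarrow> cmp C a b b (idt C b) f = f"
  unfolding is_category_def by blast

lemma category_id_right:
  "\<lbrakk>is_category C; a \<in> ob C; b \<in> ob C; f \<in> hm C a b\<rbrakk> \<Longrightarrow> cmp C a a b f (idt C a) = f"
  unfolding is_category_def by blast

lemma category_assoc:
  "\<lbrakk>is_category C; a \<in> ob C; b \<in> ob C; c \<in> ob C; d \<in> ob C; f \<in> hm C a b; g \<in> hm C b c; h \<in> hm C c d\<rbrakk>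
    \<Longrightarrow> cmp C a b d (cmp C b c d h g) f = cmp C a c d h (cmp C a b c g f)"
  unfolding is_category_def by metis

lemma functor_ob: "\<lbrakk>is_functor C D F; a \<in> ob C\<rbrakk> \<Longrightarrow> fob F a \<in> ob D"
  by (simp add: is_functor_def)

lemma functor_hm:
  "\<lbrakk>is_functor C D F; a \<in> ob C; b \<in> ob C; f \<in> hm C a b\<rbrakk> \<Longrightarrow> far F a b f \<in> hm D (fob F a) (fob F b)"
  by (simp add: is_functor_def)

lemma functor_id: "\<lbrakk>is_functor C D F; a \<in> ob C\<rbrakk> \<Longrightarrow> far F a a (idt C a) = idt D (fob F a)"
  by (simp add: is_functor_def)

lemma functor_comp:
  "\<lbrakk>is_functor C D F; a \<in> ob C; b \<in> ob C; c \<in> ob C; f \<in> hm C a b; g \<in> hm C b c\<rbrakk>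
    \<Longrightarrow> far F a c (cmp C a b c g f) = cmp D (fob F a) (fob F b) (fob F c) (far F b c g) (far F a b f)"
  by (simp add: is_functor_def)

text \<open>The quasi-inverse sends \<open>d\<close> to a chosen \<open>g d\<close> with an
  isomorphism \<open>e d\<close> from its image to \<open>d\<close>. On arrows it takes the preimage
  under F of the conjugate of \<open>u\<close> by these isomorphisms. All identities in C are
  checked after applying F, where faithfulness reflects them.\<close>

lemma equivalence_of_categoriesI:
  assumes F: "is_functor C D F"
    and faithful: "\<And>a b f g. \<lbrakk>a \<in> ob C; b \<in> ob C; f \<in> hm C a b; g \<in> hm C a b; far F a b f = far F a b g\<rbrakk> \<Longrightarrow> f = g"
    and full: "\<And>a b h. \<lbrakk>a \<in> ob C; b \<in> ob C; h \<in> hm D (fob F a) (fob F b)\<rbrakk> \<Longrightarrow> \<exists>f\<in>hm C a b. far F a b f = h"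
    and ess: "\<And>d. d \<in> ob D \<Longrightarrow> \<exists>a\<in>ob C. \<exists>i. iso_arrow D (fob F a) d i"
  shows "equivalence_of_categories C D F"
proof -
  have C: "is_category C" and D: "is_category D" using F by (simp_all add: is_functor_def)
  obtain g where "\<forall>d\<in>ob D. g d \<in> ob C \<and> (\<exists>i. iso_arrow D (fob F (g d)) d i)"
    using bchoice[of "ob D" "\<lambda>d a. a \<in> ob C \<and> (\<exists>i. iso_arrow D (fob F a) d i)"] ess by blast
  then have g: "\<And>d. d \<in> ob D \<Longrightarrow> g d \<in> ob C" and "\<forall>d\<in>ob D. \<exists>i. iso_arrow D (fob F (g d)) d i"
    by blast+
  then obtain e where e_iso: "\<forall>d\<in>ob D. iso_arrow D (fob F (g d)) d (e d)"
    using bchoice[of "ob D" "\<lambda>d i. iso_arrow D (fob F (g d)) d i"] by blast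
  let ?F = "\<lambda>d. fob F (g d)"
  have "\<forall>d\<in>ob D. \<exists>i. i \<in> hm D d (?F d) \<and> cmp D (?F d) d (?F d) i (e d) = idt D (?F d)
      \<and> cmp D d (?F d) d (e d) i = idt D d"
    using e_iso unfolding iso_arrow_def by blast
  then obtain e' where "\<forall>d\<in>ob D. e' d \<in> hm D d (?F d) \<and> cmp D (?F d) d (?F d) (e' d) (e d) = idt D (?F d)
      \<and> cmp D d (?F d) d (e d) (e' d) = idt D d"
    using bchoice[of "ob D" "\<lambda>d i. i \<in> hm D d (?F d) \<and> cmp D (?F d) d (?F d) i (e d) = idt D (?F d)
      \<and> cmp D d (?F d) d (e d) i = idt D d"] by blast
  then have e'_hm: "\<And>d. d \<in> ob D \<Longrightarrow> e' d \<in> hm D d (?F d)"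
    and e'e: "\<And>d. d \<in> ob D \<Longrightarrow> cmp D (?F d) d (?F d) (e' d) (e d) = idt D (?F d)"
    and ee': "\<And>d. d \<in> ob D \<Longrightarrow> cmp D d (?F d) d (e d) (e' d) = idt D d" by blast+
  have e_hm: "\<And>d. d \<in> ob D \<Longrightarrow> e d \<in> hm D (?F d) d" using e_iso by (simp add: iso_arrow_def)
  have Fg: "\<And>d. d \<in> ob D \<Longrightarrow> ?F d \<in> ob D" using g functor_ob[OF F] by blast
  \<comment> \<open>The conjugate of \<open>u\<close>: along \<open>e d\<close>, through
    \<open>u\<close>, and back along the inverse of \<open>e d'\<close>.\<close>
  define T where "T = (\<lambda>d d' u. cmp D (?F d) d' (?F d') (e' d') (cmp D (?F d) d d' u (e d)))"
  have T_hm: "T d d' u \<in> hm D (?F d) (?F d')" if "d \<in> ob D" "d' \<in> ob D" "u \<in> hm D d d'" for d d' u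
    unfolding T_def
    by (rule category_comp[OF D _ _ _ category_comp[OF D]]) (use that Fg e_hm e'_hm in auto)
  have eT: "cmp D (?F d) (?F d') d' (e d') (T d d' u) = cmp D (?F d) d d' u (e d)"
    if "d \<in> ob D" "d' \<in> ob D" "u \<in> hm D d d'" for d d' u
  proof -
    have k: "cmp D (?F d) d d' u (e d) \<in> hm D (?F d) d'"
      by (rule category_comp[OF D]) (use that Fg e_hm in auto)
    show ?thesis unfolding T_def
      using category_assoc[OF D Fg[OF that(1)] that(2) Fg[OF that(2)] that(2) k e'_hm[OF that(2)] e_hm[OF that(2)]]
        ee'[OF that(2)] category_id_left[OF D Fg[OF that(1)] that(2) k] by simp
  qed
  \<comment> \<open>As \<open>e d'\<close> is invertible, \<open>T d d' u\<close> is the only arrow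
    that makes the naturality square of \<open>e\<close> commute. The functor laws for T therefore
    follow by pasting squares.\<close>
  have T_unique: "w = T d d' u"
    if "d \<in> ob D" "d' \<in> ob D" "u \<in> hm D d d'" and w: "w \<in> hm D (?F d) (?F d')"
      and eq: "cmp D (?F d) (?F d') d' (e d') w = cmp D (?F d) d d' u (e d)" for d d' u w
  proof -
    have "cmp D (?F d) d' (?F d') (e' d') (cmp D (?F d) (?F d') d' (e d') w) = w"
      using category_assoc[OF D Fg[OF that(1)] Fg[OF that(2)] that(2) Fg[OF that(2)] w e_hm[OF that(2)] e'_hm[OF that(2)]]
        e'e[OF that(2)] category_id_left[OF D Fg[OF that(1)] Fg[OF that(2)] w] by simp
    then show ?thesis using eq by (simp add: T_def)
  qed
  have "\<exists>f. f \<in> hm C (g d) (g d') \<and> far F (g d) (g d') f = T d d' u"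
    if "d \<in> ob D" "d' \<in> ob D" "u \<in> hm D d d'" for d d' u
    using full[OF g g T_hm] that by blast
  then obtain G where G: "\<And>d d' u. \<lbrakk>d \<in> ob D; d' \<in> ob D; u \<in> hm D d d'\<rbrakk> \<Longrightarrow>
      G d d' u \<in> hm C (g d) (g d') \<and> far F (g d) (g d') (G d d' u) = T d d' u"
    by metis
  define GG where "GG = \<lparr>fob = g, far = G\<rparr>"
  have "is_functor D C GG"
    unfolding is_functor_def
  proof (intro conjI ballI C D)
    fix d assume d: "d \<in> ob D"
    show "fob GG d \<in> ob C" using g d by (simp add: GG_def)
    have "far F (g d) (g d) (G d d (idt D d)) = T d d (idt D d)" using G d category_id[OF D] by blast
    also have "\<dots> = idt D (?F d)"
      by (rule T_unique[symmetric])
        (simp_all add: d Fg category_id[OF D] category_id_left[OF D] category_id_right[OF D] e_hm)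
    also have "\<dots> = far F (g d) (g d) (idt C (g d))" using functor_id[OF F] g d by simp
    finally have "G d d (idt D d) = idt C (g d)"
      using G d category_id[OF D] category_id[OF C] g by (intro faithful[of "g d" "g d"]) simp_all
    then show "far GG d d (idt D d) = idt C (fob GG d)" by (simp add: GG_def)
  next
    fix d d' u assume "d \<in> ob D" "d' \<in> ob D" "u \<in> hm D d d'"
    then show "far GG d d' u \<in> hm C (fob GG d) (fob GG d')" using G by (simp add: GG_def)
  next
    fix a b c u v assume a: "a \<in> ob D" and b: "b \<in> ob D" and c: "c \<in> ob D"
      and u: "u \<in> hm D a b" and v: "v \<in> hm D b c"
    have vu: "cmp D a b c v u \<in> hm D a c" by (rule category_comp[OF D a b c u v])
    have "cmp D (?F a) (?F b) (?F c) (T b c v) (T a b u) = T a c (cmp D a b c v u)"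
    proof (rule T_unique[OF a c vu])
      show "cmp D (?F a) (?F b) (?F c) (T b c v) (T a b u) \<in> hm D (?F a) (?F c)"
        by (rule category_comp[OF D]) (simp_all add: a b c u v Fg T_hm)
      have "cmp D (?F a) (?F c) c (e c) (cmp D (?F a) (?F b) (?F c) (T b c v) (T a b u))
          = cmp D (?F a) (?F b) c (cmp D (?F b) (?F c) c (e c) (T b c v)) (T a b u)"
        by (rule category_assoc[OF D, symmetric]) (simp_all add: a b c u v Fg T_hm e_hm)
      also have "\<dots> = cmp D (?F a) (?F b) c (cmp D (?F b) b c v (e b)) (T a b u)"
        by (simp add: eT b c v)
      also have "\<dots> = cmp D (?F a) b c v (cmp D (?F a) (?F b) b (e b) (T a b u))"
        by (rule category_assoc[OF D]) (simp_all add: a b c u v Fg T_hm e_hm)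
      also have "\<dots> = cmp D (?F a) b c v (cmp D (?F a) a b u (e a))"
        by (simp add: eT a b u)
      also have "\<dots> = cmp D (?F a) a c (cmp D a b c v u) (e a)"
        by (rule category_assoc[OF D, symmetric]) (simp_all add: a b c u v Fg T_hm e_hm)
      finally show "cmp D (?F a) (?F c) c (e c) (cmp D (?F a) (?F b) (?F c) (T b c v) (T a b u))
          = cmp D (?F a) a c (cmp D a b c v u) (e a)" .
    qed
    then have "far F (g a) (g c) (cmp C (g a) (g b) (g c) (G b c v) (G a b u))
        = far F (g a) (g c) (G a c (cmp D a b c v u))"
      using functor_comp[OF F] G a b c u v vu g by simp
    then have "cmp C (g a) (g b) (g c) (G b c v) (G a b u) = G a c (cmp D a b c v u)"
      using faithful[OF g[OF a] g[OF c]] category_comp[OF C g[OF a] g[OF b] g[OF c]] G a b c u v vu by simp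
    then show "far GG a c (cmp D a b c v u)
        = cmp C (fob GG a) (fob GG b) (fob GG c) (far GG b c v) (far GG a b u)"
      by (simp add: GG_def)
  qed
  moreover have "naturally_isomorphic D D (comp_functor F GG) id_functor"
    unfolding naturally_isomorphic_def
    by (rule exI[of _ e]) (use e_iso G eT in \<open>auto simp: comp_functor_def id_functor_def GG_def\<close>)
  moreover have "naturally_isomorphic C C (comp_functor GG F) id_functor"
  proof -
    have FgF: "g (fob F a) \<in> ob C" "fob F a \<in> ob D" if "a \<in> ob C" for a
      using g functor_ob[OF F] that by blast+
    \<comment> \<open>At the object \<open>fob F a\<close> the isomorphism \<open>e\<close> runs
      between images of objects of C, so fullness gives a preimage \<open>n a\<close>. Faithfulness
      reflects its invertibility and its naturality.\<close>
    have "\<exists>n. n \<in> hm C (g (fob F a)) a \<and> far F (g (fob F a)) a n = e (fob F a)" if "a \<in> ob C" for a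
      using full[OF FgF(1)[OF that] that e_hm[OF FgF(2)[OF that]]] by blast
    then obtain n where n: "\<And>a. a \<in> ob C \<Longrightarrow> n a \<in> hm C (g (fob F a)) a \<and> far F (g (fob F a)) a (n a) = e (fob F a)"
      by metis
    have iso: "iso_arrow C (g (fob F a)) a (n a)" if a: "a \<in> ob C" for a
    proof -
      obtain n' where n': "n' \<in> hm C a (g (fob F a))" "far F a (g (fob F a)) n' = e' (fob F a)"
        using full[OF a FgF(1)[OF a] e'_hm[OF FgF(2)[OF a]]] by blast
      have "cmp C (g (fob F a)) a (g (fob F a)) n' (n a) = idt C (g (fob F a))"
        by (rule faithful[OF FgF(1)[OF a] FgF(1)[OF a]])
          (simp_all add: a FgF n n' category_comp[OF C] category_id[OF C] functor_comp[OF F] functor_id[OF F] e'e)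
      moreover have "cmp C a (g (fob F a)) a (n a) n' = idt C a"
        by (rule faithful[OF a a])
          (simp_all add: a FgF n n' category_comp[OF C _ FgF(1)[OF a]] category_id[OF C]
            functor_comp[OF F _ FgF(1)[OF a]] functor_id[OF F] ee')
      ultimately show ?thesis using n[OF a] n'(1) unfolding iso_arrow_def by blast
    qed
    have nat: "cmp C (g (fob F a)) (g (fob F b)) b (n b) (G (fob F a) (fob F b) (far F a b f))
        = cmp C (g (fob F a)) a b f (n a)" if a: "a \<in> ob C" and b: "b \<in> ob C" and f: "f \<in> hm C a b" for a b f
    proof -
      have Ff: "far F a b f \<in> hm D (fob F a) (fob F b)" by (rule functor_hm[OF F a b f])
      note GF = G[OF FgF(2)[OF a] FgF(2)[OF b] Ff]
      show ?thesis
      proof (rule faithful[OF FgF(1)[OF a] b])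
        show "cmp C (g (fob F a)) (g (fob F b)) b (n b) (G (fob F a) (fob F b) (far F a b f)) \<in> hm C (g (fob F a)) b"
          using category_comp[OF C FgF(1)[OF a] FgF(1)[OF b] b] GF n[OF b] by blast
        show "cmp C (g (fob F a)) a b f (n a) \<in> hm C (g (fob F a)) b"
          using category_comp[OF C FgF(1)[OF a] a b] f n[OF a] by blast
        show "far F (g (fob F a)) b (cmp C (g (fob F a)) (g (fob F b)) b (n b) (G (fob F a) (fob F b) (far F a b f)))
          = far F (g (fob F a)) b (cmp C (g (fob F a)) a b f (n a))"
          using functor_comp[OF F FgF(1)[OF a] FgF(1)[OF b] b, of "G (fob F a) (fob F b) (far F a b f)" "n b"]
            functor_comp[OF F FgF(1)[OF a] a b, of "n a" f] GF n[OF a] n[OF b] f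
            eT[OF FgF(2)[OF a] FgF(2)[OF b] Ff] by simp
      qed
    qed
    show ?thesis
      unfolding naturally_isomorphic_def
      by (rule exI[of _ n]) (use iso nat in \<open>auto simp: comp_functor_def id_functor_def GG_def\<close>)
  qed
  ultimately show ?thesis using F unfolding equivalence_of_categories_def by blast
qed

section \<open>The fibre functor\<close>

lemma ob_Cov: "(Y, p) \<in> ob (Cov X) \<longleftrightarrow> cover X Y p \<and> p \<in> extensional (topspace Y)"
  by (simp add: Cov_def)

lemma hm_Cov: "f \<in> hm (Cov X) (Y, p) (Z, q) \<longleftrightarrow>
    f \<in> extensional (topspace Y) \<and> continuous_map Y Z f \<and> (\<forall>y\<in>topspace Y. q (f y) = p y)"
  by (simp add: Cov_def)

lemma ob_GSet: "(E, \<phi>) \<in> ob (GSet G) \<longleftrightarrow> group_action G E \<phi> \<and> \<phi> \<in> extensional (carrier G)"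
  by (simp add: GSet_def)

lemma hm_GSet: "f \<in> hm (GSet G) (E, \<phi>) (F, \<psi>) \<longleftrightarrow>
    f \<in> E \<rightarrow>\<^sub>E F \<and> (\<forall>g\<in>carrier G. \<forall>e\<in>E. f (\<phi> g e) = \<psi> g (f e))"
  by (simp add: GSet_def equivariant_def)

lemma is_category_Cov:
  fixes X :: "'a topology"
  shows "is_category (Cov X :: ('b topology \<times> ('b \<Rightarrow> 'a), 'b \<Rightarrow> 'b) cat)"
  unfolding is_category_def
proof (intro conjI ballI)
  fix a :: "'b topology \<times> ('b \<Rightarrow> 'a)" assume "a \<in> ob (Cov X)"
  then show "idt (Cov X) a \<in> hm (Cov X) a a"
    by (cases a) (auto simp: Cov_def intro: continuous_map_eq[OF continuous_map_id])
next
  fix a b c :: "'b topology \<times> ('b \<Rightarrow> 'a)" and f g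
  obtain Y p Z q W r where abc: "a = (Y, p)" "b = (Z, q)" "c = (W, r)" by (cases a, cases b, cases c) blast
  assume f: "f \<in> hm (Cov X) a b" and g: "g \<in> hm (Cov X) b c"
  have "continuous_map Y W (compose (topspace Y) g f)"
    using f g by (intro continuous_map_eq[OF continuous_map_compose[of Y Z f W g]]) (auto simp: abc hm_Cov compose_def)
  moreover have "f y \<in> topspace Z" if "y \<in> topspace Y" for y
    using that f continuous_map_image_subset_topspace by (fastforce simp: abc hm_Cov)
  ultimately have "compose (topspace Y) g f \<in> hm (Cov X) a c"
    using f g by (auto simp: abc hm_Cov compose_def)
  then show "cmp (Cov X) a b c g f \<in> hm (Cov X) a c" by (simp add: Cov_def abc)
next
  fix a b :: "'b topology \<times> ('b \<Rightarrow> 'a)" and f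
  obtain Y p Z q where ab: "a = (Y, p)" "b = (Z, q)" by (cases a, cases b) blast
  assume f: "f \<in> hm (Cov X) a b"
  have "f y \<in> topspace Z" if "y \<in> topspace Y" for y
    using that f continuous_map_image_subset_topspace by (fastforce simp: ab hm_Cov)
  then show "cmp (Cov X) a b b (idt (Cov X) b) f = f" "cmp (Cov X) a a b f (idt (Cov X) a) = f"
    using f by (auto simp: ab Cov_def compose_def extensional_def fun_eq_iff)
next
  fix a b c d :: "'b topology \<times> ('b \<Rightarrow> 'a)" and f g h
  obtain Y p Z q W r where abc: "a = (Y, p)" "b = (Z, q)" "c = (W, r)" by (cases a, cases b, cases c) blast
  assume f: "f \<in> hm (Cov X) a b"
  have "f y \<in> topspace Z" if "y \<in> topspace Y" for y
    using that f continuous_map_image_subset_topspace by (fastforce simp: abc hm_Cov)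
  then show "cmp (Cov X) a c d h (cmp (Cov X) a b c g f) = cmp (Cov X) a b d (cmp (Cov X) b c d h g) f"
    by (auto simp: abc Cov_def compose_def fun_eq_iff)
qed

lemma is_category_GSet:
  fixes G :: "('a, 'z) monoid_scheme"
  shows "is_category (GSet G :: ('b set \<times> ('a \<Rightarrow> 'b \<Rightarrow> 'b), 'b \<Rightarrow> 'b) cat)"
  unfolding is_category_def
proof (intro conjI ballI)
  fix a :: "'b set \<times> ('a \<Rightarrow> 'b \<Rightarrow> 'b)" assume a: "a \<in> ob (GSet G)"
  obtain E \<phi> where E: "a = (E, \<phi>)" by (cases a)
  then have "\<phi> g e \<in> E" if "g \<in> carrier G" "e \<in> E" for g e
    using a that group_action.element_image[of G E \<phi> g e] by (auto simp: ob_GSet)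
  then show "idt (GSet G) a \<in> hm (GSet G) a a" by (auto simp: E GSet_def equivariant_def)
next
  fix a b c :: "'b set \<times> ('a \<Rightarrow> 'b \<Rightarrow> 'b)" and f g
  assume a: "a \<in> ob (GSet G)" and f: "f \<in> hm (GSet G) a b" and g: "g \<in> hm (GSet G) b c"
  obtain E \<phi> E' \<phi>' E'' \<phi>'' where abc: "a = (E, \<phi>)" "b = (E', \<phi>')" "c = (E'', \<phi>'')"
    by (cases a, cases b, cases c) blast
  then have "\<phi> g e \<in> E" if "g \<in> carrier G" "e \<in> E" for g e
    using a that group_action.element_image[of G E \<phi> g e] by (auto simp: ob_GSet)
  then have "compose E g f \<in> hm (GSet G) a c"
    using f g by (auto simp: abc hm_GSet compose_def PiE_iff)
  then show "cmp (GSet G) a b c g f \<in> hm (GSet G) a c" by (simp add: abc GSet_def)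
qed (auto simp: GSet_def equivariant_def compose_def PiE_iff extensional_def fun_eq_iff)

lemma fob_Fib [simp]: "fob (Fib X x) (Y, p) = (fibre Y p x, monodromy X x Y p)"
  by (simp add: Fib_def)

lemma Cov_morphism_in_fibre:
  "\<lbrakk>f \<in> hm (Cov X) (Y, p) (Z, q); y \<in> fibre Y p b\<rbrakk> \<Longrightarrow> f y \<in> fibre Z q b"
  using continuous_map_image_subset_topspace by (fastforce simp: hm_Cov)

lemma monodromy_in_fibre:
  assumes p: "cover X Y p" and c: "c \<in> carrier (pi1 X x)" and y: "y \<in> fibre Y p x"
  shows "monodromy X x Y p c y \<in> fibre Y p x"
proof -
  obtain \<gamma> where \<gamma>: "path_between X x x \<gamma>" "c = loop_class X x \<gamma>" using c by (auto simp: carrier_pi1)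
  then show ?thesis using monodromy_loop_class[OF p \<gamma>(1) y] transport_in_fibre[OF p \<gamma>(1) y] by simp
qed

lemma monodromy_morphism:
  assumes p: "cover X Y p" and q: "cover X Z q" and f: "f \<in> hm (Cov X) (Y, p) (Z, q)"
    and c: "c \<in> carrier (pi1 X x)" and y: "y \<in> fibre Y p x"
  shows "f (monodromy X x Y p c y) = monodromy X x Z q c (f y)"
proof -
  obtain \<gamma> where \<gamma>: "path_between X x x \<gamma>" "c = loop_class X x \<gamma>" using c by (auto simp: carrier_pi1)
  then show ?thesis
    using monodromy_loop_class[OF p \<gamma>(1) y] monodromy_loop_class[OF q \<gamma>(1) Cov_morphism_in_fibre[OF f y]]
      transport_morphism[OF p q _ _ \<gamma>(1) y, of f] f by (simp add: hm_Cov)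
qed

lemma is_functor_Fib:
  fixes X :: "'a topology"
  assumes x: "x \<in> topspace X"
  shows "is_functor (Cov X :: ('b topology \<times> ('b \<Rightarrow> 'a), 'b \<Rightarrow> 'b) cat) (GSet (pi1 X x)) (Fib X x)"
  unfolding is_functor_def
proof (intro conjI ballI is_category_Cov is_category_GSet)
  fix a :: "'b topology \<times> ('b \<Rightarrow> 'a)" assume "a \<in> ob (Cov X)"
  then show "fob (Fib X x) a \<in> ob (GSet (pi1 X x))"
  proof (cases a)
    case (Pair Y p)
    then have "group_action (pi1 X x) (fibre Y p x) (monodromy X x Y p)"
      using \<open>a \<in> ob (Cov X)\<close> by (simp add: ob_Cov group_action_monodromy[OF x])
    then show ?thesis by (simp add: Pair ob_GSet) (simp add: monodromy_def)
  qed
  show "far (Fib X x) a a (idt (Cov X) a) = idt (GSet (pi1 X x)) (fob (Fib X x) a)"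
    by (cases a) (auto simp: Fib_def Cov_def GSet_def)
next
  fix a b :: "'b topology \<times> ('b \<Rightarrow> 'a)" and f
  assume ob: "a \<in> ob (Cov X)" "b \<in> ob (Cov X)" and f: "f \<in> hm (Cov X) a b"
  obtain Y p Z q where ab: "a = (Y, p)" "b = (Z, q)" by (cases a, cases b) blast
  have p: "cover X Y p" and q: "cover X Z q" using ob by (simp_all add: ab ob_Cov)
  note f = f[unfolded ab]
  show "far (Fib X x) a b f \<in> hm (GSet (pi1 X x)) (fob (Fib X x) a) (fob (Fib X x) b)"
    using Cov_morphism_in_fibre[OF f, of _ x] monodromy_in_fibre[OF p, of _ x] monodromy_morphism[OF p q f, of _ x]
    by (simp add: ab hm_GSet) (auto simp: Fib_def)
next
  fix a b c :: "'b topology \<times> ('b \<Rightarrow> 'a)" and f g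
  assume f: "f \<in> hm (Cov X) a b"
  obtain Y p Z q W r where abc: "a = (Y, p)" "b = (Z, q)" "c = (W, r)" by (cases a, cases b, cases c) blast
  have "f y \<in> fibre Z q x" if "y \<in> fibre Y p x" for y
    by (rule Cov_morphism_in_fibre[OF f[unfolded abc] that])
  then show "far (Fib X x) a c (cmp (Cov X) a b c g f)
    = cmp (GSet (pi1 X x)) (fob (Fib X x) a) (fob (Fib X x) b) (fob (Fib X x) c) (far (Fib X x) b c g) (far (Fib X x) a b f)"
    by (auto simp: abc Fib_def Cov_def GSet_def compose_def fun_eq_iff)
qed

section \<open>Connectedness through transport\<close>

lemma path_connectedin_path_between:
  "\<lbrakk>path_connectedin X N; a \<in> N; b \<in> N\<rbrakk> \<Longrightarrow> \<exists>\<gamma>. path_between (subtopology X N) a b \<gamma>"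
  unfolding path_connectedin_def path_connected_space_def path_between_def
  by (simp add: Int_absorb1)

lemma locally_path_connected_imp_path_between:
  assumes conn: "connected_space X" and lpc: "locally_path_connected_space X"
    and a: "a \<in> topspace X" and b: "b \<in> topspace X"
  shows "\<exists>\<gamma>. path_between X a b \<gamma>"
proof (rule connected_space_locally_constant[OF conn a b])
  show "\<exists>\<gamma>. path_between X a a \<gamma>" using path_between_const[OF a] by blast
  fix k assume "k \<in> topspace X"
  then obtain W where W: "openin X W" "path_connectedin X W" "k \<in> W"
    using lpc[unfolded locally_path_connected_space, rule_format, of "topspace X" k] by auto
  have "(\<exists>\<gamma>. path_between X a j \<gamma>) \<longleftrightarrow> (\<exists>\<gamma>. path_between X a k \<gamma>)" if j: "j \<in> W" for j
  proof -
    obtain \<delta> where \<delta>: "path_between (subtopology X W) j k \<delta>"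
      using path_connectedin_path_between[OF W(2) j W(3)] ..
    note \<delta> = path_between_mono[OF \<delta>]
    show ?thesis
    proof
      assume "\<exists>\<gamma>. path_between X a j \<gamma>"
      then obtain \<gamma> where "path_between X a j \<gamma>" ..
      from path_between_concat[OF this \<delta>] show "\<exists>\<gamma>. path_between X a k \<gamma>" by blast
    next
      assume "\<exists>\<gamma>. path_between X a k \<gamma>"
      then obtain \<gamma> where "path_between X a k \<gamma>" ..
      from path_between_concat[OF this path_between_reverse[OF \<delta>]] show "\<exists>\<gamma>. path_between X a j \<gamma>" by blast
    qed
  qed
  then show "\<exists>W. openin X W \<and> k \<in> W \<and>
    (\<forall>j\<in>W. (\<exists>\<gamma>. path_between X a j \<gamma>) = (\<exists>\<gamma>. path_between X a k \<gamma>))"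
    using W(1,3) by (intro exI[of _ W] conjI ballI)
qed

text \<open>Being reached from \<open>y\<close> by transport is locally constant on Y: two points in
  the image of a section over a path-connected \<open>N\<close> differ by transport along a path in
  \<open>N\<close>. For points of one fibre the path obtained is a loop, which gives
  transitivity.\<close>

lemma connected_cover_transport:
  assumes p: "cover X Y p" and lpc: "locally_path_connected_space X" and Y: "connected_space Y"
    and y: "y \<in> topspace Y" and z: "z \<in> topspace Y"
  shows "\<exists>\<gamma>. path_between X (p y) (p z) \<gamma> \<and> transport Y p \<gamma> y = z"
proof (rule connected_space_locally_constant[OF Y y z])
  have "y \<in> fibre Y p (p y)" using y by simp
  then show "\<exists>\<gamma>. path_between X (p y) (p y) \<gamma> \<and> transport Y p \<gamma> y = y"
    using path_between_const[OF cover_in_topspace[OF p y]] transport_const[OF p] by meson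
  fix k assume k: "k \<in> topspace Y"
  obtain N s where N: "openin X N" "p k \<in> N" "N \<subseteq> topspace X" "path_connectedin X N"
    and s: "continuous_map (subtopology X N) Y s"
      "\<forall>b\<in>N. s b \<in> topspace Y \<and> p (s b) = b" "s (p k) = k" "openin Y (s ` N)"
    by (rule cover_local_section_path_connected[OF p lpc openin_topspace k openin_topspace cover_in_topspace[OF p k]])
  let ?R = "\<lambda>j. \<exists>\<gamma>. path_between X (p y) (p j) \<gamma> \<and> transport Y p \<gamma> y = j"
  have step: "?R j'" if R: "?R j" and j: "j \<in> s ` N" and j': "j' \<in> s ` N" for j j'
  proof -
    have pj: "p j \<in> N" "p j' \<in> N" "s (p j) = j" "s (p j') = j'" using j j' s(2) by auto
    obtain \<delta> where \<delta>: "path_between (subtopology X N) (p j) (p j') \<delta>"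
      using path_connectedin_path_between[OF N(4) pj(1,2)] by blast
    have "transport Y p \<delta> j = j'" using transport_section[OF p s(1) _ \<delta>] s(2) pj by simp
    moreover obtain \<gamma> where \<gamma>: "path_between X (p y) (p j) \<gamma>" "transport Y p \<gamma> y = j" using R by blast
    ultimately have "transport Y p (path_concat \<gamma> \<delta>) y = j'"
      using transport_concat[OF p \<gamma>(1) path_between_mono[OF \<delta>]] y by simp
    then show ?thesis using path_between_concat[OF \<gamma>(1) path_between_mono[OF \<delta>]] by blast
  qed
  have k_in: "k \<in> s ` N" using N(2) s(3) by force
  have "?R j = ?R k" if "j \<in> s ` N" for j by (rule iffI[OF step[OF _ that k_in] step[OF _ k_in that]])
  then show "\<exists>W. openin Y W \<and> k \<in> W \<and> (\<forall>j\<in>W. ?R j = ?R k)"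
    using s(4) k_in by (intro exI[of _ "s ` N"] conjI ballI)
qed

text \<open>For the converse, a lift of a path to x joins each point of Y to the fibre, and lifts of
  loops join the points of the fibre to one another, so Y is even path-connected.\<close>

lemma connected_cover_iff_transitive:
  assumes conn: "connected_space X" and lpc: "locally_path_connected_space X" and x: "x \<in> topspace X"
    and p: "cover X Y p"
  shows "connected_cover X Y p \<longleftrightarrow> transitive_gset (pi1 X x) (fibre Y p x, monodromy X x Y p)"
proof
  assume "connected_cover X Y p"
  then have Y: "connected_space Y" and ne: "topspace Y \<noteq> {}" by (simp_all add: connected_cover_def)
  obtain y where y: "y \<in> topspace Y" using ne by blast
  obtain \<gamma> where \<gamma>: "path_between X (p y) x \<gamma>"
    using locally_path_connected_imp_path_between[OF conn lpc cover_in_topspace[OF p y] x] by blast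
  have "transport Y p \<gamma> y \<in> fibre Y p x" by (rule transport_in_fibre[OF p \<gamma>]) (simp add: y)
  moreover have "\<exists>c\<in>carrier (pi1 X x). monodromy X x Y p c y = z"
    if y: "y \<in> fibre Y p x" and z: "z \<in> fibre Y p x" for y z
  proof -
    obtain \<gamma> where \<gamma>: "path_between X x x \<gamma>" "transport Y p \<gamma> y = z"
      using connected_cover_transport[OF p lpc Y, of y z] y z by auto
    then show ?thesis using monodromy_loop_class[OF p \<gamma>(1) y] loop_class_in_carrier[OF \<gamma>(1)] by auto
  qed
  ultimately show "transitive_gset (pi1 X x) (fibre Y p x, monodromy X x Y p)"
    using group_action_monodromy[OF x p]
    by (auto simp: transitive_gset_def transitive_action_def transitive_action_axioms_def)
next
  assume "transitive_gset (pi1 X x) (fibre Y p x, monodromy X x Y p)"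
  then have trans: "\<And>y z. \<lbrakk>y \<in> fibre Y p x; z \<in> fibre Y p x\<rbrakk> \<Longrightarrow>
      \<exists>c\<in>carrier (pi1 X x). monodromy X x Y p c y = z" and ne: "fibre Y p x \<noteq> {}"
    unfolding transitive_gset_def transitive_action_def transitive_action_axioms_def by blast+
  have to_fibre: "\<exists>z\<in>fibre Y p x. path_component_of Y y z" if y: "y \<in> topspace Y" for y
  proof -
    obtain \<gamma> where \<gamma>: "path_between X (p y) x \<gamma>"
      using locally_path_connected_imp_path_between[OF conn lpc cover_in_topspace[OF p y] x] by blast
    have yf: "y \<in> fibre Y p (p y)" using y by simp
    obtain \<beta> where "path_between Y y (transport Y p \<gamma> y) \<beta>" using transport_lift[OF p \<gamma> yf] by blast
    then have "path_component_of Y y (transport Y p \<gamma> y)"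
      by (auto simp: path_component_of_def path_between_def)
    then show ?thesis using transport_in_fibre[OF p \<gamma> yf] by blast
  qed
  have in_fibre: "path_component_of Y y z" if y: "y \<in> fibre Y p x" and z: "z \<in> fibre Y p x" for y z
  proof -
    obtain c where c: "c \<in> carrier (pi1 X x)" "monodromy X x Y p c y = z" using trans[OF y z] by blast
    then obtain \<gamma> where \<gamma>: "path_between X x x \<gamma>" "c = loop_class X x \<gamma>" by (auto simp: carrier_pi1)
    obtain \<beta> where "path_between Y y (transport Y p \<gamma> y) \<beta>" using transport_lift[OF p \<gamma>(1) y] by blast
    then show ?thesis using monodromy_loop_class[OF p \<gamma>(1) y] c \<gamma>(2)
      by (auto simp: path_component_of_def path_between_def)
  qed
  have "path_connected_space Y"
    unfolding path_connected_space_iff_path_component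
    by (meson to_fibre in_fibre path_component_of_sym path_component_of_trans)
  then show "connected_cover X Y p"
    using ne p path_connected_imp_connected_space[of Y] by (auto simp: connected_cover_def)
qed

section \<open>Faithfulness and fullness of the fibre functor\<close>

lemma Fib_faithful:
  assumes conn: "connected_space X" and lpc: "locally_path_connected_space X" and x: "x \<in> topspace X"
    and p: "cover X Y p" and q: "cover X Z q"
    and f: "f \<in> hm (Cov X) (Y, p) (Z, q)" and g: "g \<in> hm (Cov X) (Y, p) (Z, q)"
    and fg: "\<And>y. y \<in> fibre Y p x \<Longrightarrow> f y = g y"
  shows "f = g"
proof (rule extensionalityI)
  fix y assume y: "y \<in> topspace Y"
  obtain \<gamma> where \<gamma>: "path_between X x (p y) \<gamma>"
    using locally_path_connected_imp_path_between[OF conn lpc x cover_in_topspace[OF p y]] by blast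
  let ?z = "transport Y p (path_reverse \<gamma>) y"
  have yf: "y \<in> fibre Y p (p y)" using y by simp
  have z: "?z \<in> fibre Y p x" by (rule transport_in_fibre[OF p path_between_reverse[OF \<gamma>] yf])
  have y_eq: "transport Y p \<gamma> ?z = y" by (rule transport_reverse'[OF p \<gamma> yf])
  have "f (transport Y p \<gamma> ?z) = transport Z q \<gamma> (f ?z)" "g (transport Y p \<gamma> ?z) = transport Z q \<gamma> (g ?z)"
    using f g by (auto simp: hm_Cov intro!: transport_morphism[OF p q _ _ \<gamma> z])
  then show "f y = g y" using fg[OF z] by (simp add: y_eq)
qed (use f g in \<open>simp_all add: hm_Cov\<close>)

text \<open>Near \<open>y\<close> and near its image, the two covers have sections \<open>r\<close>
  and \<open>s\<close> over a common path-connected set \<open>M\<close>. Transport along paths in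
  \<open>M\<close> traces both of them, so compatibility with transport forces
  \<open>F (r b) = s b\<close>, and \<open>s\<close> takes its values in the given open set.\<close>

lemma continuous_map_over_if_transport:
  assumes lpc: "locally_path_connected_space X" and p: "cover X Y p" and q: "cover X Z q"
    and F: "\<And>y. y \<in> topspace Y \<Longrightarrow> F y \<in> fibre Z q (p y)"
    and tr: "\<And>y c \<delta>. \<lbrakk>y \<in> topspace Y; path_between X (p y) c \<delta>\<rbrakk>
      \<Longrightarrow> F (transport Y p \<delta> y) = transport Z q \<delta> (F y)"
  shows "continuous_map Y Z F"
  unfolding continuous_map_def
proof (intro conjI allI impI)
  show "F \<in> topspace Y \<rightarrow> topspace Z" using F by auto
  fix T assume T: "openin Z T"
  show "openin Y {y \<in> topspace Y. F y \<in> T}"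
  proof (subst openin_subopen, intro ballI)
    fix y assume "y \<in> {y \<in> topspace Y. F y \<in> T}"
    then have y: "y \<in> topspace Y" "F y \<in> T" by auto
    obtain N s where N: "openin X N" "q (F y) \<in> N" and s: "continuous_map (subtopology X N) Z s"
      "\<forall>b\<in>N. s b \<in> T \<and> q (s b) = b" "s (q (F y)) = F y" "openin Z (s ` N)"
      by (rule cover_local_section[OF q T y(2)])
    have qF: "q (F y) = p y" using F[OF y(1)] by simp
    obtain M r where M: "openin X M" "p y \<in> M" "M \<subseteq> N" "path_connectedin X M"
      and r: "continuous_map (subtopology X M) Y r"
        "\<forall>b\<in>M. r b \<in> topspace Y \<and> p (r b) = b" "r (p y) = y" "openin Y (r ` M)"
      by (rule cover_local_section_path_connected[OF p lpc openin_topspace y(1) N(1) N(2)[unfolded qF]])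
    have "F (r b) \<in> T" if b: "b \<in> M" for b
    proof -
      obtain \<delta> where \<delta>: "path_between (subtopology X M) (p y) b \<delta>"
        using path_connectedin_path_between[OF M(4,2) b] by blast
      have "path_between (subtopology X N) (p y) b \<delta>" using \<delta> M(3) by (auto simp: path_between_subtopology)
      from transport_section[OF q s(1) _ this] have "transport Z q \<delta> (F y) = s b"
        using s(2,3) qF by simp
      moreover have "transport Y p \<delta> y = r b"
        using transport_section[OF p r(1) _ \<delta>] r(2,3) by simp
      ultimately have "F (r b) = s b" using tr[OF y(1) path_between_mono[OF \<delta>]] by simp
      then show ?thesis using s(2) b M(3) by auto
    qed
    then have "r ` M \<subseteq> {y \<in> topspace Y. F y \<in> T}" using r(2) by auto
    moreover have "y \<in> r ` M" using M(2) r(3) by force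
    ultimately show "\<exists>S. openin Y S \<and> y \<in> S \<and> S \<subseteq> {y \<in> topspace Y. F y \<in> T}" using r(4) by blast
  qed
qed

lemma Fib_full:
  assumes conn: "connected_space X" and lpc: "locally_path_connected_space X" and x: "x \<in> topspace X"
    and p: "cover X Y p" and q: "cover X Z q"
    and h: "h \<in> equivariant (pi1 X x) (fibre Y p x, monodromy X x Y p) (fibre Z q x, monodromy X x Z q)"
  shows "\<exists>f\<in>hm (Cov X) (Y, p) (Z, q). \<forall>y\<in>fibre Y p x. f y = h y"
proof -
  have h_in: "h y \<in> fibre Z q x" if "y \<in> fibre Y p x" for y
    using h that by (auto simp: equivariant_def)
  have h_loop: "h (transport Y p \<gamma> y) = transport Z q \<gamma> (h y)"
    if \<gamma>: "path_between X x x \<gamma>" and y: "y \<in> fibre Y p x" for \<gamma> y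
    using h loop_class_in_carrier[OF \<gamma>] y
    by (auto simp: equivariant_def simp flip: monodromy_loop_class[OF p \<gamma> y] monodromy_loop_class[OF q \<gamma> h_in[OF y]])
  have "\<forall>b\<in>topspace X. \<exists>\<gamma>. path_between X x b \<gamma>"
    using locally_path_connected_imp_path_between[OF conn lpc x] by blast
  then obtain g where g: "\<And>b. b \<in> topspace X \<Longrightarrow> path_between X x b (g b)" by metis
  define F where "F = (\<lambda>y. transport Z q (g (p y)) (h (transport Y p (path_reverse (g (p y))) y)))"
  \<comment> \<open>Independence of the chosen paths: \<gamma> followed by the reverse of
    \<open>g b\<close> is a loop at x, and equivariance lets \<open>h\<close> pass through the
    transport along it.\<close>
  have F_transport: "F (transport Y p \<gamma> y) = transport Z q \<gamma> (h y)"
    if \<gamma>: "path_between X x b \<gamma>" and y: "y \<in> fibre Y p x" for \<gamma> y b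
  proof -
    have b: "b \<in> topspace X" using path_between_imp_topspace[OF \<gamma>] by blast
    let ?r = "path_reverse (g b)" and ?l = "path_concat \<gamma> (path_reverse (g b))"
    have r: "path_between X b x ?r" by (rule path_between_reverse[OF g[OF b]])
    have l: "path_between X x x ?l" by (rule path_between_concat[OF \<gamma> r])
    have "p (transport Y p \<gamma> y) = b" using transport_in_fibre[OF p \<gamma> y] by simp
    then have "F (transport Y p \<gamma> y) = transport Z q (g b) (h (transport Y p ?l y))"
      by (simp add: F_def transport_concat[OF p \<gamma> r y])
    also have "\<dots> = transport Z q (g b) (transport Z q ?r (transport Z q \<gamma> (h y)))"
      by (simp add: h_loop[OF l y] transport_concat[OF q \<gamma> r h_in[OF y]])
    also have "\<dots> = transport Z q \<gamma> (h y)"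
      by (rule transport_reverse'[OF q g[OF b] transport_in_fibre[OF q \<gamma> h_in[OF y]]])
    finally show ?thesis .
  qed
  have reach: "\<exists>\<gamma> z. path_between X x (p y) \<gamma> \<and> z \<in> fibre Y p x \<and> y = transport Y p \<gamma> z"
    if y: "y \<in> topspace Y" for y
  proof -
    have yf: "y \<in> fibre Y p (p y)" using y by simp
    note gy = g[OF cover_in_topspace[OF p y]]
    show ?thesis
      by (intro exI conjI, rule gy, rule transport_in_fibre[OF p path_between_reverse[OF gy] yf],
          rule transport_reverse'[OF p gy yf, symmetric])
  qed
  have F_in: "F y \<in> fibre Z q (p y)" if y: "y \<in> topspace Y" for y
  proof -
    obtain \<gamma> z where \<gamma>: "path_between X x (p y) \<gamma>" and z: "z \<in> fibre Y p x" and y_eq: "y = transport Y p \<gamma> z"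
      using reach[OF y] by blast
    then show ?thesis using F_transport[OF \<gamma> z] transport_in_fibre[OF q \<gamma> h_in[OF z]] by simp
  qed
  have F_tr: "F (transport Y p \<delta> y) = transport Z q \<delta> (F y)"
    if y: "y \<in> topspace Y" and \<delta>: "path_between X (p y) c \<delta>" for y c \<delta>
  proof -
    obtain \<gamma> z where \<gamma>: "path_between X x (p y) \<gamma>" and z: "z \<in> fibre Y p x" and y_eq: "y = transport Y p \<gamma> z"
      using reach[OF y] by blast
    have "transport Y p \<delta> y = transport Y p (path_concat \<gamma> \<delta>) z"
      unfolding transport_concat[OF p \<gamma> \<delta> z] by (simp flip: y_eq)
    moreover have "F (transport Y p (path_concat \<gamma> \<delta>) z) = transport Z q \<delta> (transport Z q \<gamma> (h z))"
      by (simp add: F_transport[OF path_between_concat[OF \<gamma> \<delta>] z] transport_concat[OF q \<gamma> \<delta> h_in[OF z]])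
    moreover have "F y = transport Z q \<gamma> (h z)" using F_transport[OF \<gamma> z] y_eq by simp
    ultimately show ?thesis by simp
  qed
  have "continuous_map Y Z F"
    by (rule continuous_map_over_if_transport[OF lpc p q F_in F_tr])
  then have "continuous_map Y Z (restrict F (topspace Y))" by (rule continuous_map_eq) simp
  \<comment> \<open>Applied to the constant path at x, \<open>F_transport\<close> says that
    \<open>F\<close> extends \<open>h\<close>.\<close>
  moreover have "F y = h y" if y: "y \<in> fibre Y p x" for y
    using F_transport[OF path_between_const[OF x] y] transport_const[OF p y] transport_const[OF q h_in[OF y]] by simp
  ultimately show ?thesis
    using F_in by (intro bexI[of _ "restrict F (topspace Y)"]) (auto simp: hm_Cov)
qed

section \<open>The cover attached to a set with an action\<close>

text \<open>Insert the reverse of \<delta> followed by \<delta> after \<gamma>; the first two of the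
  three paths form the loop that contracts.\<close>

lemma path_homotopic_if_loop_trivial:
  assumes \<gamma>: "path_between X a b \<gamma>" and \<delta>: "path_between X a b \<delta>"
    and hom: "path_homotopic X a a (path_concat \<gamma> (path_reverse \<delta>)) (\<lambda>t. a)"
  shows "path_homotopic X a b \<gamma> \<delta>"
proof -
  note r = path_between_reverse[OF \<delta>]
  have "path_homotopic X a b \<gamma> (path_concat \<gamma> (\<lambda>t. b))"
    by (rule path_homotopic_sym[OF path_homotopic_const_right[OF \<gamma>]])
  also have "path_homotopic X a b \<dots> (path_concat \<gamma> (path_concat (path_reverse \<delta>) \<delta>))"
    by (rule path_homotopic_concat[OF path_homotopic_refl[OF \<gamma>] path_homotopic_sym[OF path_homotopic_reverse_left[OF \<delta>]]])
  also have "path_homotopic X a b \<dots> (path_concat (path_concat \<gamma> (path_reverse \<delta>)) \<delta>)"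
    by (rule path_homotopic_sym[OF path_homotopic_assoc[OF \<gamma> r \<delta>]])
  also have "path_homotopic X a b \<dots> (path_concat (\<lambda>t. a) \<delta>)"
    by (rule path_homotopic_concat[OF hom path_homotopic_refl[OF \<delta>]])
  also have "path_homotopic X a b \<dots> \<delta>" by (rule path_homotopic_const_left[OF \<delta>])
  finally show ?thesis .
qed

lemma path_homotopic_cancel_left:
  assumes \<epsilon>: "path_between X a b \<epsilon>" and \<gamma>: "path_between X b c \<gamma>" and \<delta>: "path_between X b c \<delta>"
    and hom: "path_homotopic X a c (path_concat \<epsilon> \<gamma>) (path_concat \<epsilon> \<delta>)"
  shows "path_homotopic X b c \<gamma> \<delta>"
proof -
  note r = path_between_reverse[OF \<epsilon>]
  have cancel: "path_homotopic X b c (path_concat (path_reverse \<epsilon>) (path_concat \<epsilon> \<zeta>)) \<zeta>"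
    if \<zeta>: "path_between X b c \<zeta>" for \<zeta>
  proof -
    have "path_homotopic X b c (path_concat (path_reverse \<epsilon>) (path_concat \<epsilon> \<zeta>))
        (path_concat (path_concat (path_reverse \<epsilon>) \<epsilon>) \<zeta>)"
      by (rule path_homotopic_sym[OF path_homotopic_assoc[OF r \<epsilon> \<zeta>]])
    also have "path_homotopic X b c \<dots> (path_concat (\<lambda>t. b) \<zeta>)"
      by (rule path_homotopic_concat[OF path_homotopic_reverse_left[OF \<epsilon>] path_homotopic_refl[OF \<zeta>]])
    also have "path_homotopic X b c \<dots> \<zeta>" by (rule path_homotopic_const_left[OF \<zeta>])
    finally show ?thesis .
  qed
  have "path_homotopic X b c \<gamma> (path_concat (path_reverse \<epsilon>) (path_concat \<epsilon> \<gamma>))"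
    by (rule path_homotopic_sym[OF cancel[OF \<gamma>]])
  also have "path_homotopic X b c \<dots> (path_concat (path_reverse \<epsilon>) (path_concat \<epsilon> \<delta>))"
    by (rule path_homotopic_concat[OF path_homotopic_refl[OF r] hom])
  also have "path_homotopic X b c \<dots> \<delta>" by (rule cancel[OF \<delta>])
  finally show ?thesis .
qed

text \<open>The hypothesis on X concerns loops based at the one point \<open>b\<close>. Inside a
  path-connected U, prefixing a path from \<open>b\<close> to \<open>c\<close> extends it to all
  pairs of paths with common ends; the prefix is cancelled afterwards. The homotopies may leave
  U.\<close>

lemma semilocally_simply_connected_neighbourhood:
  assumes lpc: "locally_path_connected_space X" and slsc: "semilocally_simply_connected_space X"
    and b: "b \<in> topspace X"
  obtains U where "openin X U" "b \<in> U" "path_connectedin X U"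
    "\<forall>c d \<gamma> \<delta>. path_between (subtopology X U) c d \<gamma> \<longrightarrow> path_between (subtopology X U) c d \<delta>
       \<longrightarrow> path_homotopic X c d \<gamma> \<delta>"
proof -
  obtain U\<^sub>0 where U\<^sub>0: "openin X U\<^sub>0" "b \<in> U\<^sub>0"
    "\<forall>\<gamma>. loopin (subtopology X U\<^sub>0) b \<gamma> \<longrightarrow> loop_homotopic X b \<gamma> (\<lambda>t. b)"
    using slsc b unfolding semilocally_simply_connected_space_def by blast
  obtain U where U: "openin X U" "path_connectedin X U" "b \<in> U" "U \<subseteq> U\<^sub>0"
    using lpc[unfolded locally_path_connected_space, rule_format, of U\<^sub>0 b] U\<^sub>0 by blast
  have from_b: "path_homotopic X b c \<gamma> \<delta>"
    if \<gamma>: "path_between (subtopology X U) b c \<gamma>" and \<delta>: "path_between (subtopology X U) b c \<delta>" for c \<gamma> \<delta>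
  proof -
    have "path_between (subtopology X U) b b (path_concat \<gamma> (path_reverse \<delta>))"
      by (rule path_between_concat[OF \<gamma> path_between_reverse[OF \<delta>]])
    then have "loopin (subtopology X U\<^sub>0) b (path_concat \<gamma> (path_reverse \<delta>))"
      using U(4) by (auto simp: loopin_iff_path_between path_between_subtopology)
    then show ?thesis
      using U\<^sub>0(3) path_homotopic_if_loop_trivial[OF path_between_mono[OF \<gamma>] path_between_mono[OF \<delta>]]
      by (simp add: loop_homotopic_eq)
  qed
  have "path_homotopic X c d \<gamma> \<delta>"
    if \<gamma>: "path_between (subtopology X U) c d \<gamma>" and \<delta>: "path_between (subtopology X U) c d \<delta>" for c d \<gamma> \<delta>
  proof -
    have "c \<in> U" using path_between_imp_topspace(1)[OF \<gamma>] by simp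
    then obtain \<epsilon> where \<epsilon>: "path_between (subtopology X U) b c \<epsilon>"
      using path_connectedin_path_between[OF U(2,3)] by blast
    show ?thesis
      by (rule path_homotopic_cancel_left[OF path_between_mono[OF \<epsilon>] path_between_mono[OF \<gamma>] path_between_mono[OF \<delta>]
            from_b[OF path_between_concat[OF \<epsilon> \<gamma>] path_between_concat[OF \<epsilon> \<delta>]]])
  qed
  then show ?thesis using that[of U] U(1-3) by blast
qed

text \<open>The cover attached to \<open>E\<close> is \<open>X \<times> E\<close>, retopologised: a point \<open>(b, e)\<close> stands for the point
  reached from \<open>e\<close> along the chosen path \<open>g b\<close> from \<open>x\<close> to \<open>b\<close>, so that moving along a path \<open>\<delta>\<close> from
  \<open>b\<close> to \<open>c\<close> acts on \<open>E\<close> through the class of the loop \<open>g b \<cdot> \<delta> \<cdot> (g c)\<^sup>-\<^sup>1\<close>. The injection \<open>j\<close>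
  moves the points into a prescribed type.\<close>

locale twisted_product =
  fixes X :: "'a topology" and x :: 'a and E :: "'e set" and \<phi> :: "(real \<Rightarrow> 'a) set \<Rightarrow> 'e \<Rightarrow> 'e"
    and g :: "'a \<Rightarrow> real \<Rightarrow> 'a" and j :: "'a \<times> 'e \<Rightarrow> 'u"
  assumes lpc: "locally_path_connected_space X" and slsc: "semilocally_simply_connected_space X"
    and x: "x \<in> topspace X" and action: "group_action (pi1 X x) E \<phi>"
    and g: "b \<in> topspace X \<Longrightarrow> path_between X x b (g b)" and g_x: "g x = (\<lambda>t. x)"
    and j: "inj_on j (topspace X \<times> E)"
begin

section \<open>Shifting labels along paths\<close>

definition shift :: "'a \<Rightarrow> 'a \<Rightarrow> (real \<Rightarrow> 'a) \<Rightarrow> 'e \<Rightarrow> 'e" where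
  "shift b c \<delta> = \<phi> (loop_class X x (path_concat (path_concat (g b) \<delta>) (path_reverse (g c))))"

lemma loop_of_path:
  assumes "path_between X b c \<delta>"
  shows "path_between X x x (path_concat (path_concat (g b) \<delta>) (path_reverse (g c)))"
  using path_between_imp_topspace[OF assms] g assms by (blast intro: path_between_concat path_between_reverse)

lemma shift_in: "\<lbrakk>path_between X b c \<delta>; e \<in> E\<rbrakk> \<Longrightarrow> shift b c \<delta> e \<in> E"
  using group_action.element_image[OF action loop_class_in_carrier[OF loop_of_path]] by (auto simp: shift_def)

lemma shift_homotopic:
  assumes "path_homotopic X b c \<delta> \<delta>'"
  shows "shift b c \<delta> = shift b c \<delta>'"
proof -
  note top = path_between_imp_topspace[OF path_homotopic_imp_path_between(1)[OF assms]]
  have "path_homotopic X x x (path_concat (path_concat (g b) \<delta>) (path_reverse (g c)))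
      (path_concat (path_concat (g b) \<delta>') (path_reverse (g c)))"
    by (rule path_homotopic_concat[OF path_homotopic_concat[OF path_homotopic_refl[OF g[OF top(1)]] assms]
          path_homotopic_refl[OF path_between_reverse[OF g[OF top(2)]]]])
  then show ?thesis by (simp add: shift_def loop_class_eq)
qed

text \<open>The return along \<open>g c\<close> cancels against the new departure along
  \<open>g c\<close>. Since the product in \<open>pi1\<close> puts the later loop on the left, a
  left action composes the shifts in the order in which the paths are run through.\<close>

lemma shift_concat:
  assumes \<delta>: "path_between X b c \<delta>" and \<epsilon>: "path_between X c d \<epsilon>" and e: "e \<in> E"
  shows "shift b d (path_concat \<delta> \<epsilon>) e = shift c d \<epsilon> (shift b c \<delta> e)"
proof -
  note top = path_between_imp_topspace[OF \<delta>] path_between_imp_topspace[OF \<epsilon>]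
  note gb = g[OF top(1)] and gc = g[OF top(2)] and gd = g[OF top(4)]
  note rc = path_between_reverse[OF gc] and rd = path_between_reverse[OF gd]
  let ?A = "path_concat (g b) \<delta>" and ?C = "path_concat (g c) \<epsilon>"
  let ?rc = "path_reverse (g c)" and ?rd = "path_reverse (g d)"
  note A = path_between_concat[OF gb \<delta>] and C = path_between_concat[OF gc \<epsilon>]
  have "path_homotopic X c d (path_concat ?rc ?C) (path_concat (path_concat ?rc (g c)) \<epsilon>)"
    by (rule path_homotopic_sym[OF path_homotopic_assoc[OF rc gc \<epsilon>]])
  also have "path_homotopic X c d \<dots> (path_concat (\<lambda>t. c) \<epsilon>)"
    by (rule path_homotopic_concat[OF path_homotopic_reverse_left[OF gc] path_homotopic_refl[OF \<epsilon>]])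
  also have "path_homotopic X c d \<dots> \<epsilon>" by (rule path_homotopic_const_left[OF \<epsilon>])
  finally have cancel: "path_homotopic X c d (path_concat ?rc ?C) \<epsilon>" .
  have "path_homotopic X x x (path_concat (path_concat ?A ?rc) (path_concat ?C ?rd))
      (path_concat ?A (path_concat ?rc (path_concat ?C ?rd)))"
    by (rule path_homotopic_assoc[OF A rc path_between_concat[OF C rd]])
  also have "path_homotopic X x x \<dots> (path_concat ?A (path_concat (path_concat ?rc ?C) ?rd))"
    by (rule path_homotopic_concat[OF path_homotopic_refl[OF A] path_homotopic_sym[OF path_homotopic_assoc[OF rc C rd]]])
  also have "path_homotopic X x x \<dots> (path_concat ?A (path_concat \<epsilon> ?rd))"
    by (rule path_homotopic_concat[OF path_homotopic_refl[OF A]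
          path_homotopic_concat[OF cancel path_homotopic_refl[OF rd]]])
  also have "path_homotopic X x x \<dots> (path_concat (path_concat ?A \<epsilon>) ?rd)"
    by (rule path_homotopic_sym[OF path_homotopic_assoc[OF A \<epsilon> rd]])
  also have "path_homotopic X x x \<dots> (path_concat (path_concat (g b) (path_concat \<delta> \<epsilon>)) ?rd)"
    by (rule path_homotopic_concat[OF path_homotopic_assoc[OF gb \<delta> \<epsilon>] path_homotopic_refl[OF rd]])
  finally have "loop_class X x (path_concat (path_concat (g b) (path_concat \<delta> \<epsilon>)) ?rd)
      = loop_class X x (path_concat ?C ?rd) \<otimes>\<^bsub>pi1 X x\<^esub> loop_class X x (path_concat ?A ?rc)"
    unfolding mult_pi1[OF loop_of_path[OF \<delta>] loop_of_path[OF \<epsilon>]] by (rule loop_class_eq[symmetric])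
  then show ?thesis
    using group_action.composition_rule[OF action e loop_class_in_carrier[OF loop_of_path[OF \<epsilon>]]
        loop_class_in_carrier[OF loop_of_path[OF \<delta>]]] by (simp add: shift_def)
qed

lemma shift_const:
  assumes b: "b \<in> topspace X" and e: "e \<in> E"
  shows "shift b b (\<lambda>t. b) e = e"
proof -
  note r = path_between_reverse[OF g[OF b]]
  have "path_homotopic X x x (path_concat (path_concat (g b) (\<lambda>t. b)) (path_reverse (g b)))
      (path_concat (g b) (path_reverse (g b)))"
    by (rule path_homotopic_concat[OF path_homotopic_const_right[OF g[OF b]] path_homotopic_refl[OF r]])
  also have "path_homotopic X x x \<dots> (\<lambda>t. x)" by (rule path_homotopic_reverse_right[OF g[OF b]])
  finally have "shift b b (\<lambda>t. b) e = \<phi> \<one>\<^bsub>pi1 X x\<^esub> e" by (simp add: shift_def loop_class_eq one_pi1)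
  then show ?thesis using group_action.id_eq_one[OF action] e by (metis restrict_apply')
qed

text \<open>Because \<open>g x\<close> is constant, loops at x act by the given action itself and
  not by a conjugate of it.\<close>

lemma shift_loop:
  assumes \<gamma>: "path_between X x x \<gamma>"
  shows "shift x x \<gamma> = \<phi> (loop_class X x \<gamma>)"
proof -
  have "path_homotopic X x x (path_concat (path_concat (\<lambda>t. x) \<gamma>) (\<lambda>t. x)) (path_concat (\<lambda>t. x) \<gamma>)"
    by (rule path_homotopic_const_right[OF path_between_concat[OF path_between_const[OF x] \<gamma>]])
  also have "path_homotopic X x x \<dots> \<gamma>" by (rule path_homotopic_const_left[OF \<gamma>])
  finally show ?thesis by (simp add: shift_def g_x path_reverse_def loop_class_eq)
qed

lemma shift_reverse:
  assumes \<delta>: "path_between X b c \<delta>" and e: "e \<in> E"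
  shows "shift c b (path_reverse \<delta>) (shift b c \<delta> e) = e"
  using shift_concat[OF \<delta> path_between_reverse[OF \<delta>] e] shift_homotopic[OF path_homotopic_reverse_right[OF \<delta>]]
    shift_const[OF path_between_imp_topspace(1)[OF \<delta>] e] by simp

section \<open>Topology and sheets of the twisted product\<close>

text \<open>Openness is stated through the paths leaving each point instead of through a basis of
  sheets. The topology thus refers to no choice of good neighbourhoods; these come in only when even
  covering is shown.\<close>

definition total_space :: "'u topology" where
  "total_space = topology (\<lambda>W. W \<subseteq> j ` (topspace X \<times> E) \<and>
     (\<forall>b\<in>topspace X. \<forall>e\<in>E. j (b, e) \<in> W \<longrightarrow>
       (\<exists>U. openin X U \<and> b \<in> U \<and>
         (\<forall>c \<delta>. path_between (subtopology X U) b c \<delta> \<longrightarrow> j (c, shift b c \<delta> e) \<in> W))))"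

definition proj :: "'u \<Rightarrow> 'a" where
  "proj = (\<lambda>y\<in>j ` (topspace X \<times> E). fst (inv_into (topspace X \<times> E) j y))"

lemma openin_total:
  "openin total_space W \<longleftrightarrow> W \<subseteq> j ` (topspace X \<times> E) \<and>
     (\<forall>b\<in>topspace X. \<forall>e\<in>E. j (b, e) \<in> W \<longrightarrow>
       (\<exists>U. openin X U \<and> b \<in> U \<and>
         (\<forall>c \<delta>. path_between (subtopology X U) b c \<delta> \<longrightarrow> j (c, shift b c \<delta> e) \<in> W)))"
proof -
  let ?P = "\<lambda>W b e U. openin X U \<and> b \<in> U \<and>
         (\<forall>c \<delta>. path_between (subtopology X U) b c \<delta> \<longrightarrow> j (c, shift b c \<delta> e) \<in> W)"
  have "istopology (\<lambda>W. W \<subseteq> j ` (topspace X \<times> E) \<and>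
     (\<forall>b\<in>topspace X. \<forall>e\<in>E. j (b, e) \<in> W \<longrightarrow> (\<exists>U. ?P W b e U)))"
    unfolding istopology_def
  proof (intro conjI allI impI ballI)
    fix S T b e
    assume S: "S \<subseteq> j ` (topspace X \<times> E) \<and> (\<forall>b\<in>topspace X. \<forall>e\<in>E. j (b, e) \<in> S \<longrightarrow> (\<exists>U. ?P S b e U))"
      and T: "T \<subseteq> j ` (topspace X \<times> E) \<and> (\<forall>b\<in>topspace X. \<forall>e\<in>E. j (b, e) \<in> T \<longrightarrow> (\<exists>U. ?P T b e U))"
    show "S \<inter> T \<subseteq> j ` (topspace X \<times> E)" using S by blast
    assume be: "b \<in> topspace X" "e \<in> E" "j (b, e) \<in> S \<inter> T"
    obtain U where U: "?P S b e U" using S be by blast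
    obtain U' where U': "?P T b e U'" using T be by blast
    have "?P (S \<inter> T) b e (U \<inter> U')" using U U' by (auto simp: path_between_subtopology)
    then show "\<exists>U. ?P (S \<inter> T) b e U" by blast
  next
    fix K
    assume K: "\<forall>S\<in>K. S \<subseteq> j ` (topspace X \<times> E) \<and>
      (\<forall>b\<in>topspace X. \<forall>e\<in>E. j (b, e) \<in> S \<longrightarrow> (\<exists>U. ?P S b e U))"
    then show "\<Union>K \<subseteq> j ` (topspace X \<times> E)" by blast
    fix b e assume be: "b \<in> topspace X" "e \<in> E" "j (b, e) \<in> \<Union>K"
    then obtain S where S: "S \<in> K" "j (b, e) \<in> S" by blast
    then obtain U where "?P S b e U" using K be by meson
    then have "?P (\<Union>K) b e U" using S(1) by blast
    then show "\<exists>U. ?P (\<Union>K) b e U" by blast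
  qed
  then show ?thesis by (simp add: total_space_def topology_inverse')
qed

lemma topspace_total [simp]: "topspace total_space = j ` (topspace X \<times> E)"
proof
  show "topspace total_space \<subseteq> j ` (topspace X \<times> E)"
    using openin_total[THEN iffD1, OF openin_topspace] ..
  have "openin total_space (j ` (topspace X \<times> E))"
    unfolding openin_total
  proof (intro conjI ballI impI subset_refl)
    fix b e assume "b \<in> topspace X" "e \<in> E"
    then show "\<exists>U. openin X U \<and> b \<in> U \<and>
      (\<forall>c \<delta>. path_between (subtopology X U) b c \<delta> \<longrightarrow> j (c, shift b c \<delta> e) \<in> j ` (topspace X \<times> E))"
      by (intro exI[of _ "topspace X"]) (auto intro: shift_in dest: path_between_imp_topspace(2))
  qed
  then show "j ` (topspace X \<times> E) \<subseteq> topspace total_space" by (rule openin_subset)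
qed

lemma proj_j [simp]: "\<lbrakk>b \<in> topspace X; e \<in> E\<rbrakk> \<Longrightarrow> proj (j (b, e)) = b"
  by (simp add: proj_def inv_into_f_f[OF j])

lemma fibre_total: "b \<in> topspace X \<Longrightarrow> fibre total_space proj b = (\<lambda>e. j (b, e)) ` E"
  by auto

lemma j_eq_iff:
  "\<lbrakk>b \<in> topspace X; e \<in> E; b' \<in> topspace X; e' \<in> E\<rbrakk> \<Longrightarrow> j (b, e) = j (b', e') \<longleftrightarrow> b = b' \<and> e = e'"
  using inj_on_eq_iff[OF j, of "(b, e)" "(b', e')"] by simp

lemma path_between_subtopology_in:
  "path_between (subtopology X U) b c \<delta> \<Longrightarrow> b \<in> topspace X \<and> b \<in> U \<and> c \<in> topspace X \<and> c \<in> U"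
  using path_between_imp_topspace[of "subtopology X U"] by simp

lemma continuous_map_proj: "continuous_map total_space X proj"
  unfolding continuous_map_def
proof (intro conjI allI impI)
  show "proj \<in> topspace total_space \<rightarrow> topspace X" by auto
  fix U assume U: "openin X U"
  show "openin total_space {y \<in> topspace total_space. proj y \<in> U}"
    unfolding openin_total
  proof (intro conjI ballI impI)
    fix b e assume b: "b \<in> topspace X" and e: "e \<in> E" and "j (b, e) \<in> {y \<in> topspace total_space. proj y \<in> U}"
    then have "b \<in> U" by simp
    have "j (c, shift b c \<delta> e) \<in> {y \<in> topspace total_space. proj y \<in> U}"
      if \<delta>: "path_between (subtopology X U) b c \<delta>" for c \<delta>
    proof -
      have "c \<in> topspace X" "c \<in> U" using path_between_subtopology_in[OF \<delta>] by blast+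
      moreover have "shift b c \<delta> e \<in> E" by (rule shift_in[OF path_between_mono[OF \<delta>] e])
      ultimately show ?thesis by simp
    qed
    then show "\<exists>U'. openin X U' \<and> b \<in> U' \<and> (\<forall>c \<delta>. path_between (subtopology X U') b c \<delta> \<longrightarrow>
        j (c, shift b c \<delta> e) \<in> {y \<in> topspace total_space. proj y \<in> U})"
      using U \<open>b \<in> U\<close> by blast
  qed simp
qed

text \<open>Every point of a path-connected neighbourhood of \<open>b\<close> is the end of a path
  from \<open>b\<close> in it, and shifting along this path gives a point of \<open>W\<close> above
  it.\<close>

lemma open_map_proj: "open_map total_space X proj"
  unfolding open_map_def
proof (intro allI impI)
  fix W assume W: "openin total_space W"
  show "openin X (proj ` W)"
  proof (subst openin_subopen, intro ballI)
    fix b assume "b \<in> proj ` W"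
    then obtain y where y: "y \<in> W" "b = proj y" by blast
    obtain e where e: "b \<in> topspace X" "e \<in> E" "j (b, e) \<in> W"
      using y openin_subset[OF W] by auto
    then obtain U where U: "openin X U" "b \<in> U"
      "\<forall>c \<delta>. path_between (subtopology X U) b c \<delta> \<longrightarrow> j (c, shift b c \<delta> e) \<in> W"
      using W[unfolded openin_total] by blast
    obtain U' where U': "openin X U'" "path_connectedin X U'" "b \<in> U'" "U' \<subseteq> U"
      using lpc[unfolded locally_path_connected_space, rule_format, of U b] U by blast
    have "c \<in> proj ` W" if c: "c \<in> U'" for c
    proof -
      obtain \<delta> where \<delta>: "path_between (subtopology X U') b c \<delta>"
        using path_connectedin_path_between[OF U'(2,3) c] by blast
      then have "path_between (subtopology X U) b c \<delta>" using U'(4) by (auto simp: path_between_subtopology)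
      then have "j (c, shift b c \<delta> e) \<in> W" using U(3) by blast
      moreover have "proj (j (c, shift b c \<delta> e)) = c"
        using path_between_imp_topspace(2)[OF path_between_mono[OF \<delta>]] shift_in[OF path_between_mono[OF \<delta>] e(2)] by simp
      ultimately show ?thesis by force
    qed
    then show "\<exists>T. openin X T \<and> b \<in> T \<and> T \<subseteq> proj ` W" using U'(1,3) by blast
  qed
qed

lemma cover_total: "cover X total_space proj"
  unfolding cover_def
proof (intro conjI continuous_map_proj ballI)
  fix b assume b: "b \<in> topspace X"
  obtain U where U: "openin X U" "b \<in> U" "path_connectedin X U"
    and simple: "\<forall>c d \<gamma> \<delta>. path_between (subtopology X U) c d \<gamma> \<longrightarrow> path_between (subtopology X U) c d \<delta>
       \<longrightarrow> path_homotopic X c d \<gamma> \<delta>"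
    by (rule semilocally_simply_connected_neighbourhood[OF lpc slsc b])
  \<comment> \<open>The sheet through \<open>j (b, e)\<close> consists of everything reached from it
    along paths inside U. Sheets are indexed by points of the fibre, so \<open>e\<close> is
    recovered from \<open>y\<close>; \<open>V_iff\<close> removes this detour.\<close>
  define V where "V = (\<lambda>y. {j (c, shift b c \<delta> e) |c \<delta> e. e \<in> E \<and> y = j (b, e) \<and> path_between (subtopology X U) b c \<delta>})"
  have V_iff: "y \<in> V (j (b, e)) \<longleftrightarrow> (\<exists>c \<delta>. y = j (c, shift b c \<delta> e) \<and> path_between (subtopology X U) b c \<delta>)"
    if "e \<in> E" for y e
  proof -
    have "j (b, e) = j (b, e') \<longleftrightarrow> e = e'" if "e' \<in> E" for e' using that \<open>e \<in> E\<close> b by (simp add: j_eq_iff)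
    then show ?thesis using that unfolding V_def by blast
  qed
  \<comment> \<open>Here semi-local simple connectedness enters: over U the shift depends only on
    the end \<open>c\<close>, so a sheet has at most one point above each \<open>c\<close>.\<close>
  have shift_eq: "shift b c \<gamma> = shift b c \<delta>"
    if "path_between (subtopology X U) b c \<gamma>" "path_between (subtopology X U) b c \<delta>" for c \<gamma> \<delta>
    using simple that shift_homotopic by blast
  have V_sub: "V (j (b, e)) \<subseteq> j ` (topspace X \<times> E)" if e: "e \<in> E" for e
  proof
    fix y assume "y \<in> V (j (b, e))"
    then obtain c \<delta> where "y = j (c, shift b c \<delta> e)" and \<delta>: "path_between (subtopology X U) b c \<delta>"
      using V_iff[OF e] by blast
    then show "y \<in> j ` (topspace X \<times> E)"
      using path_between_subtopology_in[OF \<delta>] shift_in[OF path_between_mono[OF \<delta>] e] by blast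
  qed
  have V_open: "openin total_space (V (j (b, e)))" if e: "e \<in> E" for e
    unfolding openin_total
  proof (intro conjI ballI impI V_sub[OF e])
    fix c e' assume c: "c \<in> topspace X" and e': "e' \<in> E" and "j (c, e') \<in> V (j (b, e))"
    then obtain c' \<delta> where "j (c, e') = j (c', shift b c' \<delta> e)" and \<delta>: "path_between (subtopology X U) b c' \<delta>"
      using V_iff[OF e] by blast
    moreover have "c' \<in> topspace X" "shift b c' \<delta> e \<in> E"
      using path_between_subtopology_in[OF \<delta>] shift_in[OF path_between_mono[OF \<delta>] e] by blast+
    ultimately have c': "c' = c" and e'_eq: "e' = shift b c \<delta> e" using c e' by (auto simp: j_eq_iff)
    note \<delta> = \<delta>[unfolded c']
    have "j (d, shift c d \<epsilon> e') \<in> V (j (b, e))" if \<epsilon>: "path_between (subtopology X U) c d \<epsilon>" for d \<epsilon>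
      using shift_concat[OF path_between_mono[OF \<delta>] path_between_mono[OF \<epsilon>] e] path_between_concat[OF \<delta> \<epsilon>]
      unfolding V_iff[OF e] e'_eq by metis
    moreover have "c \<in> U" using path_between_subtopology_in[OF \<delta>] by blast
    ultimately show "\<exists>U. openin X U \<and> c \<in> U \<and>
      (\<forall>d \<epsilon>. path_between (subtopology X U) c d \<epsilon> \<longrightarrow> j (d, shift c d \<epsilon> e') \<in> V (j (b, e)))"
      using U(1) by blast
  qed
  have "{y \<in> topspace total_space. proj y \<in> U} = (\<Union>y\<in>fibre total_space proj b. V y)"
  proof
    show "{y \<in> topspace total_space. proj y \<in> U} \<subseteq> (\<Union>y\<in>fibre total_space proj b. V y)"
    proof
      fix y assume "y \<in> {y \<in> topspace total_space. proj y \<in> U}"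
      then obtain c e where y: "y = j (c, e)" "c \<in> topspace X" "e \<in> E" "c \<in> U" by auto
      obtain \<delta> where \<delta>: "path_between (subtopology X U) b c \<delta>"
        using path_connectedin_path_between[OF U(3,2) y(4)] by blast
      note r = path_between_reverse[OF path_between_mono[OF \<delta>]]
      \<comment> \<open>The sheet containing \<open>j (c, e)\<close> is found by moving the label
        \<open>e\<close> back to \<open>b\<close> along the reverse of \<delta>.\<close>
      let ?e = "shift c b (path_reverse \<delta>) e"
      have e: "?e \<in> E" by (rule shift_in[OF r y(3)])
      moreover have "shift b c \<delta> ?e = e" using shift_reverse[OF r y(3)] by simp
      ultimately have "y \<in> V (j (b, ?e))" using \<delta> y(1) by (metis V_iff)
      then show "y \<in> (\<Union>y\<in>fibre total_space proj b. V y)" using e b fibre_total by blast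
    qed
    show "(\<Union>y\<in>fibre total_space proj b. V y) \<subseteq> {y \<in> topspace total_space. proj y \<in> U}"
    proof
      fix y assume "y \<in> (\<Union>y\<in>fibre total_space proj b. V y)"
      then obtain e c \<delta> where "e \<in> E" "y = j (c, shift b c \<delta> e)" "path_between (subtopology X U) b c \<delta>"
        unfolding fibre_total[OF b] by (auto simp: V_iff)
      then show "y \<in> {y \<in> topspace total_space. proj y \<in> U}"
        using path_between_subtopology_in shift_in[OF path_between_mono] by fastforce
    qed
  qed
  moreover have "disjoint_family_on V (fibre total_space proj b)"
    unfolding disjoint_family_on_def fibre_total[OF b]
  proof (intro ballI impI)
    fix y y' assume "y \<in> (\<lambda>e. j (b, e)) ` E" "y' \<in> (\<lambda>e. j (b, e)) ` E" and ne: "y \<noteq> y'"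
    then obtain e e' where e: "e \<in> E" "y = j (b, e)" and e': "e' \<in> E" "y' = j (b, e')" by blast
    show "V y \<inter> V y' = {}"
    proof (rule ccontr)
      assume "V y \<inter> V y' \<noteq> {}"
      then obtain c \<delta> c' \<delta>' where eq: "j (c, shift b c \<delta> e) = j (c', shift b c' \<delta>' e')"
        and \<delta>: "path_between (subtopology X U) b c \<delta>" and \<delta>': "path_between (subtopology X U) b c' \<delta>'"
        unfolding e(2) e'(2) ex_in_conv[symmetric] Int_iff V_iff[OF e(1)] V_iff[OF e'(1)] by metis
      have "c \<in> topspace X" "c' \<in> topspace X" "shift b c \<delta> e \<in> E" "shift b c' \<delta>' e' \<in> E"
        using path_between_subtopology_in[OF \<delta>] path_between_subtopology_in[OF \<delta>']
          shift_in[OF path_between_mono[OF \<delta>] e(1)] shift_in[OF path_between_mono[OF \<delta>'] e'(1)] by blast+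
      then have "c' = c" "shift b c \<delta> e = shift b c \<delta>' e'" using eq by (auto simp: j_eq_iff)
      then have "shift b c \<delta> e = shift b c \<delta> e'" using shift_eq \<delta> \<delta>' by metis
      \<comment> \<open>Shifting back along \<delta> shows that the shift is injective, so distinct
        labels stay distinct.\<close>
      then have "e = e'"
        using shift_reverse[OF path_between_mono[OF \<delta>] e(1)] shift_reverse[OF path_between_mono[OF \<delta>] e'(1)] by metis
      then show False using ne e e' by simp
    qed
  qed
  moreover have "openin total_space (V y) \<and> y \<in> V y \<and> homeomorphic_map (subtopology total_space (V y)) (subtopology X U) proj"
    if y: "y \<in> fibre total_space proj b" for y
  proof -
    obtain e where e: "e \<in> E" "y = j (b, e)" using y unfolding fibre_total[OF b] by blast
    have Vy: "openin total_space (V y)" using V_open e by simp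
    have "path_between (subtopology X U) b b (\<lambda>t. b)" using b U(2) by (intro path_between_const) simp
    then have "y \<in> V y" using shift_const[OF b e(1)] e by (metis V_iff)
    moreover have "homeomorphic_map (subtopology total_space (V y)) (subtopology X U) proj"
    proof (rule bijective_open_imp_homeomorphic_map)
      have tops: "topspace (subtopology total_space (V y)) = V y" "topspace (subtopology X U) = U"
        using topspace_subtopology_subset[OF openin_subset[OF Vy]] topspace_subtopology_subset[OF openin_subset[OF U(1)]]
        by simp_all
      have proj_V: "proj (j (c, shift b c \<delta> e)) = c" if "path_between (subtopology X U) b c \<delta>" for c \<delta>
        using path_between_subtopology_in[OF that] shift_in[OF path_between_mono[OF that] e(1)] by simp
      have img: "proj ` V y = U"
      proof
        show "proj ` V y \<subseteq> U" using proj_V path_between_subtopology_in by (auto simp: e(2) V_iff[OF e(1)])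
        show "U \<subseteq> proj ` V y"
        proof
          fix c assume c: "c \<in> U"
          obtain \<delta> where \<delta>: "path_between (subtopology X U) b c \<delta>"
            using path_connectedin_path_between[OF U(3,2) c] by blast
          then have "j (c, shift b c \<delta> e) \<in> V y" unfolding e(2) V_iff[OF e(1)] by blast
          then show "c \<in> proj ` V y" using proj_V[OF \<delta>] by force
        qed
      qed
      show "proj ` topspace (subtopology total_space (V y)) = topspace (subtopology X U)" using img tops by simp
      show "continuous_map (subtopology total_space (V y)) (subtopology X U) proj"
        using continuous_map_from_subtopology[OF continuous_map_proj] img tops
        by (auto simp: continuous_map_in_subtopology)
      show "open_map (subtopology total_space (V y)) (subtopology X U) proj"
        unfolding open_map_def openin_open_subtopology[OF Vy] openin_open_subtopology[OF U(1)]
        using open_map_proj img unfolding open_map_def by blast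
      show "inj_on proj (topspace (subtopology total_space (V y)))"
        unfolding tops
      proof (rule inj_onI)
        fix z z' assume "z \<in> V y" "z' \<in> V y" and eq: "proj z = proj z'"
        then obtain c \<delta> c' \<delta>' where z: "z = j (c, shift b c \<delta> e)" "path_between (subtopology X U) b c \<delta>"
          and z': "z' = j (c', shift b c' \<delta>' e)" "path_between (subtopology X U) b c' \<delta>'"
          unfolding e(2) V_iff[OF e(1)] by blast
        have "c = c'" using eq proj_V[OF z(2)] proj_V[OF z'(2)] z(1) z'(1) by simp
        then show "z = z'" using shift_eq z z' by metis
      qed
    qed
    ultimately show ?thesis using Vy by blast
  qed
  ultimately show "\<exists>U V. openin X U \<and> b \<in> U \<and>
        {y \<in> topspace total_space. proj y \<in> U} = (\<Union>y\<in>fibre total_space proj b. V y) \<and>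
        disjoint_family_on V (fibre total_space proj b) \<and>
        (\<forall>y\<in>fibre total_space proj b. openin total_space (V y) \<and> y \<in> V y \<and>
           homeomorphic_map (subtopology total_space (V y)) (subtopology X U) proj)"
    using U(1,2) by (intro exI[of _ U] exI[of _ V] conjI ballI) simp_all
qed

section \<open>Monodromy of the twisted product\<close>

text \<open>The lift is explicit: at time t, shift the label along the part of \<gamma> up to t. It
  is continuous because the change of label from u to a nearby t is the shift along a short segment,
  which is how open sets were defined.\<close>

lemma transport_total:
  assumes \<gamma>: "path_between X a b \<gamma>" and e: "e \<in> E"
  shows "transport total_space proj \<gamma> (j (a, e)) = j (b, shift a b \<gamma> e)"
proof -
  let ?I = "{0..1::real}"
  let ?s = "\<lambda>t. shift a (\<gamma> t) (path_segment \<gamma> 0 t) e"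
  define \<beta> where "\<beta> = (\<lambda>t. j (\<gamma> t, ?s t))"
  have pin: "pathin X \<gamma>" and ends: "\<gamma> 0 = a" "\<gamma> 1 = b" using \<gamma> by (simp_all add: path_between_def)
  have seg: "path_between X (\<gamma> u) (\<gamma> v) (path_segment \<gamma> u v)" if "u \<in> ?I" "v \<in> ?I" for u v
    by (rule path_between_segment[OF pin that])
  have seg0: "path_between X a (\<gamma> t) (path_segment \<gamma> 0 t)" if "t \<in> ?I" for t
    using seg[of 0 t] that ends by simp
  have s_in: "?s t \<in> E" if "t \<in> ?I" for t by (rule shift_in[OF seg0[OF that] e])
  \<comment> \<open>Rebases the shift from 0 to u, for t on either side of u.\<close>
  have step: "?s t = shift (\<gamma> u) (\<gamma> t) (path_segment \<gamma> u t) (?s u)" if "u \<in> ?I" "t \<in> ?I" for u t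
  proof -
    have "path_homotopic X a (\<gamma> t) (path_concat (path_segment \<gamma> 0 u) (path_segment \<gamma> u t)) (path_segment \<gamma> 0 t)"
      using path_homotopic_concat_segments[OF pin, of 0 u t] that ends by simp
    from shift_homotopic[OF this] show ?thesis
      using shift_concat[OF seg0[OF that(1)] seg[OF that] e] by simp
  qed
  have "pathin total_space \<beta>"
    unfolding pathin_def continuous_map_def
  proof (intro conjI allI impI)
    show "\<beta> \<in> topspace (top_of_set ?I) \<rightarrow> topspace total_space"
      using s_in path_between_in_topspace[OF \<gamma>] by (auto simp: \<beta>_def)
    fix W assume W: "openin total_space W"
    show "openin (top_of_set ?I) {t \<in> topspace (top_of_set ?I). \<beta> t \<in> W}"
      unfolding openin_euclidean_subtopology_iff
    proof (intro conjI ballI)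
      fix u assume "u \<in> {t \<in> topspace (top_of_set ?I). \<beta> t \<in> W}"
      then have u: "u \<in> ?I" "j (\<gamma> u, ?s u) \<in> W" by (simp_all add: \<beta>_def)
      then obtain U where U: "openin X U" "\<gamma> u \<in> U"
        "\<forall>c \<delta>. path_between (subtopology X U) (\<gamma> u) c \<delta> \<longrightarrow> j (c, shift (\<gamma> u) c \<delta> (?s u)) \<in> W"
        using W[unfolded openin_total] s_in[OF u(1)] path_between_in_topspace[OF \<gamma> u(1)] by blast
      have "openin (top_of_set ?I) {t \<in> topspace (top_of_set ?I). \<gamma> t \<in> U}"
        using pin U(1) unfolding pathin_def by (rule openin_continuous_map_preimage)
      then have "\<exists>d>0. \<forall>t\<in>?I. dist t u < d \<longrightarrow> t \<in> {t \<in> topspace (top_of_set ?I). \<gamma> t \<in> U}"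
        using u(1) U(2) unfolding openin_euclidean_subtopology_iff by simp
      then obtain d where d: "d > 0" "\<forall>t\<in>?I. dist t u < d \<longrightarrow> \<gamma> t \<in> U" by auto
      have "\<beta> t \<in> W" if t: "t \<in> ?I" "dist t u < d" for t
      proof -
        have "path_segment \<gamma> u t r \<in> U" if r: "r \<in> ?I" for r
        proof -
          have "u + r * (t - u) \<in> ?I" by (rule segment_parameter_in_unit_interval[OF u(1) t(1) r])
          moreover have "dist (u + r * (t - u)) u \<le> dist t u"
            using r mult_left_le_one_le[of "\<bar>t - u\<bar>" r] by (simp add: dist_real_def abs_mult)
          then have "dist (u + r * (t - u)) u < d" using t(2) by (rule order_le_less_trans)
          ultimately show ?thesis using d(2) unfolding path_segment_def by blast
        qed
        then have "path_between (subtopology X U) (\<gamma> u) (\<gamma> t) (path_segment \<gamma> u t)"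
          using seg[OF u(1) t(1)] by (simp add: path_between_subtopology)
        then show ?thesis using U(3) step[OF u(1) t(1)] by (simp add: \<beta>_def)
      qed
      then show "\<exists>e>0. \<forall>t\<in>?I. dist t u < e \<longrightarrow> t \<in> {t \<in> topspace (top_of_set ?I). \<beta> t \<in> W}"
        using d(1) by auto
    qed auto
  qed
  moreover have "path_segment \<gamma> 0 0 = (\<lambda>t. a)" by (simp add: path_segment_def ends)
  then have "\<beta> 0 = j (a, e)"
    using shift_const[OF path_between_imp_topspace(1)[OF \<gamma>] e] by (simp add: \<beta>_def ends)
  moreover have "\<beta> 1 = j (b, shift a b \<gamma> e)" by (simp add: \<beta>_def ends)
  ultimately have "path_between total_space (j (a, e)) (j (b, shift a b \<gamma> e)) \<beta>" by (simp add: path_between_def)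
  then show ?thesis
    by (rule transport_eqI[OF cover_total]) (simp add: \<beta>_def s_in path_between_in_topspace[OF \<gamma>])
qed

text \<open>The map reads off the label of a point over x; by \<open>transport_total\<close> and
  \<open>shift_loop\<close>, loops act on labels through \<phi>.\<close>

lemma gset_isomorphic_Fib_total:
  "\<exists>f\<in>equivariant (pi1 X x) (fibre total_space proj x, monodromy X x total_space proj) (E, \<phi>).
     bij_betw f (fibre total_space proj x) E"
proof -
  define f where "f = (\<lambda>y\<in>fibre total_space proj x. snd (inv_into (topspace X \<times> E) j y))"
  have f: "f (j (x, e)) = e" if "e \<in> E" for e
    using that x by (simp add: f_def inv_into_f_f[OF j])
  have f_ext: "f \<in> extensional (fibre total_space proj x)" unfolding f_def by (rule restrict_extensional)
  have "bij_betw f (fibre total_space proj x) E"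
    unfolding fibre_total[OF x] bij_betw_def using f by (auto simp: inj_on_def image_image)
  moreover have "f \<in> fibre total_space proj x \<rightarrow>\<^sub>E E"
    using f f_ext unfolding fibre_total[OF x] by (auto simp only: PiE_iff)
  moreover have "f (monodromy X x total_space proj c y) = \<phi> c (f y)"
    if c: "c \<in> carrier (pi1 X x)" and y: "y \<in> fibre total_space proj x" for c y
  proof -
    obtain e where e: "e \<in> E" "y = j (x, e)" using y unfolding fibre_total[OF x] by blast
    obtain \<gamma> where \<gamma>: "path_between X x x \<gamma>" "c = loop_class X x \<gamma>" using c by (auto simp: carrier_pi1)
    have "monodromy X x total_space proj c y = j (x, \<phi> c e)"
      using monodromy_loop_class[OF cover_total \<gamma>(1) y] transport_total[OF \<gamma>(1) e(1)] shift_loop[OF \<gamma>(1)] \<gamma>(2) e(2)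
      by simp
    moreover have "\<phi> c e \<in> E" using group_action.element_image[OF action c e(1)] by blast
    ultimately show ?thesis using f e by simp
  qed
  ultimately show ?thesis by (intro bexI[of _ f]) (simp_all only: equivariant_def case_prod_conv mem_Collect_eq, blast)
qed

end

section \<open>The size of the fundamental group\<close>

lemma lepoll_iff_ordLeq: "A \<lesssim> B \<longleftrightarrow> (card_of A, card_of B) \<in> ordLeq"
  unfolding lepoll_def card_of_ordLeq[symmetric] by blast

lemma times_lepoll_infinite:
  assumes "infinite (UNIV :: 'u set)" "A \<lesssim> (UNIV :: 'u set)" "B \<lesssim> (UNIV :: 'u set)"
  shows "A \<times> B \<lesssim> (UNIV :: 'u set)"
proof -
  have "A \<times> B \<lesssim> (UNIV :: 'u set) \<times> (UNIV :: 'u set)" using assms(2,3) by (rule times_lepoll_mono)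
  moreover have "(UNIV :: 'u set) \<times> (UNIV :: 'u set) \<lesssim> (UNIV :: 'u set)"
    unfolding lepoll_iff_ordLeq using card_of_Times_same_infinite[OF assms(1)] by (rule ordIso_imp_ordLeq)
  ultimately show ?thesis by (rule lepoll_trans)
qed

text \<open>The lists form a countable union over their lengths, and those of fixed length embed by
  repeated use of products.\<close>

lemma lists_lepoll_infinite:
  assumes inf: "infinite (UNIV :: 'u set)" and A: "A \<lesssim> (UNIV :: 'u set)"
  shows "lists A \<lesssim> (UNIV :: 'u set)"
proof -
  have step: "{l \<in> lists A. length l = n} \<lesssim> (UNIV :: 'u set)" for n
  proof (induction n)
    case 0
    have "{l \<in> lists A. length l = 0} = {[]}" by auto
    then show ?case using inf by (simp add: finite_lepoll_infinite)
  next
    case (Suc n)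
    have "{l \<in> lists A. length l = Suc n} \<subseteq> (\<lambda>(a, l). a # l) ` (A \<times> {l \<in> lists A. length l = n})"
      by (force simp: length_Suc_conv)
    from subset_image_lepoll[OF this] times_lepoll_infinite[OF inf A Suc.IH] show ?case
      by (rule lepoll_trans)
  qed
  have "(card_of (\<Union>n. {l \<in> lists A. length l = n}), card_of (UNIV :: 'u set)) \<in> ordLeq"
    by (rule card_of_UNION_ordLeq_infinite[OF inf])
      (use step inf in \<open>auto simp: lepoll_iff_ordLeq infinite_iff_card_of_nat\<close>)
  moreover have "(\<Union>n. {l \<in> lists A. length l = n}) = lists A" by auto
  ultimately show ?thesis by (simp add: lepoll_iff_ordLeq)
qed

text \<open>A list \<open>(b\<^sub>1, c\<^sub>1), \<dots>, (b\<^sub>n, c\<^sub>n)\<close> stands for the path through \<open>c, c\<^sub>1, \<dots>, c\<^sub>n\<close> whose pieces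
  \<open>\<sigma> b\<^sub>i c\<^sub>i\<^sub>-\<^sub>1 c\<^sub>i\<close> are chosen in a good neighbourhood of \<open>b\<^sub>i\<close>.\<close>

primrec chain_path :: "('a \<Rightarrow> 'a \<Rightarrow> 'a \<Rightarrow> real \<Rightarrow> 'a) \<Rightarrow> 'a \<Rightarrow> ('a \<times> 'a) list \<Rightarrow> real \<Rightarrow> 'a" where
  "chain_path \<sigma> c [] = (\<lambda>t. c)"
| "chain_path \<sigma> c (bd # l) = path_concat (\<sigma> (fst bd) c (snd bd)) (chain_path \<sigma> (snd bd) l)"

text \<open>The pieces are only required to be paths in X; that they lie in good neighbourhoods is
  left to the choice of \<sigma>. The condition on the empty list makes its constant path a path in
  X.\<close>

primrec is_chain ::
  "'a topology \<Rightarrow> ('a \<Rightarrow> 'a \<Rightarrow> 'a \<Rightarrow> real \<Rightarrow> 'a) \<Rightarrow> 'a \<Rightarrow> ('a \<times> 'a) list \<Rightarrow> 'a \<Rightarrow> bool" where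
  "is_chain X \<sigma> c [] d \<longleftrightarrow> c = d \<and> c \<in> topspace X"
| "is_chain X \<sigma> c (bd # l) d \<longleftrightarrow> fst bd \<in> topspace X \<and>
     path_between X c (snd bd) (\<sigma> (fst bd) c (snd bd)) \<and> is_chain X \<sigma> (snd bd) l d"

lemma is_chain_path_between: "is_chain X \<sigma> c l d \<Longrightarrow> path_between X c d (chain_path \<sigma> c l)"
  by (induction l arbitrary: c) (auto intro: path_between_const path_between_concat)

lemma is_chain_in_lists: "is_chain X \<sigma> c l d \<Longrightarrow> l \<in> lists (topspace X \<times> topspace X)"
  by (induction l arbitrary: c) (auto dest: path_between_imp_topspace(2))

lemma is_chain_append:
  assumes "is_chain X \<sigma> c l d" and l': "is_chain X \<sigma> d l' e"
  shows "is_chain X \<sigma> c (l @ l') e"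
    and "path_homotopic X c e (path_concat (chain_path \<sigma> c l) (chain_path \<sigma> d l')) (chain_path \<sigma> c (l @ l'))"
proof -
  have "is_chain X \<sigma> c (l @ l') e \<and>
    path_homotopic X c e (path_concat (chain_path \<sigma> c l) (chain_path \<sigma> d l')) (chain_path \<sigma> c (l @ l'))"
    using assms(1)
  proof (induction l arbitrary: c)
    case Nil
    then show ?case using l' path_homotopic_const_left[OF is_chain_path_between[OF l']] by simp
  next
    case (Cons bd l)
    let ?c = "snd bd" and ?s = "\<sigma> (fst bd) c (snd bd)"
    have s: "path_between X c ?c ?s" and l: "is_chain X \<sigma> ?c l d" using Cons.prems by auto
    note IH = Cons.IH[OF l]
    have "path_homotopic X c e (path_concat (path_concat ?s (chain_path \<sigma> ?c l)) (chain_path \<sigma> d l'))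
        (path_concat ?s (path_concat (chain_path \<sigma> ?c l) (chain_path \<sigma> d l')))"
      by (rule path_homotopic_assoc[OF s is_chain_path_between[OF l] is_chain_path_between[OF l']])
    also have "path_homotopic X c e \<dots> (path_concat ?s (chain_path \<sigma> ?c (l @ l')))"
      using IH by (intro path_homotopic_concat[OF path_homotopic_refl[OF s]]) blast
    finally show ?case using IH Cons.prems by simp
  qed
  then show "is_chain X \<sigma> c (l @ l') e"
    and "path_homotopic X c e (path_concat (chain_path \<sigma> c l) (chain_path \<sigma> d l')) (chain_path \<sigma> c (l @ l'))"
    by blast+
qed

text \<open>Bisection cuts a loop into segments lying in good neighbourhoods. There a segment is
  homotopic to the chosen path with the same ends, so finitely many points determine the class of
  the loop.\<close>

lemma pi1_lepoll_lists:
  assumes lpc: "locally_path_connected_space X" and slsc: "semilocally_simply_connected_space X"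
  shows "carrier (pi1 X x) \<lesssim> lists (topspace X \<times> topspace X)"
proof -
  have "\<forall>b\<in>topspace X. \<exists>U. openin X U \<and> b \<in> U \<and> path_connectedin X U \<and>
      (\<forall>c d \<gamma> \<delta>. path_between (subtopology X U) c d \<gamma> \<longrightarrow> path_between (subtopology X U) c d \<delta>
         \<longrightarrow> path_homotopic X c d \<gamma> \<delta>)"
  proof
    fix b assume "b \<in> topspace X"
    from semilocally_simply_connected_neighbourhood[OF lpc slsc this]
    show "\<exists>U. openin X U \<and> b \<in> U \<and> path_connectedin X U \<and>
      (\<forall>c d \<gamma> \<delta>. path_between (subtopology X U) c d \<gamma> \<longrightarrow> path_between (subtopology X U) c d \<delta>
         \<longrightarrow> path_homotopic X c d \<gamma> \<delta>)" by metis
  qed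
  from bchoice[OF this] obtain U where U: "\<forall>b\<in>topspace X. openin X (U b) \<and> b \<in> U b \<and> path_connectedin X (U b) \<and>
      (\<forall>c d \<gamma> \<delta>. path_between (subtopology X (U b)) c d \<gamma> \<longrightarrow> path_between (subtopology X (U b)) c d \<delta>
         \<longrightarrow> path_homotopic X c d \<gamma> \<delta>)" ..
  \<comment> \<open>One path is fixed for each neighbourhood and each pair of ends, so that a list
    of points alone determines a path.\<close>
  define \<sigma> where "\<sigma> = (\<lambda>b c d. SOME \<gamma>. path_between (subtopology X (U b)) c d \<gamma>)"
  have \<sigma>: "path_between (subtopology X (U b)) c d (\<sigma> b c d)"
    if "b \<in> topspace X" "c \<in> U b" "d \<in> U b" for b c d
  proof -
    have "path_connectedin X (U b)" using U that(1) by blast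
    from someI_ex[OF path_connectedin_path_between[OF this that(2,3)]] show ?thesis by (simp add: \<sigma>_def)
  qed
  have "\<exists>l. is_chain X \<sigma> x l x \<and> path_homotopic X x x \<gamma> (chain_path \<sigma> x l)"
    if \<gamma>: "path_between X x x \<gamma>" for \<gamma>
  proof -
    have pin: "pathin X \<gamma>" and ends: "\<gamma> 0 = x" "\<gamma> 1 = x" using \<gamma> by (simp_all add: path_between_def)
    define P where "P = (\<lambda>u v. 0 \<le> u \<longrightarrow> v \<le> 1 \<longrightarrow>
      (\<exists>l. is_chain X \<sigma> (\<gamma> u) l (\<gamma> v) \<and> path_homotopic X (\<gamma> u) (\<gamma> v) (path_segment \<gamma> u v) (chain_path \<sigma> (\<gamma> u) l)))"
    have "P 0 1"
    proof (rule Bolzano[of "0::real" 1 P])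
      fix u v w assume P: "P u v" "P v w" and uvw: "u \<le> v" "v \<le> w"
      show "P u w" unfolding P_def
      proof (intro impI)
        assume "0 \<le> u" "w \<le> 1"
        then have I: "u \<in> {0..1}" "v \<in> {0..1}" "w \<in> {0..1}" using uvw by auto
        obtain l where l: "is_chain X \<sigma> (\<gamma> u) l (\<gamma> v)"
          "path_homotopic X (\<gamma> u) (\<gamma> v) (path_segment \<gamma> u v) (chain_path \<sigma> (\<gamma> u) l)"
          using P(1) I unfolding P_def by auto
        obtain l' where l': "is_chain X \<sigma> (\<gamma> v) l' (\<gamma> w)"
          "path_homotopic X (\<gamma> v) (\<gamma> w) (path_segment \<gamma> v w) (chain_path \<sigma> (\<gamma> v) l')"
          using P(2) I unfolding P_def by auto
        have "path_homotopic X (\<gamma> u) (\<gamma> w) (path_segment \<gamma> u w) (path_concat (path_segment \<gamma> u v) (path_segment \<gamma> v w))"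
          by (rule path_homotopic_sym[OF path_homotopic_concat_segments[OF pin I]])
        also have "path_homotopic X (\<gamma> u) (\<gamma> w) \<dots> (path_concat (chain_path \<sigma> (\<gamma> u) l) (chain_path \<sigma> (\<gamma> v) l'))"
          by (rule path_homotopic_concat[OF l(2) l'(2)])
        also have "path_homotopic X (\<gamma> u) (\<gamma> w) \<dots> (chain_path \<sigma> (\<gamma> u) (l @ l'))"
          by (rule is_chain_append(2)[OF l(1) l'(1)])
        finally show "\<exists>l. is_chain X \<sigma> (\<gamma> u) l (\<gamma> w) \<and>
            path_homotopic X (\<gamma> u) (\<gamma> w) (path_segment \<gamma> u w) (chain_path \<sigma> (\<gamma> u) l)"
          using is_chain_append(1)[OF l(1) l'(1)] by blast
      qed
    next
      fix t :: real assume "0 \<le> t" "t \<le> 1"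
      then have t: "t \<in> {0..1}" by simp
      let ?b = "\<gamma> t"
      have b: "?b \<in> topspace X" by (rule path_between_in_topspace[OF \<gamma> t])
      then have Ub: "openin X (U ?b)" "?b \<in> U ?b" using U by blast+
      have "openin (top_of_set {0..1}) {s \<in> topspace (top_of_set {0..1}). \<gamma> s \<in> U ?b}"
        using pin Ub(1) unfolding pathin_def by (rule openin_continuous_map_preimage)
      then have "\<exists>d>0. \<forall>s\<in>{0..1}. dist s t < d \<longrightarrow> s \<in> {s \<in> topspace (top_of_set {0..1}). \<gamma> s \<in> U ?b}"
        using t Ub(2) unfolding openin_euclidean_subtopology_iff by simp
      then obtain d where d: "d > 0" "\<forall>s\<in>{0..1}. dist s t < d \<longrightarrow> \<gamma> s \<in> U ?b" by auto
      have "P u v" if uv: "u \<le> t" "t \<le> v" "v - u < d" for u v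
        unfolding P_def
      proof (intro impI)
        assume "0 \<le> u" "v \<le> 1"
        then have I: "u \<in> {0..1}" "v \<in> {0..1}" using uv by auto
        have in_U: "\<gamma> s \<in> U ?b" if "u \<le> s" "s \<le> v" for s
          using d(2) that uv I by (auto simp: dist_real_def)
        have "path_segment \<gamma> u v r \<in> U ?b" if r: "r \<in> {0..1}" for r
          unfolding path_segment_def
        proof (rule in_U)
          have "0 \<le> r * (v - u)" "r * (v - u) \<le> v - u"
            using r uv by (simp_all add: mult_left_le_one_le)
          then show "u \<le> u + r * (v - u)" "u + r * (v - u) \<le> v" by auto
        qed
        then have seg: "path_between (subtopology X (U ?b)) (\<gamma> u) (\<gamma> v) (path_segment \<gamma> u v)"
          using path_between_segment[OF pin I] by (simp add: path_between_subtopology)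
        \<comment> \<open>A short segment is a chain of one step. The constant path with which
          \<open>chain_path\<close> ends is absorbed by
          \<open>path_homotopic_const_right\<close>.\<close>
        let ?l = "[(?b, \<gamma> v)]"
        have s: "path_between (subtopology X (U ?b)) (\<gamma> u) (\<gamma> v) (\<sigma> ?b (\<gamma> u) (\<gamma> v))"
          using \<sigma>[OF b] in_U uv by simp
        have chain: "is_chain X \<sigma> (\<gamma> u) ?l (\<gamma> v)"
          using b path_between_mono[OF s] path_between_imp_topspace(2)[OF path_between_mono[OF s]] by simp
        have "path_homotopic X (\<gamma> u) (\<gamma> v) (path_segment \<gamma> u v) (\<sigma> ?b (\<gamma> u) (\<gamma> v))"
          using U b seg s by blast
        also have "path_homotopic X (\<gamma> u) (\<gamma> v) \<dots> (chain_path \<sigma> (\<gamma> u) ?l)"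
          using path_homotopic_sym[OF path_homotopic_const_right[OF path_between_mono[OF s]]] by simp
        finally show "\<exists>l. is_chain X \<sigma> (\<gamma> u) l (\<gamma> v) \<and>
            path_homotopic X (\<gamma> u) (\<gamma> v) (path_segment \<gamma> u v) (chain_path \<sigma> (\<gamma> u) l)"
          using chain by blast
      qed
      then show "\<exists>d>0. \<forall>u v. u \<le> t \<and> t \<le> v \<and> v - u < d \<longrightarrow> P u v" using d(1) by blast
    qed simp
    then show ?thesis by (simp add: P_def ends)
  qed
  \<comment> \<open>Many lists may give the same class; a surjection from the lists is enough to
    bound the size.\<close>
  then have "carrier (pi1 X x) \<subseteq> (\<lambda>l. loop_class X x (chain_path \<sigma> x l)) ` lists (topspace X \<times> topspace X)"
    using is_chain_in_lists loop_class_eq unfolding carrier_pi1 by fast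
  then show ?thesis by (rule subset_image_lepoll)
qed

lemma pi1_lepoll_infinite:
  assumes "locally_path_connected_space X" "semilocally_simply_connected_space X"
    and "infinite (UNIV :: 'u set)" "topspace X \<lesssim> (UNIV :: 'u set)"
  shows "carrier (pi1 X x) \<lesssim> (UNIV :: 'u set)"
  using pi1_lepoll_lists[OF assms(1,2)] lists_lepoll_infinite[OF assms(3) times_lepoll_infinite[OF assms(3,4,4)]]
  by (rule lepoll_trans)

section \<open>Essential surjectivity\<close>

lemma iso_arrow_GSet:
  assumes a: "group_action G E \<phi>" and b: "group_action G F \<psi>"
    and f: "f \<in> equivariant G (E, \<phi>) (F, \<psi>)" and bij: "bij_betw f E F"
  shows "iso_arrow (GSet G) (E, \<phi>) (F, \<psi>) f"
proof -
  define h where "h = (\<lambda>y\<in>F. inv_into E f y)"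
  have f_eq: "f (\<phi> g e) = \<psi> g (f e)" if "g \<in> carrier G" "e \<in> E" for g e
    using f that by (auto simp: equivariant_def)
  have h: "h y \<in> E" "f (h y) = y" if "y \<in> F" for y
    using that bij by (simp_all add: h_def bij_betw_def inv_into_into f_inv_into_f)
  have hf: "h (f e) = e" if "e \<in> E" for e
    using that bij by (auto simp: h_def bij_betw_def)
  have "h (\<psi> g y) = \<phi> g (h y)" if g: "g \<in> carrier G" and y: "y \<in> F" for g y
  proof -
    have "\<phi> g (h y) \<in> E" using group_action.element_image[OF a g h(1)[OF y]] by blast
    then show ?thesis using f_eq[OF g h(1)[OF y]] h(2)[OF y] hf by metis
  qed
  then have "h \<in> hm (GSet G) (F, \<psi>) (E, \<phi>)"
    using h(1) unfolding hm_GSet by (auto simp: h_def)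
  moreover have "f \<in> hm (GSet G) (E, \<phi>) (F, \<psi>)" using f by (simp add: GSet_def)
  moreover have "compose E h f = (\<lambda>e\<in>E. e)" "compose F f h = (\<lambda>y\<in>F. y)"
    using hf h(2) by (auto simp: compose_def)
  ultimately show ?thesis unfolding iso_arrow_def by (auto simp: GSet_def)
qed

text \<open>\<open>E\<close> may live in any type, and only the product of X with it has to fit into
  \<open>'u\<close>. This covers both the objects of the target category and the coset spaces, whose
  points are sets of loop classes.\<close>

lemma exists_cover_with_fibre:
  assumes conn: "connected_space X" and lpc: "locally_path_connected_space X"
    and slsc: "semilocally_simply_connected_space X" and x: "x \<in> topspace X"
    and action: "group_action (pi1 X x) E \<phi>" and small: "topspace X \<times> E \<lesssim> (UNIV :: 'u set)"
  shows "\<exists>(Y :: 'u topology) p. cover X Y p \<and> p \<in> extensional (topspace Y) \<and>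
    gset_isomorphic (pi1 X x) (fibre Y p x, monodromy X x Y p) (E, \<phi>)"
proof -
  obtain j :: "'a \<times> 'b \<Rightarrow> 'u" where j: "inj_on j (topspace X \<times> E)"
    using small unfolding lepoll_def by blast
  have "\<forall>b\<in>topspace X. \<exists>\<gamma>. path_between X x b \<gamma>"
    using locally_path_connected_imp_path_between[OF conn lpc x] by blast
  then obtain g\<^sub>0 where g\<^sub>0: "\<forall>b\<in>topspace X. path_between X x b (g\<^sub>0 b)" by metis
  \<comment> \<open>The path at the base point is reset to the constant one, as \<open>g_x\<close>
    demands.\<close>
  define g where "g = (\<lambda>b. if b = x then (\<lambda>t. x) else g\<^sub>0 b)"
  interpret T: twisted_product X x E \<phi> g j
    by (rule twisted_product.intro) (simp_all add: lpc slsc x action j g_def g\<^sub>0 path_between_const)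
  have "T.proj \<in> extensional (topspace T.total_space)" by (simp add: T.proj_def)
  then show ?thesis
    using T.cover_total T.gset_isomorphic_Fib_total unfolding gset_isomorphic_def fst_conv by blast
qed

section \<open>Transitive actions and coset spaces\<close>

lemma group_action_coset_gset:
  assumes G: "group G" and N: "subgroup N G"
  shows "group_action G (fst (coset_gset G N)) (snd (coset_gset G N))"
  unfolding coset_gset_def fst_conv snd_conv
proof (rule group_actionI[OF G])
  interpret group G by fact
  have sub: "N \<subseteq> carrier G" by (rule subgroup.subset[OF N])
  have coset: "\<exists>a\<in>carrier G. C = a <#\<^bsub>G\<^esub> N" if "C \<in> lcosets\<^bsub>G\<^esub> N" for C
    using that by (auto simp: LCOSETS_def)
  have cl: "g <#\<^bsub>G\<^esub> C \<in> lcosets\<^bsub>G\<^esub> N" if g: "g \<in> carrier G" and C: "C \<in> lcosets\<^bsub>G\<^esub> N" for g C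
  proof -
    obtain a where "a \<in> carrier G" "C = a <#\<^bsub>G\<^esub> N" using coset[OF C] by blast
    then have "g <#\<^bsub>G\<^esub> C = (g \<otimes>\<^bsub>G\<^esub> a) <#\<^bsub>G\<^esub> N" "g \<otimes>\<^bsub>G\<^esub> a \<in> carrier G"
      using g sub by (simp_all add: lcos_m_assoc)
    then show ?thesis by (auto simp: LCOSETS_def)
  qed
  have C_sub: "C \<subseteq> carrier G" if "C \<in> lcosets\<^bsub>G\<^esub> N" for C
    using subgroup.lcosets_carrier[OF N G that] .
  show "(\<lambda>g\<in>carrier G. \<lambda>C\<in>lcosets\<^bsub>G\<^esub> N. g <#\<^bsub>G\<^esub> C) g C \<in> lcosets\<^bsub>G\<^esub> N"
    if "g \<in> carrier G" "C \<in> lcosets\<^bsub>G\<^esub> N" for g C using that cl by simp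
  show "(\<lambda>g\<in>carrier G. \<lambda>C\<in>lcosets\<^bsub>G\<^esub> N. g <#\<^bsub>G\<^esub> C) \<one>\<^bsub>G\<^esub> C = C"
    if "C \<in> lcosets\<^bsub>G\<^esub> N" for C using that C_sub[OF that] by (simp add: lcos_mult_one)
  show "(\<lambda>g\<in>carrier G. \<lambda>C\<in>lcosets\<^bsub>G\<^esub> N. g <#\<^bsub>G\<^esub> C) (g \<otimes>\<^bsub>G\<^esub> h) C =
      (\<lambda>g\<in>carrier G. \<lambda>C\<in>lcosets\<^bsub>G\<^esub> N. g <#\<^bsub>G\<^esub> C) g ((\<lambda>g\<in>carrier G. \<lambda>C\<in>lcosets\<^bsub>G\<^esub> N. g <#\<^bsub>G\<^esub> C) h C)"
    if "g \<in> carrier G" "h \<in> carrier G" "C \<in> lcosets\<^bsub>G\<^esub> N" for g h C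
    using that cl C_sub[OF that(3)] by (simp add: lcos_m_assoc)
qed simp

text \<open>A point \<open>y\<close> is sent to the set of all group elements carrying
  \<open>e\<close> to \<open>y\<close>. This is a left coset of the stabilizer, obtained without
  choosing a representative.\<close>

lemma transitive_gset_isomorphic_cosets:
  assumes action: "group_action G E \<phi>" and e: "e \<in> E"
    and trans: "\<And>y. y \<in> E \<Longrightarrow> \<exists>g\<in>carrier G. \<phi> g e = y"
  shows "gset_isomorphic G (E, \<phi>) (coset_gset G (stabilizer G \<phi> e))"
proof -
  interpret group_action G E \<phi> by fact
  interpret group G using group_hom by (rule group_hom.axioms(1))
  let ?N = "stabilizer G \<phi> e"
  have N: "subgroup ?N G" by (rule stabilizer_subgroup[OF e])
  note sub = subgroup.subset[OF N]
  define f where "f = (\<lambda>y\<in>E. {g \<in> carrier G. \<phi> g e = y})"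
  have f: "f (\<phi> a e) = a <#\<^bsub>G\<^esub> ?N" if a: "a \<in> carrier G" for a
  proof -
    have "\<phi> a e \<in> E" using element_image a e by blast
    then have "f (\<phi> a e) = {g \<in> carrier G. \<phi> g e = \<phi> a e}" by (simp add: f_def)
    also have "\<dots> = a <#\<^bsub>G\<^esub> ?N"
    proof (intro equalityI subsetI)
      fix g assume "g \<in> {g \<in> carrier G. \<phi> g e = \<phi> a e}"
      then have g: "g \<in> carrier G" "\<phi> g e = \<phi> a e" by auto
      have "\<phi> (inv\<^bsub>G\<^esub> a \<otimes>\<^bsub>G\<^esub> g) e = e"
        using composition_rule[OF e _ g(1), of "inv\<^bsub>G\<^esub> a"] g(2) orbit_sym_aux[OF a e refl] a by simp
      then have "inv\<^bsub>G\<^esub> a \<otimes>\<^bsub>G\<^esub> g \<in> ?N" using a g(1) by (simp add: stabilizer_def)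
      moreover have "g = a \<otimes>\<^bsub>G\<^esub> (inv\<^bsub>G\<^esub> a \<otimes>\<^bsub>G\<^esub> g)" using a g(1) by (simp flip: m_assoc)
      ultimately show "g \<in> a <#\<^bsub>G\<^esub> ?N" unfolding l_coset_def by blast
    next
      fix g assume "g \<in> a <#\<^bsub>G\<^esub> ?N"
      then obtain h where "h \<in> ?N" "g = a \<otimes>\<^bsub>G\<^esub> h" unfolding l_coset_def by blast
      then show "g \<in> {g \<in> carrier G. \<phi> g e = \<phi> a e}"
        using composition_rule[OF e a] a by (auto simp: stabilizer_def)
    qed
    finally show ?thesis .
  qed
  have "f \<in> equivariant G (E, \<phi>) (coset_gset G ?N)"
    unfolding equivariant_def coset_gset_def case_prod_conv mem_Collect_eq
  proof (intro conjI ballI)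
    have "f y \<in> lcosets\<^bsub>G\<^esub> ?N" if "y \<in> E" for y
      using trans[OF that] f by (auto simp: LCOSETS_def)
    then show f_in: "f \<in> E \<rightarrow>\<^sub>E lcosets\<^bsub>G\<^esub> ?N" by (auto simp: f_def)
    fix g y assume g: "g \<in> carrier G" and y: "y \<in> E"
    obtain a where a: "a \<in> carrier G" "y = \<phi> a e" using trans[OF y] by blast
    have "f (\<phi> g y) = (g \<otimes>\<^bsub>G\<^esub> a) <#\<^bsub>G\<^esub> ?N"
      using f[of "g \<otimes>\<^bsub>G\<^esub> a"] g a composition_rule[OF e g a(1)] by simp
    also have "\<dots> = g <#\<^bsub>G\<^esub> f y" using g a sub by (simp add: f lcos_m_assoc)
    finally show "f (\<phi> g y) = (\<lambda>g\<in>carrier G. \<lambda>C\<in>lcosets\<^bsub>G\<^esub> ?N. g <#\<^bsub>G\<^esub> C) g (f y)"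
      using g f_in y by auto
  qed
  moreover have "bij_betw f E (lcosets\<^bsub>G\<^esub> ?N)"
    unfolding bij_betw_def
  proof
    show "inj_on f E"
    proof (rule inj_onI)
      fix y z assume y: "y \<in> E" and z: "z \<in> E" and eq: "f y = f z"
      obtain a where a: "a \<in> carrier G" "\<phi> a e = y" using trans[OF y] by blast
      then have "a \<in> f z" using y by (simp flip: eq) (simp add: f_def)
      then show "y = z" using z a by (simp add: f_def)
    qed
    show "f ` E = lcosets\<^bsub>G\<^esub> ?N"
    proof
      show "f ` E \<subseteq> lcosets\<^bsub>G\<^esub> ?N" using trans f by (fastforce simp: LCOSETS_def)
      show "lcosets\<^bsub>G\<^esub> ?N \<subseteq> f ` E"
      proof
        fix C assume "C \<in> lcosets\<^bsub>G\<^esub> ?N"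
        then obtain a where a: "a \<in> carrier G" "C = a <#\<^bsub>G\<^esub> ?N" by (auto simp: LCOSETS_def)
        then have "C = f (\<phi> a e)" "\<phi> a e \<in> E" using f element_image[OF a(1) e refl] by simp_all
        then show "C \<in> f ` E" by blast
      qed
    qed
  qed
  ultimately show ?thesis unfolding gset_isomorphic_def coset_gset_def by auto
qed

text \<open>The stabilizer of the coset aN is the conjugate of N by a, which is N itself by
  normality. Every point thus has the same stabilizer, the form in which normality is used for
  Galois covers.\<close>

lemma gset_isomorphic_normal_cosets:
  assumes action: "group_action G E \<phi>" and N: "N \<lhd> G"
    and iso: "gset_isomorphic G (E, \<phi>) (coset_gset G N)"
  shows "transitive_gset G (E, \<phi>)"
    and "\<And>g y. \<lbrakk>g \<in> carrier G; y \<in> E\<rbrakk> \<Longrightarrow> \<phi> g y = y \<longleftrightarrow> g \<in> N"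
proof -
  interpret group_action G E \<phi> by fact
  interpret N: normal N G by fact
  obtain f where f: "f \<in> equivariant G (E, \<phi>) (coset_gset G N)" and bij: "bij_betw f E (lcosets\<^bsub>G\<^esub> N)"
    using iso unfolding gset_isomorphic_def coset_gset_def by auto
  have f_in: "f y \<in> lcosets\<^bsub>G\<^esub> N" if "y \<in> E" for y using bij that by (rule bij_betw_apply)
  have f_eq: "f (\<phi> g y) = g <#\<^bsub>G\<^esub> f y" if "g \<in> carrier G" "y \<in> E" for g y
    using f f_in that by (auto simp: equivariant_def coset_gset_def)
  have inj: "y = z" if "y \<in> E" "z \<in> E" "f y = f z" for y z
    using bij that unfolding bij_betw_def by (auto dest: inj_onD)
  have coset: "\<exists>a\<in>carrier G. f y = a <#\<^bsub>G\<^esub> N" if "y \<in> E" for y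
    using f_in[OF that] by (auto simp: LCOSETS_def)
  have "\<exists>g\<in>carrier G. \<phi> g y = z" if y: "y \<in> E" and z: "z \<in> E" for y z
  proof -
    obtain a where a: "a \<in> carrier G" "f y = a <#\<^bsub>G\<^esub> N" using coset[OF y] by blast
    obtain b where b: "b \<in> carrier G" "f z = b <#\<^bsub>G\<^esub> N" using coset[OF z] by blast
    let ?g = "b \<otimes>\<^bsub>G\<^esub> inv\<^bsub>G\<^esub> a"
    have g: "?g \<in> carrier G" using a b by simp
    have "f (\<phi> ?g y) = (?g \<otimes>\<^bsub>G\<^esub> a) <#\<^bsub>G\<^esub> N"
      using f_eq[OF g y] a g N.subset by (simp add: N.lcos_m_assoc)
    also have "\<dots> = f z" using a b by (simp add: N.m_assoc)
    finally have "\<phi> ?g y = z" using inj element_image[OF g y refl] z by blast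
    then show ?thesis using g by blast
  qed
  moreover have "E \<noteq> {}"
  proof -
    have "\<one>\<^bsub>G\<^esub> <#\<^bsub>G\<^esub> N \<in> lcosets\<^bsub>G\<^esub> N" by (auto simp: LCOSETS_def)
    then show ?thesis using bij unfolding bij_betw_def by auto
  qed
  ultimately show "transitive_gset G (E, \<phi>)"
    using action by (auto simp: transitive_gset_def transitive_action_def transitive_action_axioms_def)
  fix g y assume g: "g \<in> carrier G" and y: "y \<in> E"
  obtain a where a: "a \<in> carrier G" "f y = a <#\<^bsub>G\<^esub> N" using coset[OF y] by blast
  let ?ga = "g \<otimes>\<^bsub>G\<^esub> a" and ?c = "inv\<^bsub>G\<^esub> a \<otimes>\<^bsub>G\<^esub> (g \<otimes>\<^bsub>G\<^esub> a)"
  have "\<phi> g y = y \<longleftrightarrow> f (\<phi> g y) = f y" using inj[OF element_image[OF g y refl] y] by auto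
  also have "\<dots> \<longleftrightarrow> ?ga <#\<^bsub>G\<^esub> N = a <#\<^bsub>G\<^esub> N"
    using f_eq[OF g y] a g N.subset by (simp add: N.lcos_m_assoc)
  also have "\<dots> \<longleftrightarrow> ?ga \<in> a <#\<^bsub>G\<^esub> N"
    using N.l_repr_independence[of ?ga a N] N.lcos_self[of ?ga N] a g N.subgroup_axioms by auto
  also have "\<dots> \<longleftrightarrow> ?c \<in> N"
    using N.lcos_module_imp[OF N.is_group a(1), of ?ga] N.lcos_module_rev[OF N.is_group a(1), of ?ga] a g by auto
  \<comment> \<open>Normality enters: conjugation by \<open>a\<close> preserves N in both
    directions.\<close>
  also have "\<dots> \<longleftrightarrow> g \<in> N"
  proof
    assume "?c \<in> N"
    then have "a \<otimes>\<^bsub>G\<^esub> ?c \<otimes>\<^bsub>G\<^esub> inv\<^bsub>G\<^esub> a \<in> N" by (rule N.inv_op_closed2[OF a(1)])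
    moreover have "a \<otimes>\<^bsub>G\<^esub> ?c \<otimes>\<^bsub>G\<^esub> inv\<^bsub>G\<^esub> a = g"
    proof -
      have "a \<otimes>\<^bsub>G\<^esub> ?c = g \<otimes>\<^bsub>G\<^esub> a" using a g by (simp flip: N.m_assoc)
      then show ?thesis using a g by (simp add: N.m_assoc)
    qed
    ultimately show "g \<in> N" by simp
  next
    assume "g \<in> N"
    then show "?c \<in> N" using N.inv_op_closed1[OF a(1)] a g by (simp add: N.m_assoc)
  qed
  finally show "\<phi> g y = y \<longleftrightarrow> g \<in> N" .
qed

text \<open>The map must send \<open>\<phi> g y\<close> to \<open>\<phi> g z\<close>. Two elements
  carrying \<open>y\<close> to the same point differ by one that fixes \<open>y\<close>, hence fixes
  \<open>z\<close>, so the choice \<open>k\<close> of such elements does not matter.\<close>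

lemma equivariant_map_with_value:
  assumes "transitive_action G E \<phi>" and y: "y \<in> E" and z: "z \<in> E"
    and stab: "\<And>g. \<lbrakk>g \<in> carrier G; \<phi> g y = y\<rbrakk> \<Longrightarrow> \<phi> g z = z"
  shows "\<exists>h\<in>equivariant G (E, \<phi>) (E, \<phi>). h y = z"
proof -
  interpret transitive_action G E \<phi> by fact
  interpret group G using group_hom by (rule group_hom.axioms(1))
  have "\<forall>w\<in>E. \<exists>g. g \<in> carrier G \<and> \<phi> g y = w" using unique_orbit[OF y] by blast
  from bchoice[OF this] obtain k where k: "\<forall>w\<in>E. k w \<in> carrier G \<and> \<phi> (k w) y = w" ..
  define h where "h = (\<lambda>w\<in>E. \<phi> (k w) z)"
  have h: "h (\<phi> g y) = \<phi> g z" if g: "g \<in> carrier G" for g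
  proof -
    have w: "\<phi> g y \<in> E" by (rule element_image[OF g y refl])
    let ?k = "k (\<phi> g y)"
    have k': "?k \<in> carrier G" "\<phi> ?k y = \<phi> g y" using k w by blast+
    have "\<phi> (inv\<^bsub>G\<^esub> g \<otimes>\<^bsub>G\<^esub> ?k) y = y"
      using composition_rule[OF y _ k'(1), of "inv\<^bsub>G\<^esub> g"] k'(2) orbit_sym_aux[OF g y refl] g by simp
    then have "\<phi> (inv\<^bsub>G\<^esub> g \<otimes>\<^bsub>G\<^esub> ?k) z = z" using stab g k'(1) by simp
    then have "\<phi> (g \<otimes>\<^bsub>G\<^esub> (inv\<^bsub>G\<^esub> g \<otimes>\<^bsub>G\<^esub> ?k)) z = \<phi> g z"
      using composition_rule[OF z g, of "inv\<^bsub>G\<^esub> g \<otimes>\<^bsub>G\<^esub> ?k"] g k'(1) by simp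
    moreover have "g \<otimes>\<^bsub>G\<^esub> (inv\<^bsub>G\<^esub> g \<otimes>\<^bsub>G\<^esub> ?k) = ?k" using g k'(1) by (simp flip: m_assoc)
    ultimately show ?thesis using w by (simp add: h_def)
  qed
  have "h \<in> equivariant G (E, \<phi>) (E, \<phi>)"
    unfolding equivariant_def case_prod_conv mem_Collect_eq
  proof (intro conjI ballI)
    show "h \<in> E \<rightarrow>\<^sub>E E" using k element_image[OF _ z refl] by (auto simp: h_def)
    fix g w assume g: "g \<in> carrier G" and w: "w \<in> E"
    have w': "k w \<in> carrier G" "\<phi> (k w) y = w" using k w by blast+
    have "h (\<phi> g w) = \<phi> (g \<otimes>\<^bsub>G\<^esub> k w) z"
      using h[of "g \<otimes>\<^bsub>G\<^esub> k w"] composition_rule[OF y g w'(1)] w' g by simp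
    also have "\<dots> = \<phi> g (h w)" using composition_rule[OF z g w'(1)] h[OF w'(1)] w'(2) by simp
    finally show "h (\<phi> g w) = \<phi> g (h w)" .
  qed
  moreover have "h y = z" using h[OF one_closed] id_eq_one y z by (metis restrict_apply')
  ultimately show ?thesis by blast
qed

section \<open>Galois covers\<close>

lemma cover_open_map:
  assumes p: "cover X Y p"
  shows "open_map Y X p"
  unfolding open_map_def
proof (intro allI impI)
  fix W assume W: "openin Y W"
  show "openin X (p ` W)"
  proof (subst openin_subopen, intro ballI)
    fix b assume "b \<in> p ` W"
    then obtain y where y: "y \<in> W" "b = p y" by blast
    obtain N s where N: "openin X N" "p y \<in> N" "continuous_map (subtopology X N) Y s"
      "\<forall>b\<in>N. s b \<in> W \<and> p (s b) = b" "s (p y) = y" "openin Y (s ` N)"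
      by (rule cover_local_section[OF p W y(1)])
    then have "N \<subseteq> p ` W" by force
    then show "\<exists>T. openin X T \<and> b \<in> T \<and> T \<subseteq> p ` W" using N(1,2) y(2) by blast
  qed
qed

lemma carrier_Deck: "f \<in> carrier (Deck Y p) \<longleftrightarrow>
    f \<in> extensional (topspace Y) \<and> homeomorphic_map Y Y f \<and> (\<forall>y\<in>topspace Y. p (f y) = p y)"
  by (simp add: Deck_def)

lemma identity_in_Deck: "(\<lambda>y\<in>topspace Y. y) \<in> carrier (Deck Y p)"
  unfolding carrier_Deck by (auto intro: homeomorphic_map_eq[OF homeomorphic_map_id[THEN iffD2]])

lemma Deck_in_hm_Cov: "f \<in> carrier (Deck Y p) \<Longrightarrow> f \<in> hm (Cov X) (Y, p) (Y, p)"
  by (simp add: carrier_Deck hm_Cov homeomorphic_imp_continuous_map)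

lemma orbit_Deck: "orbit (Deck Y p) (\<lambda>f. f) y = {f y |f. f \<in> carrier (Deck Y p)}"
  by (simp add: orbit_def)

lemma self_in_orbit_Deck: "y \<in> topspace Y \<Longrightarrow> y \<in> orbit (Deck Y p) (\<lambda>f. f) y"
  unfolding orbit_Deck mem_Collect_eq
  by (rule exI[of _ "\<lambda>y\<in>topspace Y. y"]) (simp add: identity_in_Deck)

text \<open>Deck transformations preserve \<open>p\<close>, and the identity is one of them, so
  \<open>p\<close> maps an orbit onto a singleton.\<close>

lemma the_elem_orbit_Deck:
  assumes "y \<in> topspace Y"
  shows "the_elem (p ` orbit (Deck Y p) (\<lambda>f. f) y) = p y"
proof -
  have "p ` orbit (Deck Y p) (\<lambda>f. f) y \<subseteq> {p y}"
    using assms by (auto simp: orbit_Deck carrier_Deck)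
  then have "p ` orbit (Deck Y p) (\<lambda>f. f) y = {p y}" using self_in_orbit_Deck[OF assms] by blast
  then show ?thesis by simp
qed

lemma topspace_deck_quotient: "topspace (deck_quotient Y p) = orbit (Deck Y p) (\<lambda>f. f) ` topspace Y"
  using quotient_imp_surjective_map[OF quotient_map_quotient_topology] unfolding deck_quotient_def by metis

text \<open>A connected cover of X is an open surjection, hence a quotient map, and then so is the
  induced map from the orbit space. It is therefore a homeomorphism exactly when it is injective,
  that is, when each fibre is a single orbit.\<close>

lemma galois_cover_iff_transitive_Deck:
  assumes conn: "connected_space X" and lpc: "locally_path_connected_space X" and Y: "connected_cover X Y p"
  shows "galois_cover X Y p \<longleftrightarrow>
    (\<forall>y\<in>topspace Y. \<forall>z\<in>topspace Y. p y = p z \<longrightarrow> (\<exists>f\<in>carrier (Deck Y p). f y = z))"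
proof -
  have p: "cover X Y p" and ne: "topspace Y \<noteq> {}" using Y by (simp_all add: connected_cover_def)
  let ?o = "orbit (Deck Y p) (\<lambda>f. f)" and ?h = "\<lambda>B. the_elem (p ` B)"
  note h = the_elem_orbit_Deck
  have q: "quotient_map Y (deck_quotient Y p) ?o"
    unfolding deck_quotient_def by (rule quotient_map_quotient_topology)
  have surj: "p ` topspace Y = topspace X"
  proof
    show "p ` topspace Y \<subseteq> topspace X" using cover_in_topspace[OF p] by blast
    obtain y where y: "y \<in> topspace Y" using ne by blast
    show "topspace X \<subseteq> p ` topspace Y"
    proof
      fix b assume "b \<in> topspace X"
      then obtain \<gamma> where "path_between X (p y) b \<gamma>"
        using locally_path_connected_imp_path_between[OF conn lpc cover_in_topspace[OF p y]] by blast
      from transport_in_fibre[OF p this, of y] y show "b \<in> p ` topspace Y" by blast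
    qed
  qed
  have p_quot: "quotient_map Y X p"
    by (rule continuous_open_imp_quotient_map[OF cover_continuous_map[OF p] cover_open_map[OF p] surj])
  have "quotient_map Y X (?h \<circ> ?o)"
    by (rule quotient_map_eq[OF p_quot]) (simp add: h)
  then have "quotient_map (deck_quotient Y p) X ?h"
    by (rule quotient_map_from_composition[OF quotient_imp_continuous_map[OF q]
          continuous_compose_quotient_map[OF q quotient_imp_continuous_map]])
      (rule \<open>quotient_map Y X (?h \<circ> ?o)\<close>)
  then have "galois_cover X Y p \<longleftrightarrow> inj_on ?h (topspace (deck_quotient Y p))"
    using Y by (simp add: galois_cover_def homeomorphic_map_def)
  also have "\<dots> \<longleftrightarrow> (\<forall>y\<in>topspace Y. \<forall>z\<in>topspace Y. p y = p z \<longrightarrow> ?o y = ?o z)"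
    unfolding topspace_deck_quotient inj_on_def by (simp add: h)
  also have "\<dots> \<longleftrightarrow> (\<forall>y\<in>topspace Y. \<forall>z\<in>topspace Y. p y = p z \<longrightarrow> z \<in> ?o y)"
  proof
    assume eq: "\<forall>y\<in>topspace Y. \<forall>z\<in>topspace Y. p y = p z \<longrightarrow> ?o y = ?o z"
    show "\<forall>y\<in>topspace Y. \<forall>z\<in>topspace Y. p y = p z \<longrightarrow> z \<in> ?o y"
    proof (intro ballI impI)
      fix y z assume yz: "y \<in> topspace Y" "z \<in> topspace Y" "p y = p z"
      have "?o y = ?o z" by (rule eq[rule_format, OF yz])
      then show "z \<in> ?o y" using self_in_orbit_Deck[OF yz(2), of p] by simp
    qed
  next
    assume tr: "\<forall>y\<in>topspace Y. \<forall>z\<in>topspace Y. p y = p z \<longrightarrow> z \<in> ?o y"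
    \<comment> \<open>Orbits are compared with fibres instead of through the group laws of
      \<open>Deck\<close>: under transitivity each orbit is a whole fibre.\<close>
    have "?o y = fibre Y p (p y)" if y: "y \<in> topspace Y" for y
    proof
      show "?o y \<subseteq> fibre Y p (p y)"
      proof
        fix z assume "z \<in> ?o y"
        then obtain f where f: "f \<in> carrier (Deck Y p)" "z = f y" unfolding orbit_Deck by blast
        then show "z \<in> fibre Y p (p y)" using Cov_morphism_in_fibre[OF Deck_in_hm_Cov[OF f(1)], of y "p y"] y by simp
      qed
      show "fibre Y p (p y) \<subseteq> ?o y" using tr y by auto
    qed
    note o = this
    show "\<forall>y\<in>topspace Y. \<forall>z\<in>topspace Y. p y = p z \<longrightarrow> ?o y = ?o z"
    proof (intro ballI impI)
      fix y z assume yz: "y \<in> topspace Y" "z \<in> topspace Y" "p y = p z"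
      show "?o y = ?o z" unfolding o[OF yz(1)] o[OF yz(2)] yz(3) ..
    qed
  qed
  also have "\<dots> \<longleftrightarrow> (\<forall>y\<in>topspace Y. \<forall>z\<in>topspace Y. p y = p z \<longrightarrow> (\<exists>f\<in>carrier (Deck Y p). f y = z))"
    unfolding orbit_Deck by blast
  finally show ?thesis .
qed

text \<open>N is the stabilizer of a point of the fibre. Deck transformations commute with the
  monodromy and so preserve stabilizers; as they act transitively on the fibre, N equals all its
  conjugates.\<close>

lemma galois_cover_imp_normal_cosets:
  assumes conn: "connected_space X" and lpc: "locally_path_connected_space X" and x: "x \<in> topspace X"
    and gal: "galois_cover X Y p"
  shows "\<exists>N. N \<lhd> pi1 X x \<and> gset_isomorphic (pi1 X x) (fibre Y p x, monodromy X x Y p) (coset_gset (pi1 X x) N)"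
proof -
  let ?G = "pi1 X x" and ?\<phi> = "monodromy X x Y p"
  have Y: "connected_cover X Y p" and p: "cover X Y p"
    using gal by (simp_all add: galois_cover_def connected_cover_def)
  interpret group_action ?G "fibre Y p x" ?\<phi> by (rule group_action_monodromy[OF x p])
  interpret group ?G by (rule group_pi1[OF x])
  have "transitive_gset ?G (fibre Y p x, ?\<phi>)"
    using connected_cover_iff_transitive[OF conn lpc x p] Y by blast
  then have trans: "\<And>y z. \<lbrakk>y \<in> fibre Y p x; z \<in> fibre Y p x\<rbrakk> \<Longrightarrow> \<exists>c\<in>carrier ?G. ?\<phi> c y = z"
    and ne: "fibre Y p x \<noteq> {}"
    unfolding transitive_gset_def transitive_action_def transitive_action_axioms_def by blast+
  obtain y where y: "y \<in> fibre Y p x" using ne by blast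
  let ?N = "stabilizer ?G ?\<phi> y"
  have "g \<otimes>\<^bsub>?G\<^esub> h \<otimes>\<^bsub>?G\<^esub> inv\<^bsub>?G\<^esub> g \<in> ?N" if g: "g \<in> carrier ?G" and h: "h \<in> ?N" for g h
  proof -
    have h': "h \<in> carrier ?G" "?\<phi> h y = y" using h by (simp_all add: stabilizer_def)
    have ig: "inv\<^bsub>?G\<^esub> g \<in> carrier ?G" using g by simp
    let ?z = "?\<phi> (inv\<^bsub>?G\<^esub> g) y"
    have z: "?z \<in> fibre Y p x" by (rule monodromy_in_fibre[OF p ig y])
    have "\<forall>y\<in>topspace Y. \<forall>z\<in>topspace Y. p y = p z \<longrightarrow> (\<exists>f\<in>carrier (Deck Y p). f y = z)"
      using galois_cover_iff_transitive_Deck[OF conn lpc Y] gal by blast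
    from this[rule_format, of y ?z] have "\<exists>f\<in>carrier (Deck Y p). f y = ?z" using y z by simp
    then obtain f where f: "f \<in> carrier (Deck Y p)" "f y = ?z" ..
    \<comment> \<open>The deck transformation \<open>f\<close> carries the fixed point
      \<open>y\<close> of \<open>h\<close> to \<open>?z\<close>, which is then fixed as well; acting
      by \<open>g\<close> leads back to \<open>y\<close>.\<close>
    have "?\<phi> h ?z = ?z"
      using monodromy_morphism[OF p p Deck_in_hm_Cov[OF f(1)] h'(1) y] f(2) h'(2) by simp
    then have "?\<phi> (g \<otimes>\<^bsub>?G\<^esub> h \<otimes>\<^bsub>?G\<^esub> inv\<^bsub>?G\<^esub> g) y = ?\<phi> g ?z"
      using composition_rule[OF y m_closed[OF g h'(1)] ig] composition_rule[OF z g h'(1)] by simp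
    also have "\<dots> = y" using orbit_sym_aux[OF ig y refl] g by simp
    finally show ?thesis using g h'(1) by (simp add: stabilizer_def)
  qed
  then have "?N \<lhd> ?G" using stabilizer_subgroup[OF y] normal_inv_iff by blast
  moreover have "gset_isomorphic ?G (fibre Y p x, ?\<phi>) (coset_gset ?G ?N)"
    by (rule transitive_gset_isomorphic_cosets[OF group_action_axioms y trans[OF y]])
  ultimately show ?thesis by blast
qed

text \<open>With equal stabilizers, any two points of the fibre over x are related by an equivariant
  map, which extends to an endomorphism of the cover. The endomorphism constructed in the opposite
  direction is its inverse.\<close>

lemma normal_cosets_imp_galois_cover:
  assumes conn: "connected_space X" and lpc: "locally_path_connected_space X" and x: "x \<in> topspace X"
    and p: "cover X Y p" and N: "N \<lhd> pi1 X x"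
    and iso: "gset_isomorphic (pi1 X x) (fibre Y p x, monodromy X x Y p) (coset_gset (pi1 X x) N)"
  shows "galois_cover X Y p"
proof -
  let ?G = "pi1 X x" and ?\<phi> = "monodromy X x Y p" and ?F = "fibre Y p x"
  note action = group_action_monodromy[OF x p]
  note tr = gset_isomorphic_normal_cosets(1)[OF action N iso]
    and stab = gset_isomorphic_normal_cosets(2)[OF action N iso]
  have Y: "connected_cover X Y p" using connected_cover_iff_transitive[OF conn lpc x p] tr by blast
  then have Y_conn: "connected_space Y" by (simp add: connected_cover_def)
  have ta: "transitive_action ?G ?F ?\<phi>" using tr by (simp add: transitive_gset_def)
  have endo: "\<exists>f\<in>hm (Cov X) (Y, p) (Y, p). f y = z" if y: "y \<in> ?F" and z: "z \<in> ?F" for y z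
  proof -
    obtain h where h: "h \<in> equivariant ?G (?F, ?\<phi>) (?F, ?\<phi>)" "h y = z"
      using equivariant_map_with_value[OF ta y z] stab y z by blast
    obtain f where "f \<in> hm (Cov X) (Y, p) (Y, p)" "\<forall>w\<in>?F. f w = h w"
      using Fib_full[OF conn lpc x p p h(1)] by blast
    then show ?thesis using y h(2) by blast
  qed
  \<comment> \<open>The composite and the identity lift the same map \<open>p\<close> and agree at
    \<open>y\<close>, so they coincide on the connected space Y.\<close>
  have inverse: "g (f w) = w"
    if f: "f \<in> hm (Cov X) (Y, p) (Y, p)" and g: "g \<in> hm (Cov X) (Y, p) (Y, p)"
      and y: "y \<in> ?F" "g (f y) = y" and w: "w \<in> topspace Y" for f g y w
  proof -
    have f': "continuous_map Y Y f" "\<forall>y\<in>topspace Y. p (f y) = p y" using f by (simp_all add: hm_Cov)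
    have g': "continuous_map Y Y g" "\<forall>y\<in>topspace Y. p (g y) = p y" using g by (simp_all add: hm_Cov)
    have "(g \<circ> f) w = id w"
    proof (rule cover_lift_unique[OF p Y_conn continuous_map_compose[OF f'(1) g'(1)] continuous_map_id])
      show "p ((g \<circ> f) k) = p (id k)" if k: "k \<in> topspace Y" for k
      proof -
        have "f k \<in> topspace Y" using Cov_morphism_in_fibre[OF f, of k "p k"] k by simp
        then show ?thesis using f'(2) g'(2) k by simp
      qed
      show "y \<in> topspace Y" "(g \<circ> f) y = id y" using y by simp_all
    qed (rule w)
    then show ?thesis by simp
  qed
  have deck: "\<exists>f\<in>carrier (Deck Y p). f y = z" if y: "y \<in> ?F" and z: "z \<in> ?F" for y z
  proof -
    obtain f where f: "f \<in> hm (Cov X) (Y, p) (Y, p)" "f y = z" using endo[OF y z] by blast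
    obtain g where g: "g \<in> hm (Cov X) (Y, p) (Y, p)" "g z = y" using endo[OF z y] by blast
    have "homeomorphic_maps Y Y f g"
      using f g inverse[OF f(1) g(1) y] inverse[OF g(1) f(1) z] by (simp add: homeomorphic_maps_def hm_Cov)
    then have "homeomorphic_map Y Y f" by (rule homeomorphic_maps_imp_map)
    then have "f \<in> carrier (Deck Y p)" using f(1) by (simp add: carrier_Deck hm_Cov)
    then show ?thesis using f(2) by blast
  qed
  \<comment> \<open>Transport along \<gamma> carries any two points of one fibre to the fibre over
    x. A deck transformation relating their images also relates the points, since it commutes with
    transport back.\<close>
  have "\<exists>f\<in>carrier (Deck Y p). f y = z" if y: "y \<in> topspace Y" and z: "z \<in> topspace Y" and yz: "p y = p z" for y z
  proof -
    obtain \<gamma> where \<gamma>: "path_between X (p y) x \<gamma>"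
      using locally_path_connected_imp_path_between[OF conn lpc cover_in_topspace[OF p y] x] by blast
    have yz_fib: "y \<in> fibre Y p (p y)" "z \<in> fibre Y p (p y)" using y z yz by simp_all
    note ty = transport_in_fibre[OF p \<gamma> yz_fib(1)] and tz = transport_in_fibre[OF p \<gamma> yz_fib(2)]
    obtain f where f: "f \<in> carrier (Deck Y p)" "f (transport Y p \<gamma> y) = transport Y p \<gamma> z"
      using deck[OF ty tz] by blast
    note f_hm = Deck_in_hm_Cov[OF f(1), of X]
    have "f (transport Y p (path_reverse \<gamma>) (transport Y p \<gamma> y))
        = transport Y p (path_reverse \<gamma>) (f (transport Y p \<gamma> y))"
      using f_hm by (intro transport_morphism[OF p p _ _ path_between_reverse[OF \<gamma>] ty]) (simp_all add: hm_Cov)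
    then have "f y = z"
      using f(2) transport_reverse[OF p \<gamma> yz_fib(1)] transport_reverse[OF p \<gamma> yz_fib(2)] by simp
    then show ?thesis using f(1) by blast
  qed
  then show ?thesis using galois_cover_iff_transitive_Deck[OF conn lpc Y] by blast
qed

theorem theorem1p5p1:
  fixes X :: "'a topology" and x :: 'a
  assumes "connected_space X"
    and "locally_path_connected_space X"
    and "semilocally_simply_connected_space X"
    and "x \<in> topspace X"
    \<comment> \<open>the type \<open>'u\<close> plays the role of the universe of sets\<close>
    and "infinite (UNIV :: 'u set)"
    and "topspace X \<lesssim> (UNIV :: 'u set)"
  shows "equivalence_of_categories
           (Cov X :: ('u topology \<times> ('u \<Rightarrow> 'a), 'u \<Rightarrow> 'u) cat) (GSet (pi1 X x)) (Fib X x) \<and>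
         (\<forall>(Y, p) \<in> ob (Cov X :: ('u topology \<times> ('u \<Rightarrow> 'a), 'u \<Rightarrow> 'u) cat).
           connected_cover X Y p \<longleftrightarrow> transitive_gset (pi1 X x) (fob (Fib X x) (Y, p))) \<and>
         (\<forall>(Y, p) \<in> ob (Cov X :: ('u topology \<times> ('u \<Rightarrow> 'a), 'u \<Rightarrow> 'u) cat).
           galois_cover X Y p \<longleftrightarrow>
             (\<exists>N. N \<lhd> pi1 X x \<and>
                gset_isomorphic (pi1 X x) (fob (Fib X x) (Y, p)) (coset_gset (pi1 X x) N))) \<and>
         (\<forall>N. N \<lhd> pi1 X x \<longrightarrow>
           (\<exists>(Y, p) \<in> ob (Cov X :: ('u topology \<times> ('u \<Rightarrow> 'a), 'u \<Rightarrow> 'u) cat).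
             galois_cover X Y p \<and>
             gset_isomorphic (pi1 X x) (fob (Fib X x) (Y, p)) (coset_gset (pi1 X x) N)))"
proof (intro conjI)
  note conn = assms(1) and lpc = assms(2) and slsc = assms(3) and x = assms(4)
  let ?C = "Cov X :: ('u topology \<times> ('u \<Rightarrow> 'a), 'u \<Rightarrow> 'u) cat" and ?G = "pi1 X x"
  show "equivalence_of_categories ?C (GSet ?G) (Fib X x)"
  proof (rule equivalence_of_categoriesI[OF is_functor_Fib[OF x]])
    fix a b :: "'u topology \<times> ('u \<Rightarrow> 'a)"
    obtain Y p Z q where ab: "a = (Y, p)" "b = (Z, q)" by (cases a, cases b) blast
    assume "a \<in> ob ?C" "b \<in> ob ?C"
    then have p: "cover X Y p" and q: "cover X Z q" by (simp_all add: ab ob_Cov)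
    show "f = g" if "f \<in> hm ?C a b" "g \<in> hm ?C a b" and eq: "far (Fib X x) a b f = far (Fib X x) a b g" for f g
    proof (rule Fib_faithful[OF conn lpc x p q that(1,2)[unfolded ab]])
      fix y assume "y \<in> fibre Y p x"
      then show "f y = g y" using fun_cong[OF eq, of y] by (simp add: Fib_def ab)
    qed
    show "\<exists>f\<in>hm ?C a b. far (Fib X x) a b f = h" if "h \<in> hm (GSet ?G) (fob (Fib X x) a) (fob (Fib X x) b)" for h
    proof -
      have h: "h \<in> equivariant ?G (fibre Y p x, monodromy X x Y p) (fibre Z q x, monodromy X x Z q)"
        using that by (simp add: ab GSet_def)
      obtain f where f: "f \<in> hm ?C (Y, p) (Z, q)" "\<forall>y\<in>fibre Y p x. f y = h y"
        using Fib_full[OF conn lpc x p q h] by blast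
      have "h \<in> extensional (fibre Y p x)" using h by (simp add: equivariant_def PiE_iff)
      then have "restrict f (fibre Y p x) = h" using f(2) by (intro extensionalityI[of _ "fibre Y p x"]) simp_all
      then show ?thesis using f(1) by (intro bexI[of _ f]) (simp_all add: ab Fib_def)
    qed
  next
    fix d :: "'u set \<times> ((real \<Rightarrow> 'a) set \<Rightarrow> 'u \<Rightarrow> 'u)"
    obtain E \<phi> where d: "d = (E, \<phi>)" by (cases d)
    assume "d \<in> ob (GSet ?G)"
    then have action: "group_action ?G E \<phi>" by (simp add: d ob_GSet)
    have "E \<lesssim> (UNIV :: 'u set)" by (rule subset_imp_lepoll) simp
    then obtain Y :: "'u topology" and p where Y: "cover X Y p" "p \<in> extensional (topspace Y)"
      "gset_isomorphic ?G (fibre Y p x, monodromy X x Y p) (E, \<phi>)"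
      using exists_cover_with_fibre[OF conn lpc slsc x action times_lepoll_infinite[OF assms(5,6)]] by blast
    then obtain f where "iso_arrow (GSet ?G) (fob (Fib X x) (Y, p)) d f"
      using iso_arrow_GSet[OF group_action_monodromy[OF x Y(1)] action]
      unfolding gset_isomorphic_def d fob_Fib fst_conv by blast
    then show "\<exists>a\<in>ob ?C. \<exists>i. iso_arrow (GSet ?G) (fob (Fib X x) a) d i"
      using Y(1,2) ob_Cov[of Y p X] by blast
  qed
  show "\<forall>(Y, p)\<in>ob ?C. connected_cover X Y p \<longleftrightarrow> transitive_gset ?G (fob (Fib X x) (Y, p))"
  proof clarify
    fix Y :: "'u topology" and p assume "(Y, p) \<in> ob ?C"
    then have "cover X Y p" by (simp add: ob_Cov)
    from connected_cover_iff_transitive[OF conn lpc x this]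
    show "connected_cover X Y p \<longleftrightarrow> transitive_gset ?G (fob (Fib X x) (Y, p))" by simp
  qed
  show "\<forall>(Y, p)\<in>ob ?C. galois_cover X Y p \<longleftrightarrow>
      (\<exists>N. N \<lhd> ?G \<and> gset_isomorphic ?G (fob (Fib X x) (Y, p)) (coset_gset ?G N))"
  proof clarify
    fix Y :: "'u topology" and p assume "(Y, p) \<in> ob ?C"
    then have "cover X Y p" by (simp add: ob_Cov)
    then show "galois_cover X Y p \<longleftrightarrow>
      (\<exists>N. N \<lhd> ?G \<and> gset_isomorphic ?G (fob (Fib X x) (Y, p)) (coset_gset ?G N))"
      unfolding fob_Fib
      using galois_cover_imp_normal_cosets[OF conn lpc x] normal_cosets_imp_galois_cover[OF conn lpc x] by blast
  qed
  show "\<forall>N. N \<lhd> ?G \<longrightarrow> (\<exists>(Y, p)\<in>ob ?C. galois_cover X Y p \<and>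
      gset_isomorphic ?G (fob (Fib X x) (Y, p)) (coset_gset ?G N))"
  proof (intro allI impI)
    fix N assume N: "N \<lhd> ?G"
    have action: "group_action ?G (fst (coset_gset ?G N)) (snd (coset_gset ?G N))"
      by (rule group_action_coset_gset[OF group_pi1[OF x] normal_imp_subgroup[OF N]])
    \<comment> \<open>A coset space has sets of loop classes as points and so is no object of the
      target category; essential surjectivity does not reach it. It is counted through
      representatives and the bound on the fundamental group.\<close>
    have "fst (coset_gset ?G N) \<subseteq> (\<lambda>a. a <#\<^bsub>?G\<^esub> N) ` carrier ?G"
      by (auto simp: coset_gset_def LCOSETS_def)
    from subset_image_lepoll[OF this] pi1_lepoll_infinite[OF lpc slsc assms(5,6)]
    have "fst (coset_gset ?G N) \<lesssim> (UNIV :: 'u set)" by (rule lepoll_trans)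
    then obtain Y :: "'u topology" and p where Y: "cover X Y p" "p \<in> extensional (topspace Y)"
      "gset_isomorphic ?G (fibre Y p x, monodromy X x Y p) (fst (coset_gset ?G N), snd (coset_gset ?G N))"
      using exists_cover_with_fibre[OF conn lpc slsc x action times_lepoll_infinite[OF assms(5,6)]] by blast
    then have iso: "gset_isomorphic ?G (fob (Fib X x) (Y, p)) (coset_gset ?G N)" by simp
    have "galois_cover X Y p"
      using normal_cosets_imp_galois_cover[OF conn lpc x Y(1) N] iso by simp
    moreover have "(Y, p) \<in> ob ?C" using Y by (simp add: ob_Cov)
    ultimately show "\<exists>(Y, p)\<in>ob ?C. galois_cover X Y p \<and>
      gset_isomorphic ?G (fob (Fib X x) (Y, p)) (coset_gset ?G N)" using iso by blast
  qed
qed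

end
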